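(* Let $\phi$ be a nonconstant inner function on $\mathbb{D}^2$ and let $\alpha\in\mathbb{T}$. Assume that $J_\alpha\colon K_\phi\to L^2(\sigma_\alpha)$ is surjective and that $\vartheta^1_\alpha$ is bounded on $\mathbb{D}^2$. Then the operator $M_{z_1}$ on $L^2(\sigma_\alpha)$ satisfies $M_{z_1}=J_\alpha U^1_\alpha J_\alpha^*$, where $U^1_\alpha$ is a unitary operator on $K_\phi$ defined by $$U^1_\alpha=S^1_\phi+P_\phi P_{H^2_2}M_{\overline{\vartheta^1_\alpha}}.$$
   Context: $\mathbb{D}$ is the open unit disk, $\mathbb{T}$ the unit circle. $H^2(\mathbb{D}^2)$ is the Hardy space of holomorphic $f=\sum_{k,l\ge0}a_{k,l}z_1^kz_2^l$ on $\mathbb{D}^2$ with $\|f\|^2=\sum|a_{k,l}|^2<\infty$, identified via boundary values with a closed subspace of $L^2=L^2(\mathbb{T}^2)$ (normalized Lebesgue measure). A function $\phi$ is inner on $\mathbb{D}^2$ if it is bounded and holomorphic on $\mathbb{D}^2$ with non-tangential boundary values of modulus $1$ a.e. on $\mathbb{T}^2$. The model space is $K_\phi=H^2(\mathbb{D}^2)\ominus\phi H^2(\mathbb{D}^2)$; $P_\phi\colon H^2(\mathbb{D}^2)\to K_\phi$ is the orthogonal projection, and $S^1_\phi f=P_\phi(z_1f)$ for $f\in K_\phi$ is the compressed shift. $k_w(z)=\frac{1}{(1-z_1\bar w_1)(1-z_2\bar w_2)}$, and $k_w^\phi(z)=\frac{1-\phi(z)\overline{\phi(w)}}{(1-z_1\bar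 w_1)(1-z_2\bar w_2)}$ is the reproducing kernel of $K_\phi$. Clark measure: for $\alpha\in\mathbb{T}$, $\sigma_\alpha$ is the positive Borel measure on $\mathbb{T}^2$ with $\frac{1-|\phi(z)|^2}{|\alpha-\phi(z)|^2}=\int_{\mathbb{T}^2}P_{z_1}(\zeta_1)P_{z_2}(\zeta_2)\,d\sigma_\alpha(\zeta)$ for all $z\in\mathbb{D}^2$, where $P_{z_j}(\zeta_j)=\frac{1-|z_j|^2}{|\zeta_j-z_j|^2}$. Clark embedding: $J_\alpha\colon K_\phi\to L^2(\sigma_\alpha)$ is the linear isometry (known to exist, not necessarily surjective) determined by $J_\alpha k_w^\phi=(1-\alpha\overline{\phi(w)})\,k_w$ for all $w\in\mathbb{D}^2$. $M_{z_1}$ is multiplication by the coordinate $\zeta_1$ on $L^2(\sigma_\alpha)$. With $(B_1f)(z)=\frac{f(z)-f(0,z_2)}{z_1}$, the holomorphic function $\vartheta^1_\alpha$ on $\mathbb{D}^2$ is $\vartheta^1_\alpha(z)=\bar\alpha\,\frac{(B_1\phi)(z)}{1-\bar\alpha\phi(0,z_2)}$. When it is bounded, $M_{\overline{\vartheta^1_\alpha}}$ is multiplication on $L^2(\mathbb{T}^2)$ by the complex conjugate of (the boundary values of) $\vartheta^1_\alpha$. $H^2_2\subset H^2(\mathbb{D}^2)$ is the one-variable Hardy space $H^2(\mathbb{D})$ in the variable $z_2$, and $P_{H^2_2}$ is the orthogonal projection of $L^2(\mathbb{T}^2)$ onto $H^2_2$. *)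

theory Defs
  imports "HOL-Complex_Analysis.Complex_Analysis"
begin

type_synonym c2 = "complex \<times> complex"

definition bidisc :: "c2 set" where
  "bidisc = ball 0 1 \<times> ball 0 1"

definition torus :: "c2 set" where
  "torus = sphere 0 1 \<times> sphere 0 1"


subsection \<open>Square-integrable functions\<close>

text \<open>
  Elements of an \<open>L\<^sup>2\<close> space are represented by functions; two representatives are identified when
  they agree almost everywhere, so equations in \<open>L\<^sup>2\<close> are stated with \<open>AE\<close>.
\<close>

definition L2 :: "c2 measure \<Rightarrow> (c2 \<Rightarrow> complex) set" where
  "L2 M = {f \<in> borel_measurable M. integrable M (\<lambda>x. (cmod (f x))\<^sup>2)}"

definition L2_inner :: "c2 measure \<Rightarrow> (c2 \<Rightarrow> complex) \<Rightarrow> (c2 \<Rightarrow> complex) \<Rightarrow> complex" where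
  "L2_inner M f g = (\<integral>x. f x * cnj (g x) \<partial>M)"

definition L2_norm :: "c2 measure \<Rightarrow> (c2 \<Rightarrow> complex) \<Rightarrow> real" where
  "L2_norm M f = sqrt (\<integral>x. (cmod (f x))\<^sup>2 \<partial>M)"

text \<open>Normalized Lebesgue measure on the torus, parametrized by angles \<open>2\<pi>s\<close>, \<open>2\<pi>t\<close>.\<close>

definition torus_measure :: "c2 measure" where
  "torus_measure = completion (distr
     (restrict_space lborel ({0..<1::real} \<times> {0..<1::real}))
     (restrict_space borel torus)
     (\<lambda>(s, t). (cis (2 * pi * s), cis (2 * pi * t))))"


subsection \<open>The Hardy space of the bidisc\<close>

text \<open>
  Functions on the bidisc are total functions that vanish off the bidisc, so that equality of
  elements of the Hardy space is equality in HOL.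
\<close>

definition power_series2 :: "(nat \<times> nat \<Rightarrow> complex) \<Rightarrow> (c2 \<Rightarrow> complex) \<Rightarrow> bool" where
  "power_series2 a f \<longleftrightarrow>
     (\<forall>z\<in>bidisc. ((\<lambda>(k, l). a (k, l) * fst z ^ k * snd z ^ l) has_sum f z) UNIV)"

definition H2 :: "(c2 \<Rightarrow> complex) set" where
  "H2 = {f. (\<forall>z. z \<notin> bidisc \<longrightarrow> f z = 0) \<and>
            (\<exists>a. (\<lambda>n. (cmod (a n))\<^sup>2) summable_on UNIV \<and> power_series2 a f)}"

definition H2_coeff :: "(c2 \<Rightarrow> complex) \<Rightarrow> nat \<times> nat \<Rightarrow> complex" where
  "H2_coeff f = (THE a. (\<lambda>n. (cmod (a n))\<^sup>2) summable_on UNIV \<and> power_series2 a f)"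

definition H2_inner :: "(c2 \<Rightarrow> complex) \<Rightarrow> (c2 \<Rightarrow> complex) \<Rightarrow> complex" where
  "H2_inner f g = (\<Sum>\<^sub>\<infinity>n. H2_coeff f n * cnj (H2_coeff g n))"

definition H2_norm :: "(c2 \<Rightarrow> complex) \<Rightarrow> real" where
  "H2_norm f = sqrt (\<Sum>\<^sub>\<infinity>n. (cmod (H2_coeff f n))\<^sup>2)"

text \<open>Orthogonal projection of \<open>H2\<close> onto a closed subspace \<open>V\<close>.\<close>

definition H2_proj :: "(c2 \<Rightarrow> complex) set \<Rightarrow> (c2 \<Rightarrow> complex) \<Rightarrow> (c2 \<Rightarrow> complex)" where
  "H2_proj V f = (THE p. p \<in> V \<and> (\<forall>g\<in>V. H2_inner (\<lambda>z. f z - p z) g = 0))"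

text \<open>
  The identification of \<open>H2\<close> with a closed subspace of \<open>L\<^sup>2\<close> of the torus: the boundary function of
  \<open>f\<close> is the \<open>L\<^sup>2\<close> limit of the dilates \<open>\<zeta> \<mapsto> f (r\<zeta>)\<close> as \<open>r\<close> increases to 1.  It is determined up to
  a null set, and one representative is chosen.
\<close>

definition H2_boundary :: "(c2 \<Rightarrow> complex) \<Rightarrow> (c2 \<Rightarrow> complex)" where
  "H2_boundary f = (SOME F. F \<in> L2 torus_measure \<and>
     ((\<lambda>r. L2_norm torus_measure (\<lambda>\<zeta>. f (r *\<^sub>R \<zeta>) - F \<zeta>)) \<longlongrightarrow> 0) (at_left 1))"

definition hardy_disc :: "(complex \<Rightarrow> complex) set" where
  "hardy_disc = {h. \<exists>a. summable (\<lambda>n. (cmod (a n))\<^sup>2) \<and>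
                        (\<forall>w\<in>ball 0 1. (\<lambda>n. a n * w ^ n) sums h w)}"

text \<open>The one-variable Hardy space in the variable \<open>z\<^sub>2\<close>.\<close>

definition H22 :: "(c2 \<Rightarrow> complex) set" where
  "H22 = {f. \<exists>h\<in>hardy_disc. f = (\<lambda>z. if z \<in> bidisc then h (snd z) else 0)}"

text \<open>
  Orthogonal projection of \<open>L\<^sup>2\<close> of the torus onto \<open>H22\<close>; the value is the function on the bidisc
  rather than its boundary function.
\<close>

definition proj_H22 :: "(c2 \<Rightarrow> complex) \<Rightarrow> (c2 \<Rightarrow> complex)" where
  "proj_H22 G = (THE p. p \<in> H22 \<and>
     (\<forall>g\<in>H22. L2_inner torus_measure (\<lambda>\<zeta>. G \<zeta> - H2_boundary p \<zeta>) (H2_boundary g) = 0))"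


subsection \<open>Inner functions and model spaces\<close>

definition holomorphic2 :: "(c2 \<Rightarrow> complex) \<Rightarrow> bool" where
  "holomorphic2 f \<longleftrightarrow>
     (\<forall>z\<in>bidisc. \<exists>a b. (f has_derivative (\<lambda>h. a * fst h + b * snd h)) (at z))"

text \<open>Product of two Stolz regions of aperture \<open>c\<close>.\<close>

definition stolz :: "real \<Rightarrow> c2 \<Rightarrow> c2 set" where
  "stolz c \<zeta> = {z \<in> bidisc. cmod (fst z - fst \<zeta>) < c * (1 - cmod (fst z)) \<and>
                           cmod (snd z - snd \<zeta>) < c * (1 - cmod (snd z))}"

definition nontangential_limit :: "(c2 \<Rightarrow> complex) \<Rightarrow> c2 \<Rightarrow> complex \<Rightarrow> bool" where
  "nontangential_limit f \<zeta> L \<longleftrightarrow> (\<forall>c>1. (f \<longlongrightarrow> L) (at \<zeta> within stolz c \<zeta>))"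

text \<open>
  The boundary values of a bounded holomorphic function.  By Fatou's theorem the limit exists
  almost everywhere; at the exceptional points the value is arbitrary.  For bounded holomorphic
  functions this agrees almost everywhere with \<open>H2_boundary\<close>.
\<close>

definition boundary_value :: "(c2 \<Rightarrow> complex) \<Rightarrow> c2 \<Rightarrow> complex" where
  "boundary_value f \<zeta> = (THE L. nontangential_limit f \<zeta> L)"

definition inner_function :: "(c2 \<Rightarrow> complex) \<Rightarrow> bool" where
  "inner_function \<phi> \<longleftrightarrow> holomorphic2 \<phi> \<and> bounded (\<phi> ` bidisc) \<and>
     (AE \<zeta> in torus_measure. \<exists>L. nontangential_limit \<phi> \<zeta> L \<and> cmod L = 1)"

definition model_space :: "(c2 \<Rightarrow> complex) \<Rightarrow> (c2 \<Rightarrow> complex) set" where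
  "model_space \<phi> = {f \<in> H2. \<forall>h\<in>H2. H2_inner f (\<lambda>z. \<phi> z * h z) = 0}"

definition compressed_shift1 :: "(c2 \<Rightarrow> complex) \<Rightarrow> (c2 \<Rightarrow> complex) \<Rightarrow> (c2 \<Rightarrow> complex)" where
  "compressed_shift1 \<phi> f = H2_proj (model_space \<phi>) (\<lambda>z. fst z * f z)"

definition szego_kernel :: "c2 \<Rightarrow> c2 \<Rightarrow> complex" where
  "szego_kernel w z = 1 / ((1 - fst z * cnj (fst w)) * (1 - snd z * cnj (snd w)))"

definition model_kernel :: "(c2 \<Rightarrow> complex) \<Rightarrow> c2 \<Rightarrow> (c2 \<Rightarrow> complex)" where
  "model_kernel \<phi> w =
     (\<lambda>z. if z \<in> bidisc
          then (1 - \<phi> z * cnj (\<phi> w)) / ((1 - fst z * cnj (fst w)) * (1 - snd z * cnj (snd w)))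
          else 0)"


subsection \<open>Clark measures and Clark embeddings\<close>

definition poisson :: "complex \<Rightarrow> complex \<Rightarrow> real" where
  "poisson z \<zeta> = (1 - (cmod z)\<^sup>2) / (cmod (\<zeta> - z))\<^sup>2"

definition clark_measure :: "(c2 \<Rightarrow> complex) \<Rightarrow> complex \<Rightarrow> c2 measure \<Rightarrow> bool" where
  "clark_measure \<phi> \<alpha> \<sigma> \<longleftrightarrow> sets \<sigma> = sets (restrict_space borel torus) \<and>
     (\<forall>z\<in>bidisc. (\<integral>\<^sup>+ \<zeta>. ennreal (poisson (fst z) (fst \<zeta>) * poisson (snd z) (snd \<zeta>)) \<partial>\<sigma>) =
        ennreal ((1 - (cmod (\<phi> z))\<^sup>2) / (cmod (\<alpha> - \<phi> z))\<^sup>2))"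

text \<open>
  \<open>J\<close> is the Clark embedding of the model space into \<open>L\<^sup>2(\<sigma>)\<close>.  These conditions determine
  \<open>J f\<close> up to a \<open>\<sigma>\<close>-null set for every \<open>f\<close> in the model space.
\<close>

definition clark_embedding ::
  "(c2 \<Rightarrow> complex) \<Rightarrow> complex \<Rightarrow> c2 measure \<Rightarrow> ((c2 \<Rightarrow> complex) \<Rightarrow> (c2 \<Rightarrow> complex)) \<Rightarrow> bool" where
  "clark_embedding \<phi> \<alpha> \<sigma> J \<longleftrightarrow>
     (\<forall>f\<in>model_space \<phi>. J f \<in> L2 \<sigma> \<and> L2_norm \<sigma> (J f) = H2_norm f) \<and>
     (\<forall>f\<in>model_space \<phi>. \<forall>g\<in>model_space \<phi>.
        AE \<zeta> in \<sigma>. J (\<lambda>z. f z + g z) \<zeta> = J f \<zeta> + J g \<zeta>) \<and>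
     (\<forall>f\<in>model_space \<phi>. \<forall>c. AE \<zeta> in \<sigma>. J (\<lambda>z. c * f z) \<zeta> = c * J f \<zeta>) \<and>
     (\<forall>w\<in>bidisc. AE \<zeta> in \<sigma>.
        J (model_kernel \<phi> w) \<zeta> = (1 - \<alpha> * cnj (\<phi> w)) * szego_kernel w \<zeta>)"

definition surjective_onto_L2 ::
  "(c2 \<Rightarrow> complex) set \<Rightarrow> c2 measure \<Rightarrow> ((c2 \<Rightarrow> complex) \<Rightarrow> (c2 \<Rightarrow> complex)) \<Rightarrow> bool" where
  "surjective_onto_L2 V \<sigma> J \<longleftrightarrow> (\<forall>g\<in>L2 \<sigma>. \<exists>f\<in>V. AE \<zeta> in \<sigma>. J f \<zeta> = g \<zeta>)"

text \<open>Hilbert space adjoint of an operator \<open>J\<close> from \<open>V \<subseteq> H2\<close> to \<open>L\<^sup>2(\<sigma>)\<close>.\<close>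

definition L2_adjoint ::
  "(c2 \<Rightarrow> complex) set \<Rightarrow> c2 measure \<Rightarrow> ((c2 \<Rightarrow> complex) \<Rightarrow> (c2 \<Rightarrow> complex)) \<Rightarrow>
   (c2 \<Rightarrow> complex) \<Rightarrow> (c2 \<Rightarrow> complex)" where
  "L2_adjoint V \<sigma> J g = (THE f. f \<in> V \<and> (\<forall>h\<in>V. L2_inner \<sigma> (J h) g = H2_inner h f))"

definition unitary_on ::
  "(c2 \<Rightarrow> complex) set \<Rightarrow> ((c2 \<Rightarrow> complex) \<Rightarrow> (c2 \<Rightarrow> complex)) \<Rightarrow> bool" where
  "unitary_on V U \<longleftrightarrow> U ` V = V \<and>
     (\<forall>f\<in>V. \<forall>g\<in>V. U (\<lambda>z. f z + g z) = (\<lambda>z. U f z + U g z)) \<and>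
     (\<forall>f\<in>V. \<forall>c. U (\<lambda>z. c * f z) = (\<lambda>z. c * U f z)) \<and>
     (\<forall>f\<in>V. \<forall>g\<in>V. H2_inner (U f) (U g) = H2_inner f g)"


subsection \<open>The operator \<open>U\<^sup>1\<^sub>\<alpha>\<close>\<close>

text \<open>The quotient has a removable singularity at \<open>z\<^sub>1 = 0\<close>, filled by the partial derivative.\<close>

definition B1 :: "(c2 \<Rightarrow> complex) \<Rightarrow> c2 \<Rightarrow> complex" where
  "B1 f z = (if fst z = 0 then deriv (\<lambda>w. f (w, snd z)) 0
             else (f z - f (0, snd z)) / fst z)"

definition vartheta1 :: "(c2 \<Rightarrow> complex) \<Rightarrow> complex \<Rightarrow> c2 \<Rightarrow> complex" where
  "vartheta1 \<phi> \<alpha> z = cnj \<alpha> * (B1 \<phi> z / (1 - cnj \<alpha> * \<phi> (0, snd z)))"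

definition U1 :: "(c2 \<Rightarrow> complex) \<Rightarrow> complex \<Rightarrow> (c2 \<Rightarrow> complex) \<Rightarrow> (c2 \<Rightarrow> complex)" where
  "U1 \<phi> \<alpha> f = (\<lambda>z. compressed_shift1 \<phi> f z +
     H2_proj (model_space \<phi>)
       (proj_H22 (\<lambda>\<zeta>. cnj (boundary_value (vartheta1 \<phi> \<alpha>) \<zeta>) * H2_boundary f \<zeta>)) z)"

end

theory Submission
  imports Defs
begin

text \<open>
  Via the Clark embedding, multiplication by \<open>\<zeta>\<^sub>1\<close> becomes a unitary \<open>W\<close> of the model space.  Since
  \<open>cnj w\<^sub>1 * \<zeta>\<^sub>1 * k\<^sub>w = k\<^sub>w - k\<^sub>v\<close> with \<open>v = (0, w\<^sub>2)\<close> for the Szego kernels, evaluating \<open>W\<^sup>* g\<close> against the model kernels gives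
  \<open>w\<^sub>1 * (W\<^sup>* g)(w) = g w - g (0, w\<^sub>2) + w\<^sub>1 * vartheta1 w * g (0, w\<^sub>2)\<close>.  The right-hand side is what the adjoint of
  \<open>U1\<close> does: the shift contributes the difference quotient, and the Toeplitz term contributes
  \<open>vartheta1 * g (0, w\<^sub>2)\<close>.  Hence \<open>U1 = W\<close>.

  The analytic input is that \<open>vartheta1\<close> has nontangential boundary values almost everywhere.  This
  needs no form of Fatou's theorem: those of \<open>\<phi>\<close> are given, those of \<open>\<phi> (0, z\<^sub>2)\<close> follow from the mean
  value property, and they differ from \<open>\<alpha>\<close> almost everywhere.
\<close>

section \<open>Lebesgue measure on the torus\<close>

text \<open>The inner product of \<open>H2\<close> is given by coefficients, whereas
  \<open>U1\<close> is built from boundary functions and nontangential limits. The two meet in the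
  dilates f(r \<zeta>): for r < 1 these are uniformly convergent series on the torus, and letting r
  tend to 1 yields coefficients on one side and boundary functions on the other. Projections and
  boundary values are defined by \<open>THE\<close> or \<open>SOME\<close>, so each must be shown to
  exist; the projections come from adjoints of multiplication operators.

  The origin of \<open>vartheta1\<close> is the normalising factor of the Clark embedding, which is
  1 - \<alpha> cnj (\<phi> w) at w and 1 - \<alpha> cnj (\<phi> v) at v. The quotient of their
  conjugates is 1 - w1 * vartheta1 w.

  Surjectivity of \<open>J\<close> brings both \<zeta>1 * J f and cnj \<zeta>1 * J g into the range
  of \<open>J\<close>. The first gives the image of f under W, the second gives the vector against
  which its inner products are computed.\<close>

definition torus_param :: "real \<times> real \<Rightarrow> c2" where
  "torus_param = (\<lambda>(s, t). (cis (2 * pi * s), cis (2 * pi * t)))"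

definition unit_square :: "(real \<times> real) measure" where
  "unit_square = restrict_space lborel ({0..<1} \<times> {0..<1})"

lemma cis_measurable [measurable]: "(\<lambda>s::real. cis (2 * pi * s)) \<in> borel_measurable borel"
  by (intro borel_measurable_continuous_onI continuous_intros)

lemma torus_param_measurable [measurable]:
  "torus_param \<in> measurable unit_square (restrict_space borel torus)"
  unfolding unit_square_def torus_param_def
proof (intro measurable_restrict_space2 measurable_restrict_space1)
  show "(\<lambda>(s, t). (cis (2 * pi * s), cis (2 * pi * t)))
    \<in> space (restrict_space lborel ({0..<1} \<times> {0..<1})) \<rightarrow> torus"
    by (auto simp: torus_def)
  show "(\<lambda>(s, t). (cis (2 * pi * s), cis (2 * pi * t))) \<in> borel_measurable lborel"
    by (simp add: borel_prod[symmetric] lborel_prod[symmetric] case_prod_beta')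
qed

abbreviation \<mu> :: "c2 measure" where
  "\<mu> \<equiv> torus_measure"

lemma torus_measure_alt:
  "\<mu> = completion (distr unit_square (restrict_space borel torus) torus_param)"
  by (simp add: torus_measure_def unit_square_def torus_param_def)

lemma space_unit_square [simp]: "space unit_square = {0..<1} \<times> {0..<1}"
  by (simp add: unit_square_def space_restrict_space)

lemma square_measurable: "{0..<1::real} \<times> {0..<1::real} \<in> sets lborel"
  by (simp add: borel_Times)

lemma emeasure_unit_square: "emeasure unit_square (space unit_square) = 1"
proof -
  have "emeasure (lborel \<Otimes>\<^sub>M lborel) ({0..<1::real} \<times> {0..<1::real}) = 1"
    by (subst lborel.emeasure_pair_measure_Times) auto
  then show ?thesis
    using square_measurable by (simp add: unit_square_def emeasure_restrict_space space_restrict_space lborel_prod)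
qed

lemma finite_measure_unit_square: "finite_measure unit_square"
  by standard (simp add: emeasure_unit_square[simplified])

lemma finite_measure_torus: "finite_measure \<mu>"
  and emeasure_torus: "emeasure \<mu> torus = 1"
proof -
  have "torus_param -` torus \<inter> space unit_square = space unit_square"
    by (auto simp: torus_param_def torus_def)
  moreover have tor': "torus \<in> sets (restrict_space borel torus)"
    using sets.top[of "restrict_space borel torus"] by (simp add: space_restrict_space)
  ultimately have "emeasure (distr unit_square (restrict_space borel torus) torus_param) torus = 1"
    using emeasure_unit_square by (subst emeasure_distr) simp_all
  moreover have tor: "torus \<in> sets (distr unit_square (restrict_space borel torus) torus_param)"
    using tor' by simp
  ultimately show "emeasure \<mu> torus = 1"
    unfolding torus_measure_alt
    by (simp only: emeasure_completion[OF sets_completionI_sets[OF tor]] main_part[OF tor])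
  then show "finite_measure \<mu>"
    by (intro finite_measureI) (simp add: torus_measure_alt space_restrict_space)
qed

lemma space_torus_measure [simp]: "space \<mu> = torus"
  by (simp add: torus_measure_alt space_restrict_space)

lemma borel_measurable_torus [measurable (raw)]:
  assumes "f \<in> borel_measurable (restrict_space borel torus)"
  shows "f \<in> borel_measurable \<mu>"
  unfolding torus_measure_alt by (rule measurable_completion) (use assms in simp)

lemma fst_measurable_restrict [measurable]: "fst \<in> borel_measurable (restrict_space (borel :: c2 measure) T)"
  and snd_measurable_restrict [measurable]: "snd \<in> borel_measurable (restrict_space (borel :: c2 measure) T)"
  by (rule measurable_restrict_space1,
      rule borel_measurable_continuous_onI, intro continuous_intros)+

lemma fst_measurable_torus [measurable]: "fst \<in> borel_measurable \<mu>"
  and snd_measurable_torus [measurable]: "snd \<in> borel_measurable \<mu>"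
  by (rule borel_measurable_torus, simp)+

lemma AE_unit_square_iff:
  "(AE st in unit_square. P st) \<longleftrightarrow>
    (AE st in lborel \<Otimes>\<^sub>M lborel. st \<in> {0..<1} \<times> {0..<1} \<longrightarrow> P st)"
  unfolding unit_square_def lborel_prod
  by (rule AE_restrict_space_iff) (simp only: square_measurable space_lborel space_borel Int_UNIV_right)

lemma AE_unit_square_fst:
  assumes "AE s in lborel. s \<in> {0..<1} \<longrightarrow> P s"
  shows "AE st in unit_square. P (fst st)"
proof -
  obtain N where N: "N \<in> null_sets lborel"
    "{s \<in> space lborel. \<not> (s \<in> {0..<1} \<longrightarrow> P s)} \<subseteq> N"
    using assms unfolding eventually_ae_filter by blast
  show ?thesis
    unfolding AE_unit_square_iff
  proof (rule AE_I')
    show "N \<times> (UNIV :: real set) \<in> null_sets (lborel \<Otimes>\<^sub>M (lborel :: real measure))"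
      using N(1) unfolding null_sets_def
      by (simp add: lborel.emeasure_pair_measure_Times del: lborel_prod)
  qed (use N(2) in \<open>fastforce simp del: lborel_prod\<close>)
qed

lemma AE_unit_square_snd:
  assumes "AE t in lborel. t \<in> {0..<1} \<longrightarrow> P t"
  shows "AE st in unit_square. P (snd st)"
proof -
  obtain N where N: "N \<in> null_sets lborel"
    "{t \<in> space lborel. \<not> (t \<in> {0..<1} \<longrightarrow> P t)} \<subseteq> N"
    using assms unfolding eventually_ae_filter by blast
  show ?thesis
    unfolding AE_unit_square_iff
  proof (rule AE_I')
    show "(UNIV :: real set) \<times> N \<in> null_sets (lborel \<Otimes>\<^sub>M (lborel :: real measure))"
      using N(1) unfolding null_sets_def
      by (simp add: lborel.emeasure_pair_measure_Times del: lborel_prod)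
  qed (use N(2) in \<open>fastforce simp del: lborel_prod\<close>)
qed

lemma AE_torus_measure_iff:
  "(AE x in \<mu>. P x) \<longleftrightarrow>
    (AE x in distr unit_square (restrict_space borel torus) torus_param. P x)"
  unfolding torus_measure_alt AE_completion_iff ..

text \<open>Fubini for null sets, phrased without a separate measure on the circle: only the first
  coordinate of the inner point and the second coordinate of the outer one enter, so both variables
  may range over the torus.\<close>

lemma AE_torus_Fubini:
  assumes "AE p in \<mu>. P p"
  shows "AE \<eta> in \<mu>. AE p in \<mu>. P (fst p, snd \<eta>)"
proof -
  let ?T = "distr unit_square (restrict_space borel torus) torus_param"
  interpret U: finite_measure unit_square by (rule finite_measure_unit_square)
  interpret T: finite_measure ?T by (rule U.finite_measure_distr) simp
  obtain N where N: "\<And>p. p \<in> torus \<Longrightarrow> p \<notin> N \<Longrightarrow> P p" "N \<in> null_sets ?T"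
  proof -
    have "AE p in ?T. P p"
      using assms by (rule AE_torus_measure_iff[THEN iffD1])
    then obtain N where N: "N \<in> null_sets ?T" "{p \<in> space ?T. \<not> P p} \<subseteq> N"
      by (rule eventually_ae_filter[THEN iffD1, THEN bexE])
    have "space ?T = torus"
      by (simp only: space_distr space_restrict_space space_borel Int_UNIV_right)
    with N show thesis
      by (intro that[of N]) blast+
  qed
  have N_sets: "N \<in> sets (restrict_space borel torus)"
    using N(2) by (auto simp: null_sets_def)
  define e where "e \<eta> = emeasure ?T {p \<in> torus. (fst p, snd \<eta>) \<in> N}" for \<eta> :: c2
  have swap: "(\<lambda>(\<eta>, p). (fst p, snd \<eta>)) \<in>
    measurable (restrict_space borel torus \<Otimes>\<^sub>M ?T) (restrict_space borel torus)"
  proof (rule measurable_restrict_space2)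
    show "(\<lambda>(\<eta>, p). (fst p, snd \<eta>)) \<in> space (restrict_space borel torus \<Otimes>\<^sub>M ?T) \<rightarrow> torus"
      by (auto simp: space_pair_measure space_restrict_space torus_def)
    have 1: "fst \<in> borel_measurable ?T" by simp
    show "(\<lambda>(\<eta>, p). (fst p, snd \<eta>)) \<in> borel_measurable (restrict_space borel torus \<Otimes>\<^sub>M ?T)"
      unfolding case_prod_beta'
      by (intro borel_measurable_Pair measurable_compose[OF measurable_snd 1]
        measurable_compose[OF measurable_fst snd_measurable_restrict])
  qed
  have "(\<lambda>\<eta>. emeasure ?T (Pair \<eta> -` ((\<lambda>(\<eta>, p). (fst p, snd \<eta>)) -` N \<inter>
      space (restrict_space borel torus \<Otimes>\<^sub>M ?T)))) \<in> borel_measurable (restrict_space borel torus)"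
    by (intro T.measurable_emeasure_Pair measurable_sets[OF swap] N_sets)
  also have "?this \<longleftrightarrow> e \<in> borel_measurable (restrict_space borel torus)"
  proof (intro measurable_cong)
    fix \<eta> :: c2 assume "\<eta> \<in> space (restrict_space borel torus)"
    then have "Pair \<eta> -` ((\<lambda>(\<eta>, p). (fst p, snd \<eta>)) -` N \<inter> space (restrict_space borel torus \<Otimes>\<^sub>M ?T))
      = {p \<in> torus. (fst p, snd \<eta>) \<in> N}"
      by (auto simp: space_pair_measure space_restrict_space)
    then show "emeasure ?T (Pair \<eta> -` ((\<lambda>(\<eta>, p). (fst p, snd \<eta>)) -` N \<inter>
      space (restrict_space borel torus \<Otimes>\<^sub>M ?T))) = e \<eta>"
      by (simp add: e_def)
  qed
  finally have e_meas [measurable]: "e \<in> borel_measurable (restrict_space borel torus)" .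
  have slice: "{p \<in> torus. (fst p, snd \<eta>) \<in> N} \<in> sets (restrict_space borel torus)"
    if "\<eta> \<in> torus" for \<eta>
  proof -
    have "(\<lambda>p. (fst p, snd \<eta>)) \<in> measurable (restrict_space borel torus) (restrict_space borel torus)"
      using that by (intro measurable_restrict_space3 borel_measurable_continuous_onI continuous_intros)
        (auto simp: torus_def)
    from measurable_sets[OF this N_sets] show ?thesis
      by (simp add: vimage_def Int_def space_restrict_space conj_commute)
  qed
  have "AE st in unit_square. torus_param st \<notin> N"
    using AE_distrD[OF torus_param_measurable AE_not_in[OF N(2)]] .
  then have "AE st in lborel \<Otimes>\<^sub>M lborel. st \<in> {0..<1} \<times> {0..<1} \<longrightarrow> torus_param st \<notin> N"
    by (simp add: AE_unit_square_iff)
  \<comment> \<open>\<open>AE_pair\<close> freezes the first coordinate, but here the second one is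
    to be frozen; hence the swap.\<close>
  then have "AE st in distr (lborel \<Otimes>\<^sub>M lborel) (lborel \<Otimes>\<^sub>M lborel) (\<lambda>(x, y). (y, x)).
      st \<in> {0..<1} \<times> {0..<1} \<longrightarrow> torus_param st \<notin> N"
    by (simp only: lborel_pair.distr_pair_swap[symmetric])
  from AE_distrD[OF measurable_pair_swap' this]
  have "AE ts in lborel \<Otimes>\<^sub>M lborel. (snd ts, fst ts) \<in> {0..<1} \<times> {0..<1} \<longrightarrow>
      torus_param (snd ts, fst ts) \<notin> N"
    by (simp add: case_prod_beta')
  then have "AE t in lborel. AE s in lborel.
      (s, t) \<in> {0..<1} \<times> {0..<1} \<longrightarrow> torus_param (s, t) \<notin> N"
    by (auto dest: lborel_pair.AE_pair)
  then have "AE t in lborel. t \<in> {0..<1} \<longrightarrow>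
      (AE s in lborel. s \<in> {0..<1} \<longrightarrow> torus_param (s, t) \<notin> N)"
    by eventually_elim auto
  then have "AE t in lborel. t \<in> {0..<1} \<longrightarrow>
      (AE st in unit_square. torus_param (fst st, t) \<notin> N)"
    by eventually_elim (auto intro!: AE_unit_square_fst)
  then have *: "AE \<eta> in unit_square. AE p in unit_square. torus_param (fst p, snd \<eta>) \<notin> N"
    by (rule AE_unit_square_snd)
  have "AE \<eta> in unit_square. e (torus_param \<eta>) = 0"
    using *
  proof (rule AE_mp, intro AE_I2 impI)
    fix \<eta> assume \<eta>: "\<eta> \<in> space unit_square" and
      ae: "AE p in unit_square. torus_param (fst p, snd \<eta>) \<notin> N"
    have "torus_param \<eta> \<in> torus" by (auto simp: torus_param_def torus_def split: prod.split)
    then have "e (torus_param \<eta>) =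
      emeasure unit_square (torus_param -` {p \<in> torus. (fst p, snd (torus_param \<eta>)) \<in> N} \<inter> space unit_square)"
      unfolding e_def by (intro emeasure_distr slice) auto
    also have "torus_param -` {p \<in> torus. (fst p, snd (torus_param \<eta>)) \<in> N} \<inter> space unit_square
      = {p \<in> space unit_square. \<not> torus_param (fst p, snd \<eta>) \<notin> N}"
      by (auto simp: torus_param_def torus_def split: prod.splits)
    also have "emeasure unit_square \<dots> = 0"
      by (rule AE_E2[OF ae])
    finally show "e (torus_param \<eta>) = 0" .
  qed
  then have "AE \<eta> in ?T. e \<eta> = 0"
    using measurable_sets[OF e_meas, of "{0}"]
    by (subst AE_distr_iff) (simp_all add: space_restrict_space vimage_def Int_def conj_commute)
  then have "AE \<eta> in \<mu>. e \<eta> = 0"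
    by (simp add: AE_torus_measure_iff)
  with AE_space[of \<mu>] show ?thesis
  proof eventually_elim
    case \<eta>: (elim \<eta>)
    have "AE p in ?T. P (fst p, snd \<eta>)"
    proof (rule AE_I')
      show "{p \<in> torus. (fst p, snd \<eta>) \<in> N} \<in> null_sets ?T"
        using \<eta> slice[of \<eta>] by (simp add: null_sets_def e_def)
      show "{p \<in> space ?T. \<not> P (fst p, snd \<eta>)} \<subseteq> {p \<in> torus. (fst p, snd \<eta>) \<in> N}"
      proof
        fix p assume "p \<in> {p \<in> space ?T. \<not> P (fst p, snd \<eta>)}"
        then have "p \<in> torus" "\<not> P (fst p, snd \<eta>)" by (simp_all add: space_restrict_space)
        moreover from this \<eta> have "(fst p, snd \<eta>) \<in> torus" by (simp add: torus_def mem_Times_iff)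
        ultimately show "p \<in> {p \<in> torus. (fst p, snd \<eta>) \<in> N}" using N(1) by blast
      qed
    qed
    then show "AE p in \<mu>. P (fst p, snd \<eta>)"
      by (simp add: AE_torus_measure_iff)
  qed
qed

section \<open>Fourier orthogonality on the torus\<close>

lemma integral_cis:
  fixes k :: int
  shows "(LINT s|lborel. indicator {0..<1} s *\<^sub>R cis (2 * pi * (of_int k * s))) = of_bool (k = 0)"
proof (cases "k = 0")
  case False
  define c :: complex where "c = \<i> * (2 * pi * of_int k)"
  have c: "c \<noteq> 0" "cis (2 * pi * (of_int k * s)) = exp (c * of_real s)" for s :: real
    using False by (simp_all add: c_def cis_conv_exp mult_ac)
  let ?F = "\<lambda>s::real. exp (c * of_real s) / c"
  \<comment> \<open>The endpoint 1 is a null set; the fundamental theorem of calculus is applied on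
    the closed interval.\<close>
  have "(LINT s|lborel. indicator {0..<1} s *\<^sub>R cis (2 * pi * (of_int k * s))) =
      (LINT s|lborel. indicator {0..1} s *\<^sub>R cis (2 * pi * (of_int k * s)))"
  proof (rule integral_cong_AE)
    show "AE s in lborel. indicator {0..<1} s *\<^sub>R cis (2 * pi * (of_int k * s)) =
        indicator {0..1} s *\<^sub>R cis (2 * pi * (of_int k * s))"
      using AE_lborel_singleton[of "1::real"] by eventually_elim (auto simp: indicator_def)
  qed (auto intro!: borel_measurable_scaleR borel_measurable_continuous_onI continuous_intros)
  also have "\<dots> = ?F 1 - ?F 0"
    unfolding c(2)
  proof (rule integral_FTC_Icc)
    fix x :: real
    have "((\<lambda>s. exp (c * s) / c) has_field_derivative exp (c * x)) (at (of_real x))"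
      using c(1) by (auto intro!: derivative_eq_intros)
    then show "(?F has_vector_derivative exp (c * of_real x)) (at x within {0..1})"
      by (rule has_vector_derivative_real_field)
  next
    show "continuous_on {0..1} (\<lambda>x::real. exp (c * of_real x))"
      by (intro continuous_intros)
  qed simp
  also have "\<dots> = 0"
    using c(2)[of 1] cis_multiple_2pi[of "of_int k"] by simp
  finally show ?thesis using False by simp
qed simp

lemma cnj_measurable [measurable]: "cnj \<in> borel_measurable borel"
  by (intro borel_measurable_continuous_onI continuous_on_cnj continuous_on_id)

definition mono2 :: "nat \<times> nat \<Rightarrow> c2 \<Rightarrow> complex" where
  "mono2 n z = fst z ^ fst n * snd z ^ snd n"

lemma mono2_measurable_restrict: "mono2 n \<in> borel_measurable (restrict_space (borel :: c2 measure) T)"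
  unfolding mono2_def by measurable

lemma mono2_measurable [measurable]: "mono2 n \<in> borel_measurable \<mu>"
  by (rule borel_measurable_torus, rule mono2_measurable_restrict)

lemma norm_mono2_torus: "x \<in> torus \<Longrightarrow> cmod (mono2 n x) = 1"
  by (auto simp: mono2_def torus_def norm_mult norm_power)

lemma integral_torus:
  fixes f :: "c2 \<Rightarrow> complex"
  assumes f: "f \<in> borel_measurable (restrict_space borel torus)"
  shows "(\<integral>x. f x \<partial>\<mu>) =
    (\<integral>st. indicator ({0..<1} \<times> {0..<1}) st *\<^sub>R f (torus_param st) \<partial>(lborel \<Otimes>\<^sub>M lborel))"
proof -
  let ?T = "distr unit_square (restrict_space borel torus) torus_param"
  have "(\<integral>x. f x \<partial>\<mu>) = (\<integral>x. f x \<partial>?T)"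
    unfolding torus_measure_alt by (rule integral_completion) (use f in simp)
  also have "\<dots> = (\<integral>st. f (torus_param st) \<partial>unit_square)"
    by (rule integral_distr[OF torus_param_measurable f])
  also have "\<dots> = (\<integral>st. indicator ({0..<1} \<times> {0..<1}) st *\<^sub>R f (torus_param st) \<partial>lborel)"
    unfolding unit_square_def
    by (rule integral_restrict_space)
      (simp only: square_measurable space_lborel space_borel Int_UNIV_right)
  finally show ?thesis by (simp only: lborel_prod)
qed

lemma cis_power_mult_cnj:
  fixes x :: real and k l :: nat
  shows "cis x ^ k * cnj (cis x ^ l) = cis (of_int (int k - int l) * x)"
proof -
  have "cnj (cis x ^ l) = cis (- (real l * x))"
    by (subst Complex.DeMoivre) (rule cis_cnj)
  then show ?thesis
    by (simp only: Complex.DeMoivre[of x k] cis_mult) (simp add: algebra_simps)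
qed

lemma mono2_orthonormal:
  "(\<integral>x. mono2 n x * cnj (mono2 m x) \<partial>\<mu>) = of_bool (n = m)"
proof -
  define k l where "k = int (fst n) - int (fst m)" and "l = int (snd n) - int (snd m)"
  define e where "e j s = indicator {0..<1} s *\<^sub>R cis (2 * pi * (of_int j * s))" for j :: int and s :: real
  have e_meas: "e j \<in> borel_measurable lborel" for j
    unfolding e_def by (simp, measurable)
  have e_int: "integrable (lborel \<Otimes>\<^sub>M lborel) (\<lambda>st. e k (fst st) * e l (snd st))"
  proof (rule integrableI_bounded_set[where B = 1 and A = "{0..<1} \<times> {0..<1}"])
    show "(\<lambda>st. e k (fst st) * e l (snd st)) \<in> borel_measurable (lborel \<Otimes>\<^sub>M lborel)"
      by (intro borel_measurable_times measurable_compose[OF measurable_fst e_meas]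
        measurable_compose[OF measurable_snd e_meas])
    show "{0..<1::real} \<times> {0..<1::real} \<in> sets (lborel \<Otimes>\<^sub>M lborel)"
      unfolding lborel_prod by (rule square_measurable)
    show "emeasure (lborel \<Otimes>\<^sub>M lborel) ({0..<1::real} \<times> {0..<1::real}) < \<infinity>"
      by (subst lborel.emeasure_pair_measure_Times) auto
  qed (auto simp: e_def norm_mult indicator_def intro!: AE_I2)
  have *: "indicator ({0..<1} \<times> {0..<1}) st *\<^sub>R
      (mono2 n (torus_param st) * cnj (mono2 m (torus_param st))) = e k (fst st) * e l (snd st)" for st
  proof -
    have "mono2 n (torus_param st) * cnj (mono2 m (torus_param st)) =
      (cis (2 * pi * fst st) ^ fst n * cnj (cis (2 * pi * fst st) ^ fst m)) *
      (cis (2 * pi * snd st) ^ snd n * cnj (cis (2 * pi * snd st) ^ snd m))"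
      by (simp add: mono2_def torus_param_def case_prod_beta mult_ac)
    also have "\<dots> = cis (2 * pi * (of_int k * fst st)) * cis (2 * pi * (of_int l * snd st))"
      unfolding cis_power_mult_cnj k_def l_def by (simp add: mult_ac)
    finally show ?thesis
      by (cases st) (simp add: e_def indicator_times)
  qed
  have "(\<integral>x. mono2 n x * cnj (mono2 m x) \<partial>\<mu>) =
      (\<integral>st. e k (fst st) * e l (snd st) \<partial>(lborel \<Otimes>\<^sub>M lborel))"
    by (subst integral_torus)
      (simp_all only: * borel_measurable_times mono2_measurable_restrict
         measurable_compose[OF mono2_measurable_restrict cnj_measurable])
  also have "\<dots> = (\<integral>s. (\<integral>t. e k (fst (s, t)) * e l (snd (s, t)) \<partial>lborel) \<partial>lborel)"
    by (rule lborel_pair.integral_fst'[symmetric])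
      (rule e_int)
  also have "\<dots> = (\<integral>s. e k s \<partial>lborel) * (\<integral>t. e l t \<partial>lborel)"
    by simp
  also have "\<dots> = of_bool (k = 0) * of_bool (l = 0)"
    unfolding e_def by (simp only: integral_cis)
  also have "\<dots> = of_bool (n = m)"
    by (auto simp: k_def l_def prod_eq_iff)
  finally show ?thesis .
qed

section \<open>Square-integrable functions\<close>

lemma norm_mult_le_squares: "cmod a * cmod b \<le> (cmod a)\<^sup>2 + (cmod b)\<^sup>2"
proof -
  have "2 * (cmod a * cmod b) \<le> (cmod a)\<^sup>2 + (cmod b)\<^sup>2"
    using zero_le_power2[of "cmod a - cmod b"] by (simp add: power2_diff)
  moreover have "0 \<le> cmod a * cmod b" by simp
  ultimately show ?thesis by linarith
qed

lemma norm_add_square_le: "(cmod (a + b))\<^sup>2 \<le> 2 * (cmod a)\<^sup>2 + 2 * (cmod b)\<^sup>2"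
proof -
  have "(cmod (a + b))\<^sup>2 \<le> (cmod a + cmod b)\<^sup>2"
    by (intro power_mono norm_triangle_ineq) simp
  also have "\<dots> \<le> 2 * (cmod a)\<^sup>2 + 2 * (cmod b)\<^sup>2"
    using zero_le_power2[of "cmod a - cmod b"] by (simp add: power2_diff power2_sum)
  finally show ?thesis .
qed

lemma L2_measurable: "f \<in> L2 M \<Longrightarrow> f \<in> borel_measurable M"
  by (simp add: L2_def)

lemma L2_square_integrable: "f \<in> L2 M \<Longrightarrow> integrable M (\<lambda>x. (cmod (f x))\<^sup>2)"
  by (simp add: L2_def)

lemma L2_product_integrable:
  assumes "f \<in> L2 M" "g \<in> L2 M"
  shows "integrable M (\<lambda>x. cmod (f x) * cmod (g x))"
proof -
  note [measurable] = assms[THEN L2_measurable]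
  show ?thesis
    by (rule Bochner_Integration.integrable_bound[OF
      Bochner_Integration.integrable_add[OF assms[THEN L2_square_integrable]]])
      (auto simp: norm_mult_le_squares)
qed

lemma L2_inner_integrable:
  assumes "f \<in> L2 M" "g \<in> L2 M"
  shows "integrable M (\<lambda>x. f x * cnj (g x))"
proof -
  note [measurable] = assms[THEN L2_measurable]
  show ?thesis
    by (rule Bochner_Integration.integrable_bound[OF L2_product_integrable[OF assms]])
      (auto simp: norm_mult)
qed

lemma L2_add:
  assumes "f \<in> L2 M" "g \<in> L2 M"
  shows "(\<lambda>x. f x + g x) \<in> L2 M"
proof -
  note [measurable] = assms[THEN L2_measurable]
  have "integrable M (\<lambda>x. (cmod (f x + g x))\<^sup>2)"
    by (rule Bochner_Integration.integrable_bound[where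
      f = "\<lambda>x. 2 * (cmod (f x))\<^sup>2 + 2 * (cmod (g x))\<^sup>2"])
      (auto intro!: Bochner_Integration.integrable_add integrable_mult_right
         L2_square_integrable assms norm_add_square_le)
  then show ?thesis by (simp add: L2_def)
qed

lemma L2_bounded_mult:
  assumes [measurable]: "u \<in> borel_measurable M" and "AE x in M. cmod (u x) \<le> C" and f: "f \<in> L2 M"
  shows "(\<lambda>x. u x * f x) \<in> L2 M"
proof -
  note [measurable] = L2_measurable[OF f]
  have "integrable M (\<lambda>x. (cmod (u x * f x))\<^sup>2)"
  proof (rule Bochner_Integration.integrable_bound)
    show "integrable M (\<lambda>x. C\<^sup>2 * (cmod (f x))\<^sup>2)"
      by (intro integrable_mult_right L2_square_integrable f)
    show "AE x in M. norm ((cmod (u x * f x))\<^sup>2) \<le> norm (C\<^sup>2 * (cmod (f x))\<^sup>2)"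
      using assms(2)
      by eventually_elim (auto simp: norm_mult power_mult_distrib intro!: mult_right_mono power_mono)
  qed measurable
  then show ?thesis by (simp add: L2_def)
qed

lemma L2_cmult: "f \<in> L2 M \<Longrightarrow> (\<lambda>x. c * f x) \<in> L2 M"
  by (rule L2_bounded_mult[where C = "cmod c"]) auto

lemma L2_diff: "f \<in> L2 M \<Longrightarrow> g \<in> L2 M \<Longrightarrow> (\<lambda>x. f x - g x) \<in> L2 M"
  using L2_add[OF _ L2_cmult[of g M "-1"]] by simp

lemma L2_norm_nonneg: "0 \<le> L2_norm M f"
  by (simp add: L2_norm_def)

lemma L2_Cauchy_Schwarz:
  assumes "f \<in> L2 M" "g \<in> L2 M"
  shows "(\<integral>x. cmod (f x) * cmod (g x) \<partial>M) \<le> L2_norm M f * L2_norm M g"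
proof -
  note [measurable] = assms[THEN L2_measurable]
  have sq: "(\<integral>\<^sup>+x. ennreal ((cmod (h x))\<^sup>2) \<partial>M) = ennreal ((L2_norm M h)\<^sup>2)" if "h \<in> L2 M" for h
    unfolding L2_norm_def
    by (simp add: nn_integral_eq_integral[OF L2_square_integrable[OF that]])
  have "(\<integral>\<^sup>+x. ennreal (cmod (f x)) * ennreal (cmod (g x)) \<partial>M)\<^sup>2 \<le>
      (\<integral>\<^sup>+x. (ennreal (cmod (f x)))\<^sup>2 \<partial>M) * (\<integral>\<^sup>+x. (ennreal (cmod (g x)))\<^sup>2 \<partial>M)"
    by (rule Cauchy_Schwarz_nn_integral) measurable
  also have "(\<integral>\<^sup>+x. ennreal (cmod (f x)) * ennreal (cmod (g x)) \<partial>M) =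
      ennreal (\<integral>x. cmod (f x) * cmod (g x) \<partial>M)"
    by (subst nn_integral_eq_integral[symmetric])
      (simp_all add: L2_product_integrable[OF assms] ennreal_mult)
  finally have "(\<integral>x. cmod (f x) * cmod (g x) \<partial>M)\<^sup>2 \<le> (L2_norm M f * L2_norm M g)\<^sup>2"
    by (simp only: ennreal_power norm_ge_zero sq assms ennreal_mult[symmetric] zero_le_power2
        power_mult_distrib Bochner_Integration.integral_nonneg mult_nonneg_nonneg norm_ge_zero
        ennreal_le_iff)
  then show ?thesis
    by (rule power2_le_imp_le) (simp add: L2_norm_nonneg)
qed

interpretation torus: finite_measure \<mu>
  by (rule finite_measure_torus)

lemma torus_bounded_integrable:
  fixes f :: "c2 \<Rightarrow> 'a :: {banach, second_countable_topology}"
  assumes "f \<in> borel_measurable \<mu>" "\<And>x. x \<in> torus \<Longrightarrow> norm (f x) \<le> C"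
  shows "integrable \<mu> f"
  by (rule torus.integrable_const_bound[where B = C]) (use assms in auto)

lemma torus_bounded_L2:
  assumes [measurable]: "f \<in> borel_measurable \<mu>"
    and "\<And>y. y \<in> torus \<Longrightarrow> cmod (f y) \<le> C"
  shows "f \<in> L2 \<mu>"
proof -
  have "integrable \<mu> (\<lambda>x. (cmod (f x))\<^sup>2)"
    by (rule torus_bounded_integrable[where C = "C\<^sup>2"]) (auto intro!: power_mono assms(2))
  then show ?thesis by (simp add: L2_def)
qed

lemma measure_torus: "measure \<mu> torus = 1"
  by (simp add: measure_def emeasure_torus)

section \<open>Power series on the bidisc\<close>

lemma summable_on_complexI:
  fixes f :: "'a \<Rightarrow> complex"
  assumes "\<And>x. x \<in> A \<Longrightarrow> cmod (f x) \<le> g x" "g summable_on A"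
  shows "f summable_on A"
  unfolding summable_on_iff_abs_summable_on_complex
  by (rule Infinite_Sum.abs_summable_on_comparison_test'[OF assms(2)]) (simp add: assms(1))

lemma summable_on_realI:
  fixes f :: "'a \<Rightarrow> real"
  assumes "\<And>x. x \<in> A \<Longrightarrow> \<bar>f x\<bar> \<le> g x" "g summable_on A"
  shows "f summable_on A"
  by (rule summable_on_iff_abs_summable_on_real[THEN iffD2],
      rule Infinite_Sum.abs_summable_on_comparison_test'[OF assms(2)]) (simp add: assms(1))

lemma summable_on_cmodI:
  fixes f :: "'a \<Rightarrow> complex"
  shows "f summable_on A \<Longrightarrow> (\<lambda>x. cmod (f x)) summable_on A"
  by (simp add: summable_on_iff_abs_summable_on_complex)

text \<open>Sums over pairs are enumerated by \<open>prod_decode\<close> so that theorems about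
  series indexed by the naturals (Tannery, termwise integration) apply to them. Absolute convergence
  makes the choice of enumeration harmless.\<close>

lemma summable_prod_decode:
  fixes f :: "nat \<times> nat \<Rightarrow> 'a :: banach"
  assumes "(\<lambda>n. norm (f n)) summable_on UNIV"
  shows "summable (\<lambda>i. norm (f (prod_decode i)))"
  using assms summable_on_reindex_bij_betw[OF bij_prod_decode, of "\<lambda>n. norm (f n)"]
  by (intro summable_on_imp_summable) simp

lemma has_sum_prod_decode:
  fixes f :: "nat \<times> nat \<Rightarrow> 'a :: banach"
  assumes "summable (\<lambda>i. norm (f (prod_decode i)))" "(\<lambda>i. f (prod_decode i)) sums s"
  shows "(f has_sum s) UNIV"
  using norm_summable_imp_has_sum[OF assms]
    has_sum_reindex_bij_betw[OF bij_prod_decode, of f s] by simp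

lemma infsum_prod_decode:
  fixes f :: "nat \<times> nat \<Rightarrow> 'a :: banach"
  assumes "summable (\<lambda>i. norm (f (prod_decode i)))"
  shows "(f has_sum (\<Sum>i. f (prod_decode i))) UNIV"
  by (rule has_sum_prod_decode[OF assms]) (use assms in \<open>simp add: summable_norm_cancel summable_sums\<close>)

text \<open>Dominated convergence for sums over pairs. It is applied along r tending to 1 from the
  left, with bounds taken from the coefficients alone.\<close>

lemma Tannery_infsum:
  fixes a :: "'b \<Rightarrow> nat \<times> nat \<Rightarrow> 'a :: {real_normed_algebra, banach}"
  assumes lim: "\<And>n. ((\<lambda>r. a r n) \<longlongrightarrow> b n) F"
    and bound: "eventually (\<lambda>r. \<forall>n. norm (a r n) \<le> M n) F"
    and M: "M summable_on UNIV" and F: "F \<noteq> bot"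
  shows "((\<lambda>r. infsum (a r) UNIV) \<longlongrightarrow> infsum b UNIV) F"
proof -
  obtain r where "\<forall>n. norm (a r n) \<le> M n"
    using eventually_happens[OF bound] F by auto
  then have M0: "0 \<le> M n" for n
    using norm_ge_zero order_trans by blast
  have sumM: "summable (\<lambda>i. M (prod_decode i))"
    using summable_prod_decode[of M] M M0 by simp
  have ev: "eventually (\<lambda>(k, r). norm (a r (prod_decode k)) \<le> M (prod_decode k)) (at_top \<times>\<^sub>F F)"
    unfolding eventually_prod_filter
    by (rule exI[of _ "\<lambda>_. True"], rule exI[of _ "\<lambda>r. \<forall>n. norm (a r n) \<le> M n"]) (use bound in \<open>auto simp del: split_paired_All\<close>)
  have "eventually (\<lambda>r. summable (\<lambda>k. norm (a r (prod_decode k)))) F \<and>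
      summable (\<lambda>k. norm (b (prod_decode k))) \<and>
      ((\<lambda>r. \<Sum>k. a r (prod_decode k)) \<longlongrightarrow> (\<Sum>k. b (prod_decode k))) F"
    using tannerys_theorem[OF lim ev sumM F] by simp
  then have 1: "eventually (\<lambda>r. summable (\<lambda>k. norm (a r (prod_decode k)))) F"
    and 2: "summable (\<lambda>k. norm (b (prod_decode k)))"
    and 3: "((\<lambda>r. \<Sum>k. a r (prod_decode k)) \<longlongrightarrow> (\<Sum>k. b (prod_decode k))) F"
    by auto
  have "eventually (\<lambda>r. (\<Sum>k. a r (prod_decode k)) = infsum (a r) UNIV) F"
    using 1 by (rule eventually_mono) (rule infsumI[OF infsum_prod_decode, symmetric])
  with 3 have "((\<lambda>r. infsum (a r) UNIV) \<longlongrightarrow> (\<Sum>k. b (prod_decode k))) F"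
    by (rule Lim_transform_eventually)
  then show ?thesis
    by (simp add: infsumI[OF infsum_prod_decode[OF 2]])
qed

section \<open>Dilates of a power series\<close>

definition deg2 :: "nat \<times> nat \<Rightarrow> nat" where
  "deg2 n = fst n + snd n"

lemma mono2_scaleR: "mono2 n (r *\<^sub>R x) = of_real (r ^ deg2 n) * mono2 n x"
  by (simp add: mono2_def deg2_def scaleR_conv_of_real power_mult_distrib power_add)

lemma power_series2_iff:
  "power_series2 a f \<longleftrightarrow> (\<forall>z\<in>bidisc. ((\<lambda>n. a n * mono2 n z) has_sum f z) UNIV)"
  by (simp add: power_series2_def mono2_def case_prod_beta' mult.assoc)

lemma scaleR_torus_bidisc: "x \<in> torus \<Longrightarrow> 0 \<le> r \<Longrightarrow> r < 1 \<Longrightarrow> r *\<^sub>R x \<in> bidisc"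
  by (auto simp: torus_def bidisc_def)

text \<open>Unordered convergence of complex sums is absolute, so evaluating the series at the
  single point (r, r) yields a bound that is uniform over the torus of radius r.\<close>

lemma power_series2_abs:
  assumes "power_series2 a f" "0 \<le> r" "r < 1"
  shows "(\<lambda>n. cmod (a n) * r ^ deg2 n) summable_on UNIV"
proof -
  have "(complex_of_real r, complex_of_real r) \<in> bidisc"
    using assms by (simp add: bidisc_def)
  then have "(\<lambda>n. a n * mono2 n (complex_of_real r, complex_of_real r)) summable_on UNIV"
    using assms(1) unfolding power_series2_iff by (auto intro: has_sum_imp_summable)
  from summable_on_cmodI[OF this] show ?thesis
    using assms(2) by (simp add: mono2_def deg2_def norm_mult norm_power power_add)
qed

definition dil :: "real \<Rightarrow> (c2 \<Rightarrow> complex) \<Rightarrow> c2 \<Rightarrow> complex" where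
  "dil r f x = f (r *\<^sub>R x)"

lemma dil_has_sum:
  assumes "power_series2 a f" "0 \<le> r" "r < 1" "x \<in> torus"
  shows "((\<lambda>n. a n * of_real (r ^ deg2 n) * mono2 n x) has_sum dil r f x) UNIV"
  using assms scaleR_torus_bidisc[OF assms(4,2,3)]
  by (auto simp: power_series2_iff dil_def mono2_scaleR mult.assoc)

lemma dil_sums:
  assumes "power_series2 a f" "0 \<le> r" "r < 1" "x \<in> torus"
  shows "(\<lambda>i. a (prod_decode i) * of_real (r ^ deg2 (prod_decode i)) * mono2 (prod_decode i) x)
    sums dil r f x"
  using dil_has_sum[OF assms] has_sum_reindex_bij_betw[OF bij_prod_decode,
      of "\<lambda>n. a n * of_real (r ^ deg2 n) * mono2 n x" "dil r f x"]
  by (intro has_sum_imp_sums) simp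

lemma dil_measurable:
  assumes "power_series2 a f" "0 \<le> r" "r < 1"
  shows "dil r f \<in> borel_measurable \<mu>"
proof -
  have "(\<lambda>x. \<Sum>i. a (prod_decode i) * of_real (r ^ deg2 (prod_decode i)) * mono2 (prod_decode i) x)
      \<in> borel_measurable \<mu>"
    by measurable
  also have "?this \<longleftrightarrow> ?thesis"
    by (rule measurable_cong) (use dil_sums[OF assms] in \<open>auto simp: sums_iff\<close>)
  finally show ?thesis .
qed

lemma dil_bounded:
  assumes "power_series2 a f" "0 \<le> r" "r < 1"
  obtains C where "\<And>x. x \<in> torus \<Longrightarrow> cmod (dil r f x) \<le> C"
proof
  fix x assume x: "x \<in> torus"
  show "cmod (dil r f x) \<le> (\<Sum>\<^sub>\<infinity>n. cmod (a n) * r ^ deg2 n)"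
  proof (rule norm_has_sum_bound)
    have "(\<lambda>n. norm (a n * of_real (r ^ deg2 n) * mono2 n x)) = (\<lambda>n. cmod (a n) * r ^ deg2 n)"
      using assms x by (simp add: norm_mult norm_mono2_torus norm_power)
    then show "((\<lambda>n. norm (a n * of_real (r ^ deg2 n) * mono2 n x)) has_sum
      (\<Sum>\<^sub>\<infinity>n. cmod (a n) * r ^ deg2 n)) UNIV"
      using power_series2_abs[OF assms] by simp
  qed (rule dil_has_sum[OF assms x])
qed

lemma dil_L2:
  assumes "power_series2 a f" "0 \<le> r" "r < 1"
  shows "dil r f \<in> L2 \<mu>"
  by (rule dil_bounded[OF assms], rule torus_bounded_L2[OF dil_measurable[OF assms]])

text \<open>Termwise integration: on the torus the monomials have modulus 1, so the terms are
  dominated by a summable sequence independent of the point. Taking h to be a conjugated monomial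
  gives the coefficients, and taking it to be a conjugated dilate gives inner products.\<close>

lemma integral_dil_mult:
  assumes f: "power_series2 a f" "0 \<le> r" "r < 1"
    and [measurable]: "h \<in> borel_measurable \<mu>"
    and h: "\<And>x. x \<in> torus \<Longrightarrow> cmod (h x) \<le> C"
  shows "((\<lambda>n. a n * of_real (r ^ deg2 n) * (\<integral>x. mono2 n x * h x \<partial>\<mu>)) has_sum
    (\<integral>x. dil r f x * h x \<partial>\<mu>)) UNIV"
proof (rule has_sum_prod_decode)
  let ?d = prod_decode
  define t where "t i x = a (?d i) * of_real (r ^ deg2 (?d i)) * mono2 (?d i) x * h x"
    for i x
  define c where "c i = cmod (a (?d i)) * r ^ deg2 (?d i) * C" for i
  have c: "summable c"
    unfolding c_def using f summable_prod_decode[of "\<lambda>n. cmod (a n) * r ^ deg2 n"]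
      power_series2_abs[OF f] by (intro summable_mult2) simp
  have [measurable]: "t i \<in> borel_measurable \<mu>" for i
    unfolding t_def by measurable
  have tc: "norm (t i x) \<le> c i" if "x \<in> torus" for i x
    unfolding t_def c_def using f h[OF that] that
    by (auto simp: norm_mult norm_mono2_torus norm_power intro!: mult_left_mono)
  have t_int: "integrable \<mu> (t i)" for i
    by (rule torus_bounded_integrable[OF _ tc]) auto
  have norm_int: "(\<integral>x. norm (t i x) \<partial>\<mu>) \<le> c i" for i
  proof -
    have "(\<integral>x. norm (t i x) \<partial>\<mu>) \<le> (\<integral>x. c i \<partial>\<mu>)"
      by (rule integral_mono) (auto simp: t_int tc)
    then show ?thesis by (simp add: measure_torus)
  qed
  have sum_int: "summable (\<lambda>i. \<integral>x. norm (t i x) \<partial>\<mu>)"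
    by (rule summable_comparison_test'[OF c]) (use norm_int in auto)
  have "(\<lambda>i. integral\<^sup>L \<mu> (t i)) sums (\<integral>x. (\<Sum>i. t i x) \<partial>\<mu>)"
  proof (rule sums_integral[OF t_int _ sum_int], rule AE_I2)
    fix x assume "x \<in> space \<mu>"
    then show "summable (\<lambda>i. norm (t i x))"
      by (intro summable_comparison_test'[OF c, where N = 0]) (use tc in auto)
  qed
  also have "(\<integral>x. (\<Sum>i. t i x) \<partial>\<mu>) = (\<integral>x. dil r f x * h x \<partial>\<mu>)"
  proof (rule Bochner_Integration.integral_cong[OF refl])
    fix x assume "x \<in> space \<mu>"
    then have "t i x = (a (?d i) * of_real (r ^ deg2 (?d i)) * mono2 (?d i) x) * h x"
      "x \<in> torus" for i
      by (simp_all add: t_def)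
    then show "(\<Sum>i. t i x) = dil r f x * h x"
      using sums_mult2[OF dil_sums[OF f], of x "h x"] by (simp add: sums_iff)
  qed
  also have "(\<lambda>i. integral\<^sup>L \<mu> (t i)) =
      (\<lambda>i. a (?d i) * of_real (r ^ deg2 (?d i)) *
        (\<integral>x. mono2 (?d i) x * h x \<partial>\<mu>))"
    unfolding t_def mult.assoc by simp
  finally show S: "(\<lambda>i. a (?d i) * of_real (r ^ deg2 (?d i)) *
      (\<integral>x. mono2 (?d i) x * h x \<partial>\<mu>)) sums
      (\<integral>x. dil r f x * h x \<partial>\<mu>)" .
  have "norm (integral\<^sup>L \<mu> (t i)) \<le> c i" for i
    using integral_norm_bound[of \<mu> "t i"] norm_int[of i] by linarith
  moreover have "integral\<^sup>L \<mu> (t i) = a (?d i) * of_real (r ^ deg2 (?d i)) *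
      (\<integral>x. mono2 (?d i) x * h x \<partial>\<mu>)" for i
    unfolding t_def mult.assoc by simp
  ultimately show "summable (\<lambda>i. norm (a (?d i) * of_real (r ^ deg2 (?d i)) *
      (\<integral>x. mono2 (?d i) x * h x \<partial>\<mu>)))"
    by (intro summable_comparison_test'[OF c, where N = 0]) auto
qed

lemma has_sum_single:
  assumes "\<And>n. n \<noteq> m \<Longrightarrow> f n = 0" "s = f m"
  shows "(f has_sum s) UNIV"
  using has_sum_finite_neutralI[of "{m}" UNIV f "f m"] assms by auto

text \<open>Orthonormality of the monomials leaves a single term. As the integral depends only on
  the function, this also shows that the coefficients are unique.\<close>

lemma dil_coeff:
  assumes "power_series2 a f" "0 \<le> r" "r < 1"
  shows "(\<integral>x. dil r f x * cnj (mono2 m x) \<partial>\<mu>) = a m * of_real (r ^ deg2 m)"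
proof -
  have "((\<lambda>n. a n * of_real (r ^ deg2 n) * (\<integral>x. mono2 n x * cnj (mono2 m x) \<partial>\<mu>)) has_sum
    (\<integral>x. dil r f x * cnj (mono2 m x) \<partial>\<mu>)) UNIV"
    by (rule integral_dil_mult[OF assms, where C = 1])
      (auto simp: norm_mono2_torus intro!: measurable_compose[OF mono2_measurable cnj_measurable])
  moreover have "((\<lambda>n. a n * of_real (r ^ deg2 n) * (\<integral>x. mono2 n x * cnj (mono2 m x) \<partial>\<mu>)) has_sum
    a m * of_real (r ^ deg2 m) * (\<integral>x. mono2 m x * cnj (mono2 m x) \<partial>\<mu>)) UNIV"
    by (rule has_sum_single[of m]) (simp_all add: mono2_orthonormal)
  ultimately have "(\<integral>x. dil r f x * cnj (mono2 m x) \<partial>\<mu>) =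
      a m * of_real (r ^ deg2 m) * (\<integral>x. mono2 m x * cnj (mono2 m x) \<partial>\<mu>)"
    by (rule has_sum_unique)
  then show ?thesis by (simp add: mono2_orthonormal)
qed

lemma power_series2_unique:
  assumes "power_series2 a f" "power_series2 b g" "\<And>z. z \<in> bidisc \<Longrightarrow> f z = g z"
  shows "a = b"
proof
  fix m
  have f: "power_series2 b f"
    using assms(2,3) by (simp add: power_series2_iff)
  show "a m = b m"
    using dil_coeff[OF assms(1), of "1/2" m] dil_coeff[OF f, of "1/2" m] by simp
qed

lemma mean_value_torus:
  assumes "power_series2 a f" "0 \<le> r" "r < 1"
  shows "(\<integral>x. dil r f x \<partial>\<mu>) = f 0"
proof -
  have "((\<lambda>n. a n * mono2 n 0) has_sum f 0) UNIV"
    using assms(1) by (auto simp: power_series2_iff bidisc_def zero_prod_def)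
  moreover have "((\<lambda>n. a n * mono2 n 0) has_sum a (0, 0) * mono2 (0, 0) 0) UNIV"
    by (rule has_sum_single[of "(0, 0)"]) (auto simp: mono2_def)
  ultimately have "f 0 = a (0, 0) * mono2 (0, 0) 0"
    by (rule has_sum_unique)
  then have "f 0 = a (0, 0)" by (simp add: mono2_def)
  moreover have "(\<integral>x. dil r f x * cnj (mono2 (0, 0) x) \<partial>\<mu>) = (\<integral>x. dil r f x \<partial>\<mu>)"
    by (simp add: mono2_def)
  ultimately show ?thesis
    using dil_coeff[OF assms, of "(0, 0)"] by (simp add: deg2_def)
qed

text \<open>Two independent radii are allowed because the norm of a difference of two dilates is
  later expanded into such inner products.\<close>

lemma dil_inner2:
  assumes f: "power_series2 a f" "0 \<le> r" "r < 1" and g: "power_series2 b g" "0 \<le> s" "s < 1"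
  shows "((\<lambda>n. a n * cnj (b n) * of_real (r ^ deg2 n * s ^ deg2 n)) has_sum
    L2_inner \<mu> (dil r f) (dil s g)) UNIV"
proof -
  obtain C where C: "\<And>x. x \<in> torus \<Longrightarrow> cmod (dil s g x) \<le> C"
    by (rule dil_bounded[OF g]) (rule that)
  have "(\<integral>x. mono2 n x * cnj (dil s g x) \<partial>\<mu>) = cnj (b n) * of_real (s ^ deg2 n)" for n
  proof -
    have "(\<integral>x. mono2 n x * cnj (dil s g x) \<partial>\<mu>) =
      cnj (\<integral>x. dil s g x * cnj (mono2 n x) \<partial>\<mu>)"
      by (subst Bochner_Integration.integral_cnj[symmetric]) (simp add: mult.commute)
    then show ?thesis by (simp add: dil_coeff[OF g])
  qed
  moreover have "((\<lambda>n. a n * of_real (r ^ deg2 n) * (\<integral>x. mono2 n x * cnj (dil s g x) \<partial>\<mu>)) has_sum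
    (\<integral>x. dil r f x * cnj (dil s g x) \<partial>\<mu>)) UNIV"
    by (rule integral_dil_mult[OF f, where C = C])
      (use C in \<open>auto intro!: measurable_compose[OF dil_measurable[OF g] cnj_measurable]\<close>)
  ultimately show ?thesis
    by (simp add: L2_inner_def mult_ac)
qed

section \<open>The Hardy space of the bidisc\<close>

abbreviation square_summable :: "(nat \<times> nat \<Rightarrow> complex) \<Rightarrow> bool" where
  "square_summable a \<equiv> (\<lambda>n. (cmod (a n))\<^sup>2) summable_on UNIV"

lemma square_summable_product:
  assumes "square_summable a" "square_summable b"
  shows "(\<lambda>n. cmod (a n) * cmod (b n)) summable_on UNIV"
  by (rule summable_on_realI[OF _ summable_on_add[OF assms]]) (simp add: norm_mult_le_squares)

lemma square_summable_inner:
  assumes "square_summable a" "square_summable b"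
  shows "(\<lambda>n. a n * cnj (b n)) summable_on UNIV"
  by (rule summable_on_complexI[OF _ square_summable_product[OF assms]]) (simp add: norm_mult)

lemma square_summable_add:
  assumes "square_summable a" "square_summable b"
  shows "square_summable (\<lambda>n. a n + b n)"
  by (rule summable_on_realI[OF _ summable_on_add[OF
      summable_on_cmult_right[OF assms(1), of 2] summable_on_cmult_right[OF assms(2), of 2]]])
    (simp add: norm_add_square_le)

lemma square_summable_cmult:
  assumes "square_summable a"
  shows "square_summable (\<lambda>n. c * a n)"
  using summable_on_cmult_right[OF assms, of "(cmod c)\<^sup>2"]
  by (simp add: norm_mult power_mult_distrib)

lemma H2_coeff_eq:
  assumes "square_summable a" "power_series2 a f"
  shows "H2_coeff f = a"
  unfolding H2_coeff_def
  by (rule the_equality) (use assms power_series2_unique in blast)+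

lemma H2_square_summable: "f \<in> H2 \<Longrightarrow> square_summable (H2_coeff f)"
  and H2_power_series: "f \<in> H2 \<Longrightarrow> power_series2 (H2_coeff f) f"
  by (auto simp: H2_def H2_coeff_eq)

lemma H2_outside: "f \<in> H2 \<Longrightarrow> z \<notin> bidisc \<Longrightarrow> f z = 0"
  unfolding H2_def by blast

lemma H2I:
  assumes "\<And>z. z \<notin> bidisc \<Longrightarrow> f z = 0" "square_summable a" "power_series2 a f"
  shows "f \<in> H2"
  using assms by (auto simp: H2_def)

lemma power_series2_add:
  "power_series2 a f \<Longrightarrow> power_series2 b g \<Longrightarrow> power_series2 (\<lambda>n. a n + b n) (\<lambda>z. f z + g z)"
  by (auto simp: power_series2_iff distrib_right intro!: has_sum_add)

lemma power_series2_cmult: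
  "power_series2 a f \<Longrightarrow> power_series2 (\<lambda>n. c * a n) (\<lambda>z. c * f z)"
  by (auto simp: power_series2_iff mult.assoc intro!: has_sum_cmult_right)

lemma H2_add: "f \<in> H2 \<Longrightarrow> g \<in> H2 \<Longrightarrow> (\<lambda>z. f z + g z) \<in> H2"
  by (rule H2I[where a = "\<lambda>n. H2_coeff f n + H2_coeff g n"])
    (simp_all add: H2_outside square_summable_add power_series2_add H2_square_summable H2_power_series)

lemma H2_coeff_add:
  "f \<in> H2 \<Longrightarrow> g \<in> H2 \<Longrightarrow> H2_coeff (\<lambda>z. f z + g z) = (\<lambda>n. H2_coeff f n + H2_coeff g n)"
  by (intro H2_coeff_eq square_summable_add power_series2_add H2_square_summable H2_power_series)

lemma H2_cmult: "f \<in> H2 \<Longrightarrow> (\<lambda>z. c * f z) \<in> H2"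
  by (rule H2I[OF _ square_summable_cmult power_series2_cmult])
    (auto simp: H2_outside intro: H2_square_summable H2_power_series)

lemma H2_coeff_cmult: "f \<in> H2 \<Longrightarrow> H2_coeff (\<lambda>z. c * f z) = (\<lambda>n. c * H2_coeff f n)"
  by (rule H2_coeff_eq[OF square_summable_cmult power_series2_cmult])
    (auto intro: H2_square_summable H2_power_series)

lemma H2_diff: "f \<in> H2 \<Longrightarrow> g \<in> H2 \<Longrightarrow> (\<lambda>z. f z - g z) \<in> H2"
  using H2_add[OF _ H2_cmult[of g "-1"]] by simp

lemma H2_zero: "(\<lambda>z. 0) \<in> H2"
  by (rule H2I[of _ "\<lambda>n. 0"]) (auto simp: power_series2_iff)

lemma H2_inner_summable:
  "f \<in> H2 \<Longrightarrow> g \<in> H2 \<Longrightarrow> (\<lambda>n. H2_coeff f n * cnj (H2_coeff g n)) summable_on UNIV"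
  by (intro square_summable_inner H2_square_summable)

lemma H2_inner_add_left:
  "f \<in> H2 \<Longrightarrow> g \<in> H2 \<Longrightarrow> h \<in> H2 \<Longrightarrow> H2_inner (\<lambda>z. f z + g z) h = H2_inner f h + H2_inner g h"
  unfolding H2_inner_def
  by (simp add: H2_coeff_add distrib_right infsum_add H2_inner_summable)

lemma H2_inner_cmult_left:
  "f \<in> H2 \<Longrightarrow> h \<in> H2 \<Longrightarrow> H2_inner (\<lambda>z. c * f z) h = c * H2_inner f h"
  unfolding H2_inner_def
  by (simp add: H2_coeff_cmult mult.assoc infsum_cmult_right H2_inner_summable)

lemma H2_inner_commute: "H2_inner f g = cnj (H2_inner g f)"
  unfolding H2_inner_def by (subst infsum_cnj[symmetric]) (simp add: mult.commute)

lemma H2_inner_diff_left: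
  "f \<in> H2 \<Longrightarrow> g \<in> H2 \<Longrightarrow> h \<in> H2 \<Longrightarrow> H2_inner (\<lambda>z. f z - g z) h = H2_inner f h - H2_inner g h"
  using H2_inner_add_left[of f "\<lambda>z. (-1) * g z" h] H2_cmult[of g "-1"] H2_inner_cmult_left[of g h "-1"]
  by simp

lemma H2_inner_add_right:
  "f \<in> H2 \<Longrightarrow> g \<in> H2 \<Longrightarrow> h \<in> H2 \<Longrightarrow> H2_inner h (\<lambda>z. f z + g z) = H2_inner h f + H2_inner h g"
  using H2_inner_add_left[of f g h] H2_inner_commute by (metis complex_cnj_add)

lemma H2_inner_diff_right:
  "f \<in> H2 \<Longrightarrow> g \<in> H2 \<Longrightarrow> h \<in> H2 \<Longrightarrow> H2_inner h (\<lambda>z. f z - g z) = H2_inner h f - H2_inner h g"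
  using H2_inner_diff_left[of f g h] H2_inner_commute by (metis complex_cnj_diff)

lemma H2_inner_cmult_right:
  "f \<in> H2 \<Longrightarrow> h \<in> H2 \<Longrightarrow> H2_inner h (\<lambda>z. c * f z) = cnj c * H2_inner h f"
  using H2_inner_cmult_left[of f h c] H2_inner_commute by (metis complex_cnj_mult)

lemma H2_norm_nonneg: "0 \<le> H2_norm f"
  by (simp add: H2_norm_def infsum_nonneg)

lemma H2_norm_square: "(H2_norm f)\<^sup>2 = (\<Sum>\<^sub>\<infinity>n. (cmod (H2_coeff f n))\<^sup>2)"
  by (simp add: H2_norm_def infsum_nonneg)

lemma H2_inner_self:
  assumes "f \<in> H2"
  shows "H2_inner f f = of_real ((H2_norm f)\<^sup>2)"
proof -
  have "((\<lambda>n. complex_of_real ((cmod (H2_coeff f n))\<^sup>2)) has_sum of_real ((H2_norm f)\<^sup>2)) UNIV"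
    unfolding H2_norm_square
    by (intro has_sum_of_real has_sum_infsum H2_square_summable assms)
  then show ?thesis
    unfolding H2_inner_def by (simp add: infsumI complex_norm_square[symmetric] del: of_real_power)
qed

lemma H2_eq_zero:
  assumes "f \<in> H2" "H2_inner f f = 0"
  shows "f z = 0"
proof (cases "z \<in> bidisc")
  case True
  have "(\<Sum>\<^sub>\<infinity>n. (cmod (H2_coeff f n))\<^sup>2) = 0"
    using assms by (simp add: H2_inner_self H2_norm_square)
  then have "(cmod (H2_coeff f n))\<^sup>2 = 0" for n
    using nonneg_infsum_le_0D[of "\<lambda>n. (cmod (H2_coeff f n))\<^sup>2" UNIV n] H2_square_summable[OF assms(1)]
    by simp
  then have "H2_coeff f n = 0" for n by simp
  then have "((\<lambda>n :: nat \<times> nat. 0) has_sum f z) UNIV"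
    using H2_power_series[OF assms(1)] True by (simp add: power_series2_iff)
  then show ?thesis
    by (rule has_sum_unique[OF _ has_sum_0_simp])
qed (simp add: H2_outside assms(1))

lemma H2_eqI:
  assumes "f \<in> H2" "g \<in> H2" "H2_inner (\<lambda>z. f z - g z) (\<lambda>z. f z - g z) = 0"
  shows "f = g"
  using H2_eq_zero[OF H2_diff[OF assms(1,2)] assms(3)] by (auto simp: fun_eq_iff)

lemma H2_Cauchy_Schwarz:
  assumes f: "f \<in> H2" and g: "g \<in> H2"
  shows "cmod (H2_inner f g) \<le> H2_norm f * H2_norm g"
proof (cases "H2_norm g = 0")
  case True
  then have "g z = 0" for z
    using H2_eq_zero[OF g] by (simp add: H2_inner_self g)
  then have "g = (\<lambda>z. 0 * f z)" by auto
  then have "H2_inner f g = 0"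
    using H2_inner_cmult_right[OF f f, of 0] by simp
  then show ?thesis by (simp add: H2_norm_nonneg)
next
  case False
  \<comment> \<open>c * g is the projection of f onto the line spanned by g; the inequality says
    that the squared norm of the remainder is nonnegative.\<close>
  define c where "c = H2_inner f g / of_real ((H2_norm g)\<^sup>2)"
  let ?h = "\<lambda>z. f z - c * g z"
  have cg: "(\<lambda>z. c * g z) \<in> H2" by (rule H2_cmult[OF g])
  have h: "?h \<in> H2" by (rule H2_diff[OF f cg])
  have hg: "H2_inner ?h g = 0"
    unfolding H2_inner_diff_left[OF f cg g] H2_inner_cmult_left[OF g g]
    using False by (simp add: H2_inner_self g c_def)
  have "H2_inner ?h ?h = H2_inner ?h f"
    using hg by (simp add: H2_inner_diff_right[OF f cg h] H2_inner_cmult_right[OF g h])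
  also have "\<dots> = H2_inner f f - c * H2_inner g f"
    by (simp add: H2_inner_diff_left H2_inner_cmult_left f g cg)
  also have "c * H2_inner g f = of_real ((cmod (H2_inner f g))\<^sup>2 / (H2_norm g)\<^sup>2)"
    by (subst H2_inner_commute) (simp add: c_def complex_norm_square[symmetric] del: of_real_power)
  finally have "complex_of_real ((H2_norm ?h)\<^sup>2) =
      of_real ((H2_norm f)\<^sup>2 - (cmod (H2_inner f g))\<^sup>2 / (H2_norm g)\<^sup>2)"
    by (simp add: H2_inner_self f h)
  then have "(H2_norm ?h)\<^sup>2 = (H2_norm f)\<^sup>2 - (cmod (H2_inner f g))\<^sup>2 / (H2_norm g)\<^sup>2"
    by (simp only: of_real_eq_iff)
  then have "(cmod (H2_inner f g))\<^sup>2 / (H2_norm g)\<^sup>2 \<le> (H2_norm f)\<^sup>2"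
    using zero_le_power2[of "H2_norm ?h"] by linarith
  then have "(cmod (H2_inner f g))\<^sup>2 \<le> (H2_norm f * H2_norm g)\<^sup>2"
    using False by (simp add: field_simps power_mult_distrib)
  then show ?thesis
    by (rule power2_le_imp_le) (simp add: H2_norm_nonneg)
qed

section \<open>The Szego kernel of the bidisc\<close>

lemma has_sum_geometric2:
  fixes x y :: "'a :: {real_normed_field, banach}"
  assumes "norm x < 1" "norm y < 1"
  shows "((\<lambda>n. x ^ fst n * y ^ snd n) has_sum 1 / ((1 - x) * (1 - y))) UNIV"
proof -
  have geo: "((\<lambda>k. z ^ k) has_sum 1 / (1 - z)) UNIV"
    if "norm z < 1" for z :: "'b :: {real_normed_field, banach}"
    using that by (intro norm_summable_imp_has_sum geometric_sums)
      (simp add: norm_power summable_geometric)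
  have "((\<lambda>n. norm (x ^ fst n * y ^ snd n)) summable_on (UNIV \<times> UNIV))"
  proof (rule summable_on_SigmaI)
    show "((\<lambda>l. norm (x ^ fst (k, l) * y ^ snd (k, l))) has_sum norm x ^ k * (1 / (1 - norm y))) UNIV" for k
      using has_sum_cmult_right[OF geo[of "norm y"], of "norm x ^ k"] assms
      by (simp add: norm_mult norm_power)
    show "(\<lambda>k. norm x ^ k * (1 / (1 - norm y))) summable_on UNIV"
      using has_sum_cmult_left[OF geo[of "norm x"], of "1 / (1 - norm y)"] assms
      by (auto intro: has_sum_imp_summable)
  qed simp
  then have "(\<lambda>n. x ^ fst n * y ^ snd n) summable_on (UNIV \<times> UNIV)"
    by (rule abs_summable_summable)
  moreover have "((\<lambda>k. x ^ k * (1 / (1 - y))) has_sum (1 / (1 - x)) * (1 / (1 - y))) UNIV"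
    by (rule has_sum_cmult_left[OF geo[OF assms(1)]])
  moreover have "((\<lambda>l. x ^ fst (k, l) * y ^ snd (k, l)) has_sum x ^ k * (1 / (1 - y))) UNIV" for k
    using has_sum_cmult_right[OF geo[OF assms(2)], of "x ^ k"] by simp
  ultimately have "((\<lambda>n. x ^ fst n * y ^ snd n) has_sum (1 / (1 - x)) * (1 / (1 - y))) (UNIV \<times> UNIV)"
    by (intro has_sum_SigmaI[where g = "\<lambda>k. x ^ k * (1 / (1 - y))"])
  then show ?thesis by simp
qed

text \<open>Elements of \<open>H2\<close> must vanish off the bidisc, whereas
  \<open>szego_kernel\<close> is also evaluated on the torus, as a function in
  \<open>L2 \<sigma>\<close>. This is the truncated version that belongs to
  \<open>H2\<close>.\<close>

definition szego :: "c2 \<Rightarrow> c2 \<Rightarrow> complex" where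
  "szego w z = (if z \<in> bidisc then szego_kernel w z else 0)"

lemma bidisc_mult_cnj_less_1:
  assumes "z \<in> bidisc" "w \<in> bidisc"
  shows "cmod (fst z * cnj (fst w)) < 1" "cmod (snd z * cnj (snd w)) < 1"
proof -
  have "cmod a * cmod b < 1" if "cmod a < 1" "cmod b < 1" for a b
    using mult_left_le[of "cmod b" "cmod a"] that by simp
  then show "cmod (fst z * cnj (fst w)) < 1" "cmod (snd z * cnj (snd w)) < 1"
    using assms by (auto simp: bidisc_def norm_mult)
qed

lemma szego_power_series:
  assumes "w \<in> bidisc"
  shows "power_series2 (\<lambda>n. cnj (mono2 n w)) (szego w)"
  unfolding power_series2_iff
proof
  fix z assume z: "z \<in> bidisc"
  have "((\<lambda>n. (fst z * cnj (fst w)) ^ fst n * (snd z * cnj (snd w)) ^ snd n) has_sum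
    1 / ((1 - fst z * cnj (fst w)) * (1 - snd z * cnj (snd w)))) UNIV"
    by (rule has_sum_geometric2[OF bidisc_mult_cnj_less_1[OF z assms]])
  then show "((\<lambda>n. cnj (mono2 n w) * mono2 n z) has_sum szego w z) UNIV"
    using z by (simp add: szego_def szego_kernel_def mono2_def power_mult_distrib mult_ac)
qed

lemma szego_square_summable:
  assumes "w \<in> bidisc"
  shows "square_summable (\<lambda>n. cnj (mono2 n w))"
proof -
  have "norm ((cmod (fst w))\<^sup>2) < 1" "norm ((cmod (snd w))\<^sup>2) < 1"
    using assms by (auto simp: bidisc_def abs_square_less_1)
  from has_sum_geometric2[OF this] have
    "(\<lambda>n. ((cmod (fst w))\<^sup>2) ^ fst n * ((cmod (snd w))\<^sup>2) ^ snd n) summable_on UNIV"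
    by (rule has_sum_imp_summable)
  then show ?thesis
    by (simp add: mono2_def norm_mult norm_power power_mult_distrib power_mult[symmetric] mult.commute)
qed

lemma szego_H2: "w \<in> bidisc \<Longrightarrow> szego w \<in> H2"
  by (rule H2I[OF _ szego_square_summable szego_power_series]) (auto simp: szego_def)

text \<open>The kernel has the conjugated monomials at w as coefficients, so pairing with it
  evaluates the power series at w.\<close>

lemma H2_reproducing:
  assumes "f \<in> H2" "w \<in> bidisc"
  shows "H2_inner f (szego w) = f w"
proof -
  have "H2_coeff (szego w) = (\<lambda>n. cnj (mono2 n w))"
    by (rule H2_coeff_eq[OF szego_square_summable szego_power_series]) fact+
  then show ?thesis
    using H2_power_series[OF assms(1)] assms(2) by (auto simp: H2_inner_def power_series2_iff infsumI)
qed

lemma eventually_at_left_1: "eventually (\<lambda>r::real. 0 < r \<and> r < 1) (at_left 1)"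
  using eventually_at_left_real[of 0 "1::real"] by simp

lemma tendsto_power_at_left_1: "((\<lambda>r::real. r ^ k) \<longlongrightarrow> 1) (at_left 1)"
  by (rule tendsto_eq_intros | simp)+

text \<open>The bridge from integrals over the torus to the coefficient inner product. Identities in
  \<open>H2\<close> are later proved by computing the limit of the left-hand side in a second
  way.\<close>

lemma dil_inner_tendsto:
  assumes f: "f \<in> H2" and g: "g \<in> H2"
  shows "((\<lambda>r. L2_inner \<mu> (dil r f) (dil r g)) \<longlongrightarrow> H2_inner f g) (at_left 1)"
proof -
  let ?a = "H2_coeff f" and ?b = "H2_coeff g"
  let ?t = "\<lambda>r n. ?a n * cnj (?b n) * of_real (r ^ deg2 n * r ^ deg2 n)"
  have "((\<lambda>r. infsum (?t r) UNIV) \<longlongrightarrow> (\<Sum>\<^sub>\<infinity>n. ?a n * cnj (?b n))) (at_left 1)"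
  proof (rule Tannery_infsum)
    have "((\<lambda>r. ?t r n) \<longlongrightarrow> ?a n * cnj (?b n) * of_real (1 * 1)) (at_left 1)" for n
      by (intro tendsto_intros tendsto_power_at_left_1)
    then show "((\<lambda>r. ?t r n) \<longlongrightarrow> ?a n * cnj (?b n)) (at_left 1)" for n
      by simp
    show "\<forall>\<^sub>F r in at_left 1. \<forall>n. norm (?t r n) \<le> cmod (?a n) * cmod (?b n)"
      using eventually_at_left_1
    proof eventually_elim
      case (elim r)
      have "r ^ k * r ^ k \<le> 1" for k
        using elim by (intro mult_le_one power_le_one) auto
      then show ?case
        using elim by (auto simp: norm_mult norm_power intro!: mult_left_le simp del: of_real_mult)
    qed
    show "(\<lambda>n. cmod (?a n) * cmod (?b n)) summable_on UNIV"
      by (intro square_summable_product H2_square_summable f g)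
  qed simp
  moreover have "eventually (\<lambda>r. infsum (?t r) UNIV = L2_inner \<mu> (dil r f) (dil r g)) (at_left 1)"
    using eventually_at_left_1
    by eventually_elim (intro infsumI dil_inner2 H2_power_series f g; simp)
  ultimately show ?thesis
    unfolding H2_inner_def by (rule Lim_transform_eventually)
qed

section \<open>Boundary functions\<close>

lemma L2_norm_square: "(L2_norm M f)\<^sup>2 = (\<integral>x. (cmod (f x))\<^sup>2 \<partial>M)"
  by (simp add: L2_norm_def)

lemma L2_inner_self: "L2_inner M f f = of_real ((L2_norm M f)\<^sup>2)"
  unfolding L2_inner_def L2_norm_square
  by (simp only: integral_complex_of_real[symmetric] complex_norm_square)

lemma L2_inner_diff_left:
  assumes "f \<in> L2 M" "g \<in> L2 M" "h \<in> L2 M"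
  shows "L2_inner M (\<lambda>x. f x - g x) h = L2_inner M f h - L2_inner M g h"
  unfolding L2_inner_def left_diff_distrib
  by (intro Bochner_Integration.integral_diff L2_inner_integrable assms)

lemma L2_inner_commute: "L2_inner M f g = cnj (L2_inner M g f)"
  unfolding L2_inner_def by (subst Bochner_Integration.integral_cnj[symmetric]) (simp add: mult.commute)

lemma L2_inner_diff_right:
  assumes "f \<in> L2 M" "g \<in> L2 M" "h \<in> L2 M"
  shows "L2_inner M h (\<lambda>x. f x - g x) = L2_inner M h f - L2_inner M h g"
  using L2_inner_diff_left[OF assms] L2_inner_commute by (metis complex_cnj_diff)

lemma has_sum_diff:
  fixes f g :: "'a \<Rightarrow> 'b :: real_normed_vector"
  assumes "(f has_sum a) A" "(g has_sum b) A"
  shows "((\<lambda>x. f x - g x) has_sum (a - b)) A"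
  using has_sum_add[OF assms(1), of "\<lambda>x. - g x" "- b"] assms(2) by (simp add: has_sum_uminus)

text \<open>The squared \<open>L\<^sup>2\<close> distance from the dilate of radius \<open>r\<close> to the boundary function.\<close>

definition dil_defect :: "(c2 \<Rightarrow> complex) \<Rightarrow> real \<Rightarrow> real" where
  "dil_defect f r = (\<Sum>\<^sub>\<infinity>n. (cmod (H2_coeff f n))\<^sup>2 * (1 - r ^ deg2 n)\<^sup>2)"

lemma dil_defect_le:
  assumes "0 \<le> r" "r < 1"
  shows "(cmod (a n))\<^sup>2 * (1 - r ^ deg2 n)\<^sup>2 \<le> (cmod (a n))\<^sup>2"
proof -
  have "0 \<le> r ^ deg2 n" "r ^ deg2 n \<le> 1"
    using assms by (auto intro: power_le_one)
  then have "(1 - r ^ deg2 n)\<^sup>2 \<le> 1"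
    by (intro power_le_one) auto
  then show ?thesis
    by (intro mult_left_le) auto
qed

lemma dil_defect_summable:
  assumes "f \<in> H2" "0 \<le> r" "r < 1"
  shows "(\<lambda>n. (cmod (H2_coeff f n))\<^sup>2 * (1 - r ^ deg2 n)\<^sup>2) summable_on UNIV"
  by (rule summable_on_realI[OF _ H2_square_summable[OF assms(1)]])
    (use dil_defect_le[OF assms(2,3)] in simp)

lemma dil_defect_nonneg: "0 \<le> dil_defect f r"
  by (simp add: dil_defect_def infsum_nonneg)

lemma dil_defect_tendsto:
  assumes f: "f \<in> H2"
  shows "(dil_defect f \<longlongrightarrow> 0) (at_left 1)"
proof -
  let ?t = "\<lambda>r n. (cmod (H2_coeff f n))\<^sup>2 * (1 - r ^ deg2 n)\<^sup>2"
  have "((\<lambda>r. infsum (?t r) UNIV) \<longlongrightarrow> infsum (\<lambda>n. 0) (UNIV :: (nat \<times> nat) set)) (at_left (1::real))"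
  proof (rule Tannery_infsum)
    have "((\<lambda>r. ?t r n) \<longlongrightarrow> (cmod (H2_coeff f n))\<^sup>2 * (1 - 1)\<^sup>2) (at_left 1)" for n
      by (intro tendsto_intros tendsto_power_at_left_1)
    then show "((\<lambda>r. ?t r n) \<longlongrightarrow> 0) (at_left 1)" for n
      by simp
    show "\<forall>\<^sub>F r in at_left 1. \<forall>n. norm (?t r n) \<le> (cmod (H2_coeff f n))\<^sup>2"
      using eventually_at_left_1 by eventually_elim (auto simp: dil_defect_le)
  qed (auto intro: H2_square_summable f)
  then show ?thesis by (simp add: dil_defect_def[abs_def])
qed

lemma dil_diff_norm:
  assumes f: "f \<in> H2" and r: "0 \<le> r" "r < 1" and s: "0 \<le> s" "s < 1"
  shows "(L2_norm \<mu> (\<lambda>x. dil r f x - dil s f x))\<^sup>2 =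
    (\<Sum>\<^sub>\<infinity>n. (cmod (H2_coeff f n))\<^sup>2 * (r ^ deg2 n - s ^ deg2 n)\<^sup>2)"
proof -
  let ?a = "H2_coeff f"
  let ?t = "\<lambda>r s n. ?a n * cnj (?a n) * of_real (r ^ deg2 n * s ^ deg2 n)"
  note ps = H2_power_series[OF f]
  note L2 = dil_L2[OF ps r] dil_L2[OF ps s]
  have "((\<lambda>n. ?t r r n - ?t r s n - (?t s r n - ?t s s n)) has_sum
      L2_inner \<mu> (dil r f) (dil r f) - L2_inner \<mu> (dil r f) (dil s f) -
      (L2_inner \<mu> (dil s f) (dil r f) - L2_inner \<mu> (dil s f) (dil s f))) UNIV"
    using dil_inner2[OF ps r ps r] dil_inner2[OF ps r ps s] dil_inner2[OF ps s ps r] dil_inner2[OF ps s ps s]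
    by (intro has_sum_diff)
  also have "L2_inner \<mu> (dil r f) (dil r f) - L2_inner \<mu> (dil r f) (dil s f) -
      (L2_inner \<mu> (dil s f) (dil r f) - L2_inner \<mu> (dil s f) (dil s f)) =
      L2_inner \<mu> (\<lambda>x. dil r f x - dil s f x) (\<lambda>x. dil r f x - dil s f x)"
    by (simp add: L2_inner_diff_left L2_inner_diff_right L2_diff L2)
  also have "(\<lambda>n. ?t r r n - ?t r s n - (?t s r n - ?t s s n)) =
      (\<lambda>n. of_real ((cmod (?a n))\<^sup>2 * (r ^ deg2 n - s ^ deg2 n)\<^sup>2))"
    by (rule ext) (simp add: complex_norm_square[symmetric] power2_eq_square algebra_simps)
  finally have "((\<lambda>n. (cmod (?a n))\<^sup>2 * (r ^ deg2 n - s ^ deg2 n)\<^sup>2) has_sum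
      (L2_norm \<mu> (\<lambda>x. dil r f x - dil s f x))\<^sup>2) UNIV"
    unfolding L2_inner_self by (simp only: has_sum_of_real_iff)
  then show ?thesis by (simp add: infsumI)
qed

text \<open>For s \<le> r < 1 each difference r^n - s^n lies between 0 and 1 - s^n. Thus the smaller
  radius alone controls the distance, uniformly in the larger one.\<close>

lemma dil_diff_le_defect:
  assumes f: "f \<in> H2" and s: "0 \<le> s" "s \<le> r" and r: "r < 1"
  shows "(L2_norm \<mu> (\<lambda>x. dil r f x - dil s f x))\<^sup>2 \<le> dil_defect f s"
proof -
  have le: "(r ^ deg2 n - s ^ deg2 n)\<^sup>2 \<le> (1 - s ^ deg2 n)\<^sup>2" for n
  proof (rule power_mono)
    show "r ^ deg2 n - s ^ deg2 n \<le> 1 - s ^ deg2 n"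
      using s r by (simp add: power_le_one)
    show "0 \<le> r ^ deg2 n - s ^ deg2 n"
      using s by (simp add: power_mono)
  qed
  have sm: "(\<lambda>n. (cmod (H2_coeff f n))\<^sup>2 * (1 - s ^ deg2 n)\<^sup>2) summable_on UNIV"
    by (rule dil_defect_summable) (use f s r in auto)
  have "(L2_norm \<mu> (\<lambda>x. dil r f x - dil s f x))\<^sup>2 =
    (\<Sum>\<^sub>\<infinity>n. (cmod (H2_coeff f n))\<^sup>2 * (r ^ deg2 n - s ^ deg2 n)\<^sup>2)"
    using f s r by (intro dil_diff_norm) auto
  also have "\<dots> \<le> dil_defect f s"
    unfolding dil_defect_def
  proof (rule infsum_mono[OF _ sm])
    show "(\<lambda>n. (cmod (H2_coeff f n))\<^sup>2 * (r ^ deg2 n - s ^ deg2 n)\<^sup>2) summable_on UNIV"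
      by (rule summable_on_realI[OF _ sm]) (use le in \<open>auto intro: mult_left_mono\<close>)
  qed (use le in \<open>auto intro: mult_left_mono\<close>)
  finally show ?thesis .
qed

lemma L2_norm_minus_commute: "L2_norm M (\<lambda>x. f x - g x) = L2_norm M (\<lambda>x. g x - f x)"
  unfolding L2_norm_def by (subst norm_minus_commute) simp

text \<open>By monotone convergence the sum of the increments has finite integral, hence is finite
  almost everywhere; there the telescoping series converges absolutely.\<close>

lemma AE_convergent_of_summable_norms:
  fixes u :: "nat \<Rightarrow> 'a \<Rightarrow> complex"
  assumes [measurable]: "\<And>k. u k \<in> borel_measurable M"
    and int: "\<And>k. integrable M (\<lambda>x. cmod (u (Suc k) x - u k x))"
    and sm: "summable (\<lambda>k. \<integral>x. cmod (u (Suc k) x - u k x) \<partial>M)"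
  shows "AE x in M. convergent (\<lambda>k. u k x)"
proof -
  let ?d = "\<lambda>k x. cmod (u (Suc k) x - u k x)"
  have "(\<integral>\<^sup>+x. (\<Sum>k. ennreal (?d k x)) \<partial>M) = (\<Sum>k. \<integral>\<^sup>+x. ennreal (?d k x) \<partial>M)"
    by (rule nn_integral_suminf) measurable
  also have "\<dots> = (\<Sum>k. ennreal (\<integral>x. ?d k x \<partial>M))"
    by (simp add: nn_integral_eq_integral[OF int])
  also have "\<dots> \<noteq> \<infinity>"
    using sm by (simp add: ennreal_suminf_neq_top)
  finally have "AE x in M. (\<Sum>k. ennreal (?d k x)) \<noteq> \<infinity>"
    by (intro nn_integral_PInf_AE) measurable
  then show ?thesis
  proof eventually_elim
    case (elim x)
    have "summable (\<lambda>k. ?d k x)"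
      by (rule summable_suminf_not_top) (use elim in auto)
    then have "summable (\<lambda>k. u (Suc k) x - u k x)"
      by (rule summable_norm_cancel)
    then have "convergent (\<lambda>n. \<Sum>k<n. u (Suc k) x - u k x)"
      by (simp add: summable_iff_convergent)
    then have "convergent (\<lambda>n. u n x - u 0 x)"
      by (simp only: sum_lessThan_telescope[of "\<lambda>n. u n x"])
    then obtain L where "(\<lambda>n. u n x - u 0 x) \<longlonglongrightarrow> L"
      unfolding convergent_def by blast
    then have "(\<lambda>n. u n x - u 0 x + u 0 x) \<longlonglongrightarrow> L + u 0 x"
      by (intro tendsto_intros)
    then show ?case
      unfolding convergent_def by auto
  qed
qed

text \<open>Radii are picked so sparsely that consecutive dilates have geometrically small
  \<open>L2\<close> distance. As the torus has measure 1, Cauchy-Schwarz turns this into summable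
  \<open>L1\<close> distances, and almost everywhere convergence follows.\<close>

lemma dil_boundary_sequence:
  assumes f: "f \<in> H2"
  obtains \<rho> where "\<And>k. 0 < \<rho> k" "\<And>k. \<rho> k < 1" "\<rho> \<longlonglongrightarrow> 1"
    "AE x in \<mu>. convergent (\<lambda>k. dil (\<rho> k) f x)"
proof -
  \<comment> \<open>The defect is a squared distance, so (1/4)^k becomes (1/2)^k for the norm. The
    lower bound on r forces the radii to tend to 1.\<close>
  have "\<exists>r. (0 < r \<and> r < 1) \<and> 1 - 1 / real (Suc k) < r \<and> dil_defect f r < (1/4) ^ k" for k
  proof (rule eventually_happens'[of "at_left (1::real)"])
    show "\<forall>\<^sub>F r in at_left 1. (0 < r \<and> r < 1) \<and> 1 - 1 / real (Suc k) < r \<and> dil_defect f r < (1/4) ^ k"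
      using dil_defect_tendsto[OF f, THEN order_tendstoD(2), of "(1/4) ^ k"]
        eventually_at_left_real[of "1 - 1 / real (Suc k)" "1::real"]
      by (intro eventually_conj eventually_at_left_1) (auto elim: eventually_mono)
  qed simp
  then obtain \<rho> where \<rho>: "\<And>k. 0 < \<rho> k" "\<And>k. \<rho> k < 1" "\<And>k. 1 - 1 / real (Suc k) < \<rho> k"
    "\<And>k. dil_defect f (\<rho> k) < (1/4) ^ k"
    by metis
  note L2 = dil_L2[OF H2_power_series[OF f] less_imp_le[OF \<rho>(1)] \<rho>(2)]
  have lim: "\<rho> \<longlonglongrightarrow> 1"
  proof (rule tendsto_sandwich)
    show "(\<lambda>k. 1 - 1 / real (Suc k)) \<longlonglongrightarrow> 1"
      using tendsto_diff[OF tendsto_const LIMSEQ_inverse_real_of_nat, of 1] by (simp add: inverse_eq_divide)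
  qed (use \<rho>(2,3) in \<open>auto intro!: always_eventually less_imp_le\<close>)
  let ?d = "\<lambda>k x. dil (\<rho> (Suc k)) f x - dil (\<rho> k) f x"
  have dL2: "?d k \<in> L2 \<mu>" for k
    by (intro L2_diff L2)
  have one: "(\<lambda>_. 1) \<in> L2 \<mu>"
    by (rule torus_bounded_L2[where C = 1]) auto
  have norm_d: "L2_norm \<mu> (?d k) \<le> 2 * (1/2) ^ k" for k
  proof (rule power2_le_imp_le)
    \<comment> \<open>The chosen radii need not increase. The sum of both defects covers whichever
      of the two is the smaller radius.\<close>
    have "(L2_norm \<mu> (?d k))\<^sup>2 \<le> dil_defect f (\<rho> k) + dil_defect f (\<rho> (Suc k))"
    proof (cases "\<rho> k \<le> \<rho> (Suc k)")
      case True
      then show ?thesis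
        using dil_diff_le_defect[OF f _ True] \<rho>(1)[of k] \<rho>(2)[of "Suc k"] dil_defect_nonneg[of f "\<rho> (Suc k)"]
        by auto
    next
      case False
      then have "\<rho> (Suc k) \<le> \<rho> k" by simp
      then show ?thesis
        unfolding L2_norm_minus_commute[of \<mu> "dil (\<rho> (Suc k)) f"]
        using dil_diff_le_defect[OF f, of "\<rho> (Suc k)" "\<rho> k"] \<rho>(1)[of "Suc k"] \<rho>(2)[of k]
          dil_defect_nonneg[of f "\<rho> k"]
        by auto
    qed
    also have "\<dots> \<le> (1/4) ^ k + (1/4) ^ Suc k"
      using \<rho>(4)[of k] \<rho>(4)[of "Suc k"] by (intro add_mono less_imp_le)
    also have "\<dots> \<le> (2 * (1/2) ^ k)\<^sup>2"
    proof -
      have "((1/2 :: real) ^ k)\<^sup>2 = (1/4) ^ k"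
        unfolding power2_eq_square power_mult_distrib[symmetric] by simp
      then show ?thesis by (simp add: power_mult_distrib)
    qed
    finally show "(L2_norm \<mu> (?d k))\<^sup>2 \<le> (2 * (1/2) ^ k)\<^sup>2" .
  qed simp
  have int: "integrable \<mu> (\<lambda>x. cmod (?d k x))" for k
    using L2_product_integrable[OF dL2 one] by simp
  have "(\<integral>x. cmod (?d k x) \<partial>\<mu>) \<le> 2 * (1/2) ^ k" for k
  proof -
    have "L2_norm \<mu> (\<lambda>_. 1) = 1"
      by (simp add: L2_norm_def measure_torus)
    then show ?thesis
      using L2_Cauchy_Schwarz[OF dL2 one, of k] norm_d[of k] by simp
  qed
  then have le: "norm (\<integral>x. cmod (?d k x) \<partial>\<mu>) \<le> 2 * (1/2) ^ k" for k
    by simp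
  have sm: "summable (\<lambda>k. 2 * (1/2::real) ^ k)"
    by (rule summable_mult, rule summable_geometric) simp
  have "summable (\<lambda>k. \<integral>x. cmod (?d k x) \<partial>\<mu>)"
    by (rule summable_comparison_test'[OF sm, of 0]) (rule le)
  then have "AE x in \<mu>. convergent (\<lambda>k. dil (\<rho> k) f x)"
    by (rule AE_convergent_of_summable_norms[where u = "\<lambda>k. dil (\<rho> k) f", OF L2_measurable[OF L2] int])
  with \<rho>(1,2) lim show thesis by (rule that)
qed

text \<open>The limit along one sequence of radii is the candidate. Since
  \<open>dil_defect f s\<close> bounds the distance from the dilate of radius s to all later
  dilates, Fatou's lemma for integrals passes the bound to the candidate. This gives convergence
  along all radii and not only along the sequence.\<close>

lemma H2_boundary_exists:
  assumes f: "f \<in> H2"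
  shows "\<exists>F. F \<in> L2 \<mu> \<and>
     ((\<lambda>r. L2_norm \<mu> (\<lambda>x. dil r f x - F x)) \<longlongrightarrow> 0) (at_left 1)"
proof -
  obtain \<rho> where \<rho>: "\<And>k. 0 < \<rho> k" "\<And>k. \<rho> k < 1" "\<rho> \<longlonglongrightarrow> 1"
    "AE x in \<mu>. convergent (\<lambda>k. dil (\<rho> k) f x)"
    by (rule dil_boundary_sequence[OF f]) (rule that)
  note L2 = dil_L2[OF H2_power_series[OF f]]
  note [measurable] = L2_measurable[OF L2]
  have [measurable]: "dil (\<rho> k) f \<in> borel_measurable \<mu>" for k
    using L2_measurable[OF L2] \<rho>(1,2) less_imp_le by blast
  define F where "F x = lim (\<lambda>k. dil (\<rho> k) f x)" for x
  have [measurable]: "F \<in> borel_measurable \<mu>"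
    unfolding F_def by (rule borel_measurable_lim_metric) measurable
  have bound: "(\<integral>\<^sup>+x. ennreal ((cmod (dil s f x - F x))\<^sup>2) \<partial>\<mu>) \<le> ennreal (dil_defect f s)"
    if s: "0 < s" "s < 1" for s
  proof -
    have [measurable]: "dil s f \<in> borel_measurable \<mu>"
      using s by (intro L2_measurable L2) auto
    have "(\<integral>\<^sup>+x. ennreal ((cmod (dil s f x - F x))\<^sup>2) \<partial>\<mu>) =
        (\<integral>\<^sup>+x. liminf (\<lambda>k. ennreal ((cmod (dil s f x - dil (\<rho> k) f x))\<^sup>2)) \<partial>\<mu>)"
    proof (rule nn_integral_cong_AE)
      show "AE x in \<mu>. ennreal ((cmod (dil s f x - F x))\<^sup>2) =
          liminf (\<lambda>k. ennreal ((cmod (dil s f x - dil (\<rho> k) f x))\<^sup>2))"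
        using \<rho>(4)
      proof eventually_elim
        case (elim x)
        then have "(\<lambda>k. dil (\<rho> k) f x) \<longlonglongrightarrow> F x"
          by (simp add: F_def convergent_LIMSEQ_iff)
        then have "(\<lambda>k. ennreal ((cmod (dil s f x - dil (\<rho> k) f x))\<^sup>2))
            \<longlonglongrightarrow> ennreal ((cmod (dil s f x - F x))\<^sup>2)"
          by (intro tendsto_ennrealI tendsto_intros)
        then show ?case
          by (intro lim_imp_Liminf[symmetric]) auto
      qed
    qed
    also have "\<dots> \<le> liminf (\<lambda>k. \<integral>\<^sup>+x. ennreal ((cmod (dil s f x - dil (\<rho> k) f x))\<^sup>2) \<partial>\<mu>)"
      by (rule nn_integral_liminf) measurable
    also have "\<dots> \<le> ennreal (dil_defect f s)"
    proof (rule Liminf_le)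
      have "eventually (\<lambda>k. s < \<rho> k) sequentially"
        using order_tendstoD(1)[OF \<rho>(3)] s by auto
      then show "\<forall>\<^sub>F k in sequentially. (\<integral>\<^sup>+x. ennreal ((cmod (dil s f x - dil (\<rho> k) f x))\<^sup>2) \<partial>\<mu>)
          \<le> ennreal (dil_defect f s)"
      proof eventually_elim
        case (elim k)
        have "(\<lambda>x. dil s f x - dil (\<rho> k) f x) \<in> L2 \<mu>"
          using s \<rho>(1,2)[of k] by (intro L2_diff L2) auto
        then have "(\<integral>\<^sup>+x. ennreal ((cmod (dil s f x - dil (\<rho> k) f x))\<^sup>2) \<partial>\<mu>) =
            ennreal ((L2_norm \<mu> (\<lambda>x. dil s f x - dil (\<rho> k) f x))\<^sup>2)"
          unfolding L2_norm_square by (intro nn_integral_eq_integral L2_square_integrable) auto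
        also have "\<dots> \<le> ennreal (dil_defect f s)"
          unfolding L2_norm_minus_commute[of \<mu> "dil s f"]
          using s elim \<rho>(2)[of k] by (intro ennreal_leI dil_diff_le_defect[OF f]) auto
        finally show ?case .
      qed
    qed simp
    finally show ?thesis .
  qed
  have diff_L2: "(\<lambda>x. dil s f x - F x) \<in> L2 \<mu>" if s: "0 < s" "s < 1" for s
  proof -
    have [measurable]: "dil s f \<in> borel_measurable \<mu>"
      using s by (intro L2_measurable L2) auto
    have "integrable \<mu> (\<lambda>x. (cmod (dil s f x - F x))\<^sup>2)"
      by (rule integrableI_bounded) (use le_less_trans[OF bound[OF s]] in simp_all)
    then show ?thesis by (simp add: L2_def)
  qed
  \<comment> \<open>F is square integrable because one dilate is and its distance to F is finite;
    any radius in (0, 1) serves.\<close>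
  have "(\<lambda>x. dil (1/2) f x - (dil (1/2) f x - F x)) \<in> L2 \<mu>"
    by (intro L2_diff[OF L2 diff_L2]) auto
  then have "F \<in> L2 \<mu>" by simp
  moreover have "((\<lambda>r. L2_norm \<mu> (\<lambda>x. dil r f x - F x)) \<longlongrightarrow> 0) (at_left 1)"
  proof (rule tendsto_sandwich[of "\<lambda>_. 0" _ _ "\<lambda>r. sqrt (dil_defect f r)"])
    show "((\<lambda>r. sqrt (dil_defect f r)) \<longlongrightarrow> 0) (at_left 1)"
      using tendsto_real_sqrt[OF dil_defect_tendsto[OF f]] by simp
    show "\<forall>\<^sub>F r in at_left 1. L2_norm \<mu> (\<lambda>x. dil r f x - F x) \<le> sqrt (dil_defect f r)"
      using eventually_at_left_1
    proof eventually_elim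
      case (elim r)
      have "ennreal (\<integral>x. (cmod (dil r f x - F x))\<^sup>2 \<partial>\<mu>) \<le> ennreal (dil_defect f r)"
        using bound[of r] elim
        by (subst nn_integral_eq_integral[symmetric]) (auto intro!: L2_square_integrable diff_L2)
      then show ?case
        unfolding L2_norm_def by (simp add: dil_defect_nonneg)
    qed
  qed (auto simp: L2_norm_nonneg)
  ultimately show ?thesis by blast
qed

lemma H2_boundary_L2: "f \<in> H2 \<Longrightarrow> H2_boundary f \<in> L2 \<mu>"
  and H2_boundary_tendsto: "f \<in> H2 \<Longrightarrow>
    ((\<lambda>r. L2_norm \<mu> (\<lambda>x. dil r f x - H2_boundary f x)) \<longlongrightarrow> 0) (at_left 1)"
  using someI_ex[OF H2_boundary_exists[of f, unfolded dil_def]]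
  unfolding H2_boundary_def[symmetric] dil_def by auto

lemma norm_product_diff_le:
  "cmod (p * cnj q - P * cnj Q) \<le>
    cmod (p - P) * cmod (q - Q) + cmod (p - P) * cmod Q + cmod P * cmod (q - Q)"
proof -
  have "p * cnj q - P * cnj Q = (p - P) * cnj (q - Q) + (p - P) * cnj Q + P * cnj (q - Q)"
    by (simp add: algebra_simps)
  also have "cmod \<dots> \<le> cmod ((p - P) * cnj (q - Q)) + cmod ((p - P) * cnj Q) + cmod (P * cnj (q - Q))"
    by (intro norm_triangle_le add_mono order_refl)
  finally show ?thesis
    by (simp only: norm_mult complex_mod_cnj)
qed

text \<open>The common core of three facts, with the weight 1 (inner products of boundary
  functions), the conjugated dilates of a multiplier, and the squared modulus of the dilates of an
  inner function. The dilates of f and g converge in \<open>L2\<close>, the weights only boundedly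
  almost everywhere, so the two limits are taken separately: A r - B r replaces the dilates by
  boundary functions, and in B r only the weight still moves.\<close>

lemma dil_weighted_tendsto:
  fixes u :: "real \<Rightarrow> c2 \<Rightarrow> complex"
  assumes f: "f \<in> H2" and g: "g \<in> H2"
    and u_meas: "\<And>r. 0 < r \<Longrightarrow> r < 1 \<Longrightarrow> u r \<in> borel_measurable \<mu>"
    and u_bound: "\<And>r x. 0 < r \<Longrightarrow> r < 1 \<Longrightarrow> x \<in> torus \<Longrightarrow> cmod (u r x) \<le> C"
    and v_meas [measurable]: "v \<in> borel_measurable \<mu>"
    and lim: "AE x in \<mu>. ((\<lambda>r. u r x) \<longlongrightarrow> v x) (at_left 1)"
  shows "((\<lambda>r. \<integral>x. u r x * (dil r f x * cnj (dil r g x)) \<partial>\<mu>) \<longlongrightarrow>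
    (\<integral>x. v x * (H2_boundary f x * cnj (H2_boundary g x)) \<partial>\<mu>)) (at_left 1)"
proof -
  let ?F = "H2_boundary f" and ?G = "H2_boundary g"
  note FG = H2_boundary_L2[OF f] H2_boundary_L2[OF g]
  note FG_meas [measurable] = FG[THEN L2_measurable]
  have C0: "0 \<le> C"
  proof -
    have "(1, 1) \<in> torus" by (simp add: torus_def)
    then show ?thesis
      by (intro order_trans[OF norm_ge_zero u_bound[of "1/2" "(1, 1)"]]) simp_all
  qed
  let ?a = "\<lambda>r x. dil r f x - ?F x" and ?b = "\<lambda>r x. dil r g x - ?G x"
  define A where "A r = (\<integral>x. u r x * (dil r f x * cnj (dil r g x)) \<partial>\<mu>)" for r
  define B where "B r = (\<integral>x. u r x * (?F x * cnj (?G x)) \<partial>\<mu>)" for r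
  define e where "e r = L2_norm \<mu> (?a r) * L2_norm \<mu> (?b r) + L2_norm \<mu> (?a r) * L2_norm \<mu> ?G +
      L2_norm \<mu> ?F * L2_norm \<mu> (?b r)" for r
  have AB: "cmod (A r - B r) \<le> C * e r" if r: "0 < r" "r < 1" for r
  proof -
    have L2: "dil r f \<in> L2 \<mu>" "dil r g \<in> L2 \<mu>"
      using r by (simp_all add: dil_L2[OF H2_power_series[OF f]] dil_L2[OF H2_power_series[OF g]])
    have ab: "?a r \<in> L2 \<mu>" "?b r \<in> L2 \<mu>"
      by (intro L2_diff L2 FG)+
    note [measurable] = u_meas[OF r] L2[THEN L2_measurable]
    have uint: "integrable \<mu> (\<lambda>x. u r x * (p x * cnj (q x)))" if pq: "p \<in> L2 \<mu>" "q \<in> L2 \<mu>" for p q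
      unfolding mult.assoc[symmetric]
      by (intro L2_inner_integrable L2_bounded_mult[where C = C] pq AE_I2)
        (use u_bound[OF r] in auto)
    have I: "integrable \<mu> (\<lambda>x. cmod (?a r x) * cmod (?b r x))"
      "integrable \<mu> (\<lambda>x. cmod (?a r x) * cmod (?G x))"
      "integrable \<mu> (\<lambda>x. cmod (?F x) * cmod (?b r x))"
      by (rule L2_product_integrable; rule ab FG)+
    have AB_eq: "A r - B r = (\<integral>x. u r x * (dil r f x * cnj (dil r g x) - ?F x * cnj (?G x)) \<partial>\<mu>)"
      unfolding A_def B_def right_diff_distrib
      by (intro Bochner_Integration.integral_diff[symmetric] uint L2 FG)
    have "cmod (A r - B r) \<le> (\<integral>x. C * (cmod (?a r x) * cmod (?b r x) + cmod (?a r x) * cmod (?G x) +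
        cmod (?F x) * cmod (?b r x)) \<partial>\<mu>)"
      unfolding AB_eq
    proof (rule Bochner_Integration.integral_norm_bound_integral)
      show "integrable \<mu> (\<lambda>x. u r x * (dil r f x * cnj (dil r g x) - ?F x * cnj (?G x)))"
        unfolding right_diff_distrib by (intro Bochner_Integration.integrable_diff uint L2 FG)
      show "integrable \<mu> (\<lambda>x. C * (cmod (?a r x) * cmod (?b r x) + cmod (?a r x) * cmod (?G x) +
          cmod (?F x) * cmod (?b r x)))"
        by (rule integrable_mult_right,
            rule Bochner_Integration.integrable_add[OF Bochner_Integration.integrable_add[OF I(1,2)] I(3)])
      fix x assume "x \<in> space \<mu>"
      then show "norm (u r x * (dil r f x * cnj (dil r g x) - ?F x * cnj (?G x))) \<le>
          C * (cmod (?a r x) * cmod (?b r x) + cmod (?a r x) * cmod (?G x) + cmod (?F x) * cmod (?b r x))"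
        unfolding norm_mult
        by (intro mult_mono[OF u_bound[OF r]] norm_product_diff_le C0) simp_all
    qed
    also have "\<dots> = C * ((\<integral>x. cmod (?a r x) * cmod (?b r x) \<partial>\<mu>) + (\<integral>x. cmod (?a r x) * cmod (?G x) \<partial>\<mu>) +
        (\<integral>x. cmod (?F x) * cmod (?b r x) \<partial>\<mu>))"
      unfolding integral_mult_right_zero
        Bochner_Integration.integral_add[OF Bochner_Integration.integrable_add[OF I(1,2)] I(3)]
        Bochner_Integration.integral_add[OF I(1,2)] ..
    also have "\<dots> \<le> C * e r"
      unfolding e_def
      by (rule mult_left_mono[OF _ C0], intro add_mono; rule L2_Cauchy_Schwarz; rule ab FG)
    finally show ?thesis .
  qed
  have "(e \<longlongrightarrow> 0 * 0 + 0 * L2_norm \<mu> ?G + L2_norm \<mu> ?F * 0) (at_left 1)"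
    unfolding e_def by (intro tendsto_intros H2_boundary_tendsto f g)
  then have e0: "((\<lambda>r. C * e r) \<longlongrightarrow> 0) (at_left 1)"
    using tendsto_mult_left[of e 0 "at_left 1" C] by simp
  have "((\<lambda>r. A r - B r) \<longlongrightarrow> 0) (at_left 1)"
    by (rule Lim_null_comparison[OF _ e0]) (rule eventually_mono[OF eventually_at_left_1], simp add: AB)
  moreover have "(B \<longlongrightarrow> (\<integral>x. v x * (?F x * cnj (?G x)) \<partial>\<mu>)) (at_left 1)"
  \<comment> \<open>Dominated convergence is a statement about sequences, so the left limit is
    tested along sequences of radii.\<close>
  proof (rule tendsto_at_left_sequentially[of 0])
    fix S :: "nat \<Rightarrow> real"
    assume S: "\<And>n. S n < 1" "\<And>n. 0 < S n" "S \<longlonglongrightarrow> 1"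
    have S_lim: "filterlim S (at_left 1) sequentially"
      by (simp add: filterlim_at S less_imp_neq[OF S(1)])
    have lim': "AE x in \<mu>. (\<lambda>n. u (S n) x) \<longlonglongrightarrow> v x"
      using lim by eventually_elim (rule filterlim_compose[OF _ S_lim])
    note [measurable] = u_meas[OF S(2) S(1)]
    show "(\<lambda>n. B (S n)) \<longlonglongrightarrow> (\<integral>x. v x * (?F x * cnj (?G x)) \<partial>\<mu>)"
      unfolding B_def
    proof (rule integral_dominated_convergence[where w = "\<lambda>x. C * (cmod (?F x) * cmod (?G x))"])
      show "integrable \<mu> (\<lambda>x. C * (cmod (?F x) * cmod (?G x)))"
        by (intro integrable_mult_right L2_product_integrable FG)
      show "AE x in \<mu>. (\<lambda>n. u (S n) x * (?F x * cnj (?G x))) \<longlonglongrightarrow> v x * (?F x * cnj (?G x))"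
        using lim' by eventually_elim (intro tendsto_mult tendsto_const)
      show "AE x in \<mu>. norm (u (S n) x * (?F x * cnj (?G x))) \<le> C * (cmod (?F x) * cmod (?G x))" for n
        using u_bound[OF S(2,1)] by (intro AE_I2) (simp add: norm_mult mult_right_mono)
      show "(\<lambda>x. v x * (?F x * cnj (?G x))) \<in> borel_measurable \<mu>"
        by (intro borel_measurable_times v_meas FG_meas measurable_compose[OF FG_meas(2) cnj_measurable])
      show "(\<lambda>x. u (S n) x * (?F x * cnj (?G x))) \<in> borel_measurable \<mu>" for n
        by (intro borel_measurable_times u_meas S FG_meas measurable_compose[OF FG_meas(2) cnj_measurable])
    qed
  qed simp
  ultimately have "((\<lambda>r. A r - B r + B r) \<longlongrightarrow> 0 + (\<integral>x. v x * (?F x * cnj (?G x)) \<partial>\<mu>)) (at_left 1)"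
    by (intro tendsto_add)
  then show ?thesis by (simp add: A_def)
qed

lemma L2_inner_boundary:
  assumes "f \<in> H2" "g \<in> H2"
  shows "L2_inner \<mu> (H2_boundary f) (H2_boundary g) = H2_inner f g"
proof (rule tendsto_unique[OF _ _ dil_inner_tendsto[OF assms]])
  show "((\<lambda>r. L2_inner \<mu> (dil r f) (dil r g)) \<longlongrightarrow>
      L2_inner \<mu> (H2_boundary f) (H2_boundary g)) (at_left 1)"
    using dil_weighted_tendsto[OF assms, of "\<lambda>_ _. 1" 1 "\<lambda>_. 1"] by (simp add: L2_inner_def)
qed simp

section \<open>Bounded multipliers of the Hardy space\<close>

lemma has_sum_times:
  fixes f :: "'a \<Rightarrow> complex" and g :: "'b \<Rightarrow> complex"
  assumes f: "(f has_sum a) A" and g: "(g has_sum b) B"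
  shows "((\<lambda>x. f (fst x) * g (snd x)) has_sum a * b) (A \<times> B)"
proof (rule has_sum_SigmaI)
  show "((\<lambda>y. f (fst (x, y)) * g (snd (x, y))) has_sum f x * b) B" for x
    using has_sum_cmult_right[OF g] by simp
  show "((\<lambda>x. f x * b) has_sum a * b) A"
    by (rule has_sum_cmult_left[OF f])
  have f': "(\<lambda>x. cmod (f x)) summable_on A" and g': "(\<lambda>x. cmod (g x)) summable_on B"
    using f g by (auto intro: summable_on_cmodI has_sum_imp_summable)
  have "(\<lambda>x. cmod (f (fst x) * g (snd x))) summable_on A \<times> B"
  proof (rule summable_on_SigmaI)
    show "((\<lambda>y. cmod (f (fst (x, y)) * g (snd (x, y)))) has_sum cmod (f x) * (\<Sum>\<^sub>\<infinity>y\<in>B. cmod (g y))) B" for x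
      using has_sum_cmult_right[OF has_sum_infsum[OF g'], of "cmod (f x)"] by (simp add: norm_mult)
    show "(\<lambda>x. cmod (f x) * (\<Sum>\<^sub>\<infinity>y\<in>B. cmod (g y))) summable_on A"
      by (rule summable_on_cmult_left[OF f'])
  qed simp
  then show "(\<lambda>x. f (fst x) * g (snd x)) summable_on A \<times> B"
    by (rule abs_summable_summable)
qed

text \<open>The Cauchy product in two indices. Regrouping the double family by the sum of the
  indices is legitimate for unordered sums, and each group is finite.\<close>

lemma power_series2_mult:
  assumes f: "power_series2 a f" and g: "power_series2 b g"
  shows "\<exists>c. power_series2 c (\<lambda>z. f z * g z)"
proof
  define I where "I n = {..fst n} \<times> {..snd n}" for n :: "nat \<times> nat"
  show "power_series2 (\<lambda>n. \<Sum>p\<in>I n. a p * b (fst n - fst p, snd n - snd p)) (\<lambda>z. f z * g z)"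
    unfolding power_series2_iff
  proof
    fix z assume z: "z \<in> bidisc"
    let ?t = "\<lambda>x. a (fst x) * mono2 (fst x) z * (b (snd x) * mono2 (snd x) z)"
    let ?s = "\<lambda>(n, p). a p * b (fst n - fst p, snd n - snd p) * mono2 n z"
    have "(?t has_sum f z * g z) (UNIV \<times> UNIV)"
      using f g z by (intro has_sum_times[of "\<lambda>n. a n * mono2 n z" _ _ "\<lambda>n. b n * mono2 n z"])
        (auto simp: power_series2_iff)
    also have "(?t has_sum f z * g z) (UNIV \<times> UNIV) \<longleftrightarrow> (?s has_sum f z * g z) (Sigma UNIV I)"
      by (rule has_sum_reindex_bij_witness[where
            i = "\<lambda>(n, p). (p, (fst n - fst p, snd n - snd p))" and
            j = "\<lambda>(p, q). ((fst p + fst q, snd p + snd q), p)"])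
        (auto simp: I_def mono2_def power_add mult_ac)
    finally have "(?s has_sum f z * g z) (Sigma UNIV I)" .
    then show "((\<lambda>n. (\<Sum>p\<in>I n. a p * b (fst n - fst p, snd n - snd p)) * mono2 n z) has_sum f z * g z) UNIV"
      by (rule has_sum_SigmaD) (auto simp: I_def sum_distrib_right intro!: has_sum_finiteI)
  qed
qed

lemma dil_norm_has_sum:
  assumes "power_series2 a f" "0 \<le> r" "r < 1"
  shows "((\<lambda>n. (cmod (a n))\<^sup>2 * (r ^ deg2 n * r ^ deg2 n)) has_sum (L2_norm \<mu> (dil r f))\<^sup>2) UNIV"
proof -
  have "a n * cnj (a n) * of_real (r ^ deg2 n * r ^ deg2 n) =
      of_real ((cmod (a n))\<^sup>2 * (r ^ deg2 n * r ^ deg2 n))" for n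
    by (simp only: of_real_mult complex_norm_square)
  then show ?thesis
    using dil_inner2[OF assms assms] unfolding L2_inner_self by (simp only: has_sum_of_real_iff)
qed

text \<open>The product has some power series. On each torus of radius r < 1 the pointwise bound on
  m gives the norm estimate for dilates, and r tending to 1 gives it for the coefficients; square
  summability is thus a consequence of the estimate.\<close>

lemma bounded_multiplier:
  assumes m: "power_series2 d m" and bound: "\<And>z. z \<in> bidisc \<Longrightarrow> cmod (m z) \<le> C"
    and f: "f \<in> H2"
  shows "(\<lambda>z. m z * f z) \<in> H2" "H2_norm (\<lambda>z. m z * f z) \<le> C * H2_norm f"
proof -
  let ?h = "\<lambda>z. m z * f z"
  obtain c where c: "power_series2 c ?h"
    using power_series2_mult[OF m H2_power_series[OF f]] by blast
  have C0: "0 \<le> C"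
    by (rule order_trans[OF norm_ge_zero bound[of "(0, 0)"]]) (simp add: bidisc_def)
  have dil_le: "(L2_norm \<mu> (dil r ?h))\<^sup>2 \<le> (C * H2_norm f)\<^sup>2" if r: "0 < r" "r < 1" for r
  proof -
    note r' = less_imp_le[OF r(1)] r(2)
    note L2 = dil_L2[OF c r'] dil_L2[OF H2_power_series[OF f] r']
    have "(L2_norm \<mu> (dil r ?h))\<^sup>2 \<le> (\<integral>x. C\<^sup>2 * (cmod (dil r f x))\<^sup>2 \<partial>\<mu>)"
      unfolding L2_norm_square
    proof (rule integral_mono[OF L2_square_integrable[OF L2(1)]])
      show "integrable \<mu> (\<lambda>x. C\<^sup>2 * (cmod (dil r f x))\<^sup>2)"
        by (intro integrable_mult_right L2_square_integrable L2)
      fix x assume "x \<in> space \<mu>"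
      then have "r *\<^sub>R x \<in> bidisc" using r by (intro scaleR_torus_bidisc) auto
      then show "(cmod (dil r ?h x))\<^sup>2 \<le> C\<^sup>2 * (cmod (dil r f x))\<^sup>2"
        by (auto simp: dil_def norm_mult power_mult_distrib bound intro!: mult_right_mono power_mono)
    qed
    also have "\<dots> = C\<^sup>2 * (L2_norm \<mu> (dil r f))\<^sup>2"
      by (simp add: L2_norm_square)
    also have "(L2_norm \<mu> (dil r f))\<^sup>2 \<le> (H2_norm f)\<^sup>2"
      unfolding H2_norm_square
    proof (rule has_sum_mono[OF dil_norm_has_sum[OF H2_power_series[OF f] r'] has_sum_infsum[OF H2_square_summable[OF f]]])
      have "r ^ k * r ^ k \<le> 1" for k
        using r by (intro mult_le_one power_le_one) auto
      then show "(cmod (H2_coeff f n))\<^sup>2 * (r ^ deg2 n * r ^ deg2 n) \<le> (cmod (H2_coeff f n))\<^sup>2" for n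
        using r by (intro mult_left_le) auto
    qed
    finally show ?thesis
      using C0 by (simp add: power_mult_distrib mult_left_mono)
  qed
  \<comment> \<open>No summable bound on the coefficients c is known at this stage, so the limit in
    r is taken over finite index sets.\<close>
  have fin: "(\<Sum>n\<in>A. (cmod (c n))\<^sup>2) \<le> (C * H2_norm f)\<^sup>2" if "finite A" for A
  proof (rule tendsto_upperbound)
    have "((\<lambda>r. \<Sum>n\<in>A. (cmod (c n))\<^sup>2 * (r ^ deg2 n * r ^ deg2 n)) \<longlongrightarrow>
        (\<Sum>n\<in>A. (cmod (c n))\<^sup>2 * (1 * 1))) (at_left 1)"
      by (intro tendsto_intros tendsto_power_at_left_1)
    then show "((\<lambda>r. \<Sum>n\<in>A. (cmod (c n))\<^sup>2 * (r ^ deg2 n * r ^ deg2 n)) \<longlongrightarrow> (\<Sum>n\<in>A. (cmod (c n))\<^sup>2)) (at_left 1)"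
      by simp
    show "\<forall>\<^sub>F r in at_left 1. (\<Sum>n\<in>A. (cmod (c n))\<^sup>2 * (r ^ deg2 n * r ^ deg2 n)) \<le> (C * H2_norm f)\<^sup>2"
      using eventually_at_left_1
    proof eventually_elim
      case (elim r)
      have "(\<Sum>n\<in>A. (cmod (c n))\<^sup>2 * (r ^ deg2 n * r ^ deg2 n)) \<le> (L2_norm \<mu> (dil r ?h))\<^sup>2"
        by (rule finite_sum_le_has_sum[OF dil_norm_has_sum[OF c]]) (use elim that in auto)
      with dil_le[of r] elim show ?case by linarith
    qed
  qed simp
  have sq: "square_summable c"
    by (rule nonneg_bdd_above_summable_on) (auto intro!: bdd_aboveI2 fin)
  show h: "?h \<in> H2"
    by (rule H2I[OF _ sq c]) (simp add: H2_outside f)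
  have "(H2_norm ?h)\<^sup>2 \<le> (C * H2_norm f)\<^sup>2"
    unfolding H2_norm_square H2_coeff_eq[OF sq c] by (rule infsum_le_finite_sums[OF sq fin])
  then show "H2_norm ?h \<le> C * H2_norm f"
    by (rule power2_le_imp_le) (simp add: C0 H2_norm_nonneg)
qed

section \<open>Separately holomorphic functions\<close>

text \<open>Separate holomorphy is easier to verify for \<open>B1 f\<close> and
  \<open>vartheta1\<close> than a joint derivative, and together with boundedness it already yields
  a power series on the bidisc.\<close>

definition sep_holo :: "(c2 \<Rightarrow> complex) \<Rightarrow> bool" where
  "sep_holo f \<longleftrightarrow> (\<forall>w\<in>ball 0 1. (\<lambda>z. f (z, w)) holomorphic_on ball 0 1) \<and>
    (\<forall>z\<in>ball 0 1. (\<lambda>w. f (z, w)) holomorphic_on ball 0 1)"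

lemma sep_holo_fst: "sep_holo f \<Longrightarrow> cmod w < 1 \<Longrightarrow> (\<lambda>z. f (z, w)) holomorphic_on ball 0 1"
  and sep_holo_snd: "sep_holo f \<Longrightarrow> cmod z < 1 \<Longrightarrow> (\<lambda>w. f (z, w)) holomorphic_on ball 0 1"
  by (auto simp: sep_holo_def)

lemma in_bidisc: "(z, w) \<in> bidisc \<longleftrightarrow> cmod z < 1 \<and> cmod w < 1"
  by (simp add: bidisc_def)

lemma holomorphic2_imp_sep_holo:
  assumes "holomorphic2 f"
  shows "sep_holo f"
proof -
  have "(\<lambda>z. f (z, w)) field_differentiable (at z) \<and> (\<lambda>w. f (z, w)) field_differentiable (at w)"
    if "cmod z < 1" "cmod w < 1" for z w
  proof -
    obtain a b where d: "(f has_derivative (\<lambda>h. a * fst h + b * snd h)) (at (z, w))"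
      using assms \<open>cmod z < 1\<close> \<open>cmod w < 1\<close> unfolding holomorphic2_def by (meson in_bidisc)
    have "((\<lambda>z. (z, w)) has_derivative (\<lambda>h. (h, 0))) (at z)"
      and "((\<lambda>w. (z, w)) has_derivative (\<lambda>h. (0, h))) (at w)"
      by (auto intro!: derivative_eq_intros)
    from this[THEN has_derivative_compose[where g = f]] d have "((\<lambda>z. f (z, w)) has_derivative (\<lambda>h. a * fst (h, 0::complex) + b * snd (h, 0::complex))) (at z)"
      and "((\<lambda>w. f (z, w)) has_derivative (\<lambda>h. a * fst (0::complex, h) + b * snd (0::complex, h))) (at w)"
      by blast+
    then show ?thesis
      by (auto simp: field_differentiable_def has_field_derivative_def intro: exI[of _ a] exI[of _ b])
  qed
  then show ?thesis
    by (auto simp: sep_holo_def holomorphic_on_open field_differentiable_def open_ball)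
qed

text \<open>The Schwarz lemma for (g - g 0) / (2 * M + 1). The difference is at most 2 * M in
  modulus; the extra 1 gives the strict inequality that the Schwarz lemma requires and keeps the
  divisor nonzero when M = 0.\<close>

lemma Schwarz_bound:
  assumes holo: "g holomorphic_on ball 0 1" and M: "\<And>z. cmod z < 1 \<Longrightarrow> cmod (g z) \<le> M"
    and z: "cmod z < 1"
  shows "cmod (g z - g 0) \<le> (2 * M + 1) * cmod z" "cmod (deriv g 0) \<le> 2 * M + 1"
proof -
  have M0: "0 \<le> M" using M[of 0] norm_ge_zero[of "g 0"] by (metis norm_zero order_trans zero_less_one)
  define h where "h z = (g z - g 0) / (2 * M + 1)" for z
  have h: "h holomorphic_on ball 0 1"
    unfolding h_def using M0 by (intro holomorphic_intros holo) (auto simp flip: of_real_add)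
  have nz: "complex_of_real (2 * M + 1) \<noteq> 0" "cmod (complex_of_real (2 * M + 1)) = 2 * M + 1"
    using M0 by (auto simp del: of_real_add of_real_mult)
  have h1: "cmod (h z) < 1" if "cmod z < 1" for z
  proof -
    have "cmod (g z - g 0) \<le> M + M"
      using M[OF that] M[of 0] by (intro norm_triangle_le_diff) auto
    then show ?thesis
      using M0 nz unfolding h_def by (simp add: norm_divide)
  qed
  have h0: "h 0 = 0" by (simp add: h_def)
  have "cmod (h z) \<le> cmod z"
    by (rule Schwarz_Lemma(1)[OF h h0 h1 z])
  then show "cmod (g z - g 0) \<le> (2 * M + 1) * cmod z"
    using M0 nz unfolding h_def by (simp add: norm_divide field_simps)
  have dh: "cmod (deriv h 0) \<le> 1"
    by (rule Schwarz_Lemma(2)[OF h h0 h1 z])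
  have "g field_differentiable at 0"
    using holo by (auto simp: holomorphic_on_open field_differentiable_def open_ball)
  then have "(g has_field_derivative deriv g 0) (at 0)"
    by (simp add: DERIV_deriv_iff_field_differentiable)
  from DERIV_cdivide[OF DERIV_diff[OF this DERIV_const]]
  have "deriv h 0 = deriv g 0 / (2 * M + 1)"
    unfolding h_def by (intro DERIV_imp_deriv) simp
  then show "cmod (deriv g 0) \<le> 2 * M + 1"
    using dh M0 nz by (simp add: norm_divide field_simps)
qed

lemma B1_bound:
  assumes f: "sep_holo f" and M: "\<And>z. z \<in> bidisc \<Longrightarrow> cmod (f z) \<le> M" and z: "z \<in> bidisc"
  shows "cmod (B1 f z) \<le> 2 * M + 1"
proof -
  obtain x w where zxw: "z = (x, w)" "cmod x < 1" "cmod w < 1"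
    using z by (cases z) (auto simp: in_bidisc)
  have fM: "cmod (f (x, w)) \<le> M" if "cmod x < 1" for x
    using M that zxw(3) by (simp add: in_bidisc)
  note S = Schwarz_bound[OF sep_holo_fst[OF f zxw(3)] fM zxw(2)]
  show ?thesis
    using S by (auto simp: B1_def zxw norm_divide field_simps)
qed

lemma B1_slice_holomorphic:
  assumes f: "sep_holo f" and w: "cmod w < 1"
  shows "(\<lambda>z. B1 f (z, w)) holomorphic_on ball 0 1"
  using pole_lemma[OF sep_holo_fst[OF f w], of 0]
  by (simp add: B1_def cong: if_cong)

text \<open>The only delicate slice is z1 = 0, where \<open>B1 f\<close> is a partial derivative in
  z1 whose holomorphy in the second variable is not immediate. It is the uniform limit of the slices
  at nonzero points s n tending to 0.\<close>

lemma B1_sep_holo: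
  assumes f: "sep_holo f" and M: "\<And>z. z \<in> bidisc \<Longrightarrow> cmod (f z) \<le> M"
  shows "sep_holo (B1 f)"
proof -
  have nz: "(\<lambda>w. B1 f (z, w)) holomorphic_on ball 0 1" if "cmod z < 1" "z \<noteq> 0" for z
    using that sep_holo_snd[OF f that(1)] sep_holo_snd[OF f, of 0]
    by (auto simp: B1_def intro!: holomorphic_intros)
  have "(\<lambda>w. B1 f (0, w)) holomorphic_on ball 0 1"
  proof (rule holomorphic_uniform_sequence[OF open_ball])
    define s where "s n = complex_of_real (1 / real (Suc (Suc n)))" for n
    have s: "s n \<noteq> 0" "cmod (s n) < 1" for n
      by (simp_all add: s_def norm_divide del: of_nat_Suc of_real_divide)
    have s_lim: "(\<lambda>n. cmod (s n)) \<longlonglongrightarrow> 0"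
      using LIMSEQ_Suc[OF LIMSEQ_inverse_real_of_nat]
      by (simp add: s_def norm_divide inverse_eq_divide del: of_nat_Suc of_real_divide)
    show "(\<lambda>w. B1 f (s n, w)) holomorphic_on ball 0 1" for n
      by (rule nz) (rule s)+
    fix x :: complex assume x: "x \<in> ball 0 1"
    then obtain d where d: "d > 0" "cball x d \<subseteq> ball 0 1"
      by (meson open_ball open_contains_cball)
    \<comment> \<open>\<open>B1 f\<close> is bounded by 2 * M + 1, and \<open>Schwarz_bound\<close>
      is applied with this value in place of M.\<close>
    let ?K = "2 * (2 * M + 1) + 1"
    have le: "dist (B1 f (s n, w)) (B1 f (0, w)) \<le> ?K * cmod (s n)" if "w \<in> cball x d" for n w
    proof -
      have w: "cmod w < 1" using d that by auto
      have "cmod (B1 f (z, w)) \<le> 2 * M + 1" if "cmod z < 1" for z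
        by (rule B1_bound[OF f M]) (auto simp: in_bidisc w that)
      from Schwarz_bound(1)[OF B1_slice_holomorphic[OF f w] this s(2)]
      show ?thesis by (simp add: dist_norm)
    qed
    have "(\<lambda>n. ?K * cmod (s n)) \<longlonglongrightarrow> ?K * 0"
      by (intro tendsto_intros s_lim)
    then have "(\<lambda>n. ?K * cmod (s n)) \<longlonglongrightarrow> 0" by simp
    then have "uniform_limit (cball x d) (\<lambda>n w. B1 f (s n, w)) (\<lambda>w. B1 f (0, w)) sequentially"
      unfolding uniform_limit_iff
    proof (intro allI impI)
      fix e :: real assume "e > 0" and lim: "(\<lambda>n. ?K * cmod (s n)) \<longlonglongrightarrow> 0"
      then have "\<forall>\<^sub>F n in sequentially. ?K * cmod (s n) < e"
        by (rule order_tendstoD(2)[rotated])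
      then show "\<forall>\<^sub>F n in sequentially. \<forall>w\<in>cball x d. dist (B1 f (s n, w)) (B1 f (0, w)) < e"
        by eventually_elim (use le le_less_trans in blast)
    qed
    with d show "\<exists>d>0. cball x d \<subseteq> ball 0 1 \<and>
        uniform_limit (cball x d) (\<lambda>n w. B1 f (s n, w)) (\<lambda>w. B1 f (0, w)) sequentially"
      by blast
  qed
  with nz B1_slice_holomorphic[OF f] show ?thesis
    unfolding sep_holo_def by (metis mem_ball_0)
qed

section \<open>From separate holomorphy to a power series\<close>

lemma bounded_holomorphic_coeffs:
  assumes f: "f holomorphic_on ball 0 1" and M: "\<And>z. cmod z < 1 \<Longrightarrow> cmod (f z) \<le> M"
  obtains a where "\<And>n. cmod (a n) \<le> M" "\<And>z. cmod z < 1 \<Longrightarrow> (\<lambda>n. a n * z ^ n) sums f z"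
proof
  let ?a = "\<lambda>n. (deriv ^^ n) f 0 / fact n"
  show "(\<lambda>n. ?a n * z ^ n) sums f z" if "cmod z < 1" for z
    using holomorphic_power_series[OF f, of z] that by simp
  \<comment> \<open>Cauchy's inequality is available only on circles inside the disc; the factor r^n
    disappears as r tends to 1, and the bound M becomes independent of n.\<close>
  have le: "cmod (?a n) * r ^ n \<le> M" if r: "0 < r" "r < 1" for n r
  proof -
    have "cmod ((deriv ^^ n) f 0) \<le> fact n * M / r ^ n"
    proof (rule Cauchy_inequality)
      show "f holomorphic_on ball 0 r" "continuous_on (cball 0 r) f"
        using r holomorphic_on_imp_continuous_on[OF f]
        by (auto intro: holomorphic_on_subset[OF f] continuous_on_subset)
    qed (use r M in auto)
    then show ?thesis
      using r by (simp add: norm_divide field_simps)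
  qed
  show "cmod (?a n) \<le> M" for n
  proof (rule tendsto_upperbound)
    have "((\<lambda>r. cmod (?a n) * r ^ n) \<longlongrightarrow> cmod (?a n) * 1) (at_left 1)"
      by (intro tendsto_intros tendsto_power_at_left_1)
    then show "((\<lambda>r. cmod (?a n) * r ^ n) \<longlongrightarrow> cmod (?a n)) (at_left 1)" by simp
    show "\<forall>\<^sub>F r in at_left 1. cmod (?a n) * r ^ n \<le> M"
      using eventually_at_left_1 by eventually_elim (rule le; simp)
  qed simp
qed

text \<open>\<open>B1\<close> is the backward shift of the power series in z1. At z1 = 0 its value
  is the derivative, which is the coefficient of index 1, in agreement with the shifted
  series.\<close>

lemma B1_power_series:
  assumes a: "\<And>z. cmod z < 1 \<Longrightarrow> (\<lambda>n. a n * z ^ n) sums f (z, w)" and z: "cmod z < 1"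
  shows "(\<lambda>n. a (Suc n) * z ^ n) sums B1 f (z, w)"
proof -
  have a0: "f (0, w) = a 0"
    using sums_unique2[OF a[of 0] powser_sums_zero] by simp
  show ?thesis
  proof (cases "z = 0")
    case False
    have "(\<lambda>n. a (Suc n) * z ^ Suc n) sums (f (z, w) - a 0)"
      using a[OF z] by (subst sums_Suc_iff) simp
    from sums_divide[OF this, of z] show ?thesis
      using False a0 by (simp add: B1_def mult.assoc[symmetric])
  next
    case True
    have sm: "summable (\<lambda>n. a n * (1/2) ^ n)"
      using a[of "1/2"] by (auto simp: sums_iff)
    have "((\<lambda>z. \<Sum>n. a n * z ^ n) has_field_derivative (\<Sum>n. diffs a n * 0 ^ n)) (at 0)"
      by (rule termdiffs_strong[OF sm]) simp
    moreover have "(\<Sum>n. diffs a n * 0 ^ n) = a 1"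
      using powser_sums_zero[of "diffs a"] by (simp add: sums_iff diffs_def)
    ultimately have "((\<lambda>z. \<Sum>n. a n * z ^ n) has_field_derivative a 1) (at 0)" by simp
    then have "((\<lambda>z. f (z, w)) has_field_derivative a 1) (at 0)"
      by (rule has_field_derivative_transform_within_open[where S = "ball 0 1"])
        (use a in \<open>auto simp: sums_iff\<close>)
    then have "B1 f (0, w) = a 1"
      by (simp add: B1_def DERIV_imp_deriv)
    then show ?thesis
      using powser_sums_zero[of "\<lambda>n. a (Suc n)"] True by simp
  qed
qed

text \<open>The k-th coefficient in z1 is the value at z1 = 0 after k applications of
  \<open>B1\<close>, which shows that it is holomorphic in the second variable. Expanding it again
  gives the double series, and the bound M on all coefficients makes that series absolutely
  convergent by comparison with a geometric one.\<close>

lemma sep_holo_power_series: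
  assumes f: "sep_holo f" and M: "\<And>z. z \<in> bidisc \<Longrightarrow> cmod (f z) \<le> M"
  shows "\<exists>a. power_series2 a f"
proof -
  define c where "c k w = ((B1 ^^ k) f) (0, w)" for k w
  \<comment> \<open>The bound K obtained here grows with k and serves only to iterate
    \<open>B1_sep_holo\<close>; the uniform bound M on the coefficients comes from Cauchy's
    inequality on the slices.\<close>
  have it: "sep_holo ((B1 ^^ k) f) \<and> (\<exists>K. \<forall>z\<in>bidisc. cmod (((B1 ^^ k) f) z) \<le> K)" for k
  proof (induction k)
    case (Suc k)
    then obtain K where K: "\<And>z. z \<in> bidisc \<Longrightarrow> cmod (((B1 ^^ k) f) z) \<le> K" by blast
    show ?case
      using B1_sep_holo[OF _ K] B1_bound[OF _ K] Suc by (auto intro!: exI[of _ "2 * K + 1"])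
  next
    case 0
    show ?case using f M by (intro conjI exI[of _ M] ballI) simp_all
  qed
  have c_holo: "c k holomorphic_on ball 0 1" for k
    unfolding c_def using it[of k] by (intro sep_holo_snd) auto
  have slice: "(\<forall>k. cmod (c k w) \<le> M) \<and> (\<forall>z. cmod z < 1 \<longrightarrow> (\<lambda>k. c k w * z ^ k) sums f (z, w))"
    if w: "cmod w < 1" for w
  proof -
    obtain a where a: "\<And>n. cmod (a n) \<le> M" "\<And>z. cmod z < 1 \<Longrightarrow> (\<lambda>n. a n * z ^ n) sums f (z, w)"
      by (rule bounded_holomorphic_coeffs[OF sep_holo_fst[OF f w], of M])
        (use M w in \<open>auto simp: in_bidisc\<close>)
    have "cmod z < 1 \<Longrightarrow> (\<lambda>n. a (n + k) * z ^ n) sums ((B1 ^^ k) f) (z, w)" for k z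
    proof (induction k arbitrary: z)
      case (Suc k)
      then show ?case using B1_power_series[of "\<lambda>n. a (n + k)" "(B1 ^^ k) f" w z] by simp
    qed (simp add: a)
    from this[of 0] have "c k w = a k" for k
      unfolding c_def using sums_unique2[OF _ powser_sums_zero[of "\<lambda>n. a (n + k)"]] by simp
    with a show ?thesis by simp
  qed
  have "\<exists>d. (\<forall>l. cmod (d l) \<le> M) \<and> (\<forall>w. cmod w < 1 \<longrightarrow> (\<lambda>l. d l * w ^ l) sums c k w)" for k
  proof -
    obtain d where "\<And>l. cmod (d l) \<le> M" "\<And>w. cmod w < 1 \<Longrightarrow> (\<lambda>l. d l * w ^ l) sums c k w"
      by (rule bounded_holomorphic_coeffs[OF c_holo[of k], of M]) (use slice in auto)
    then show ?thesis by blast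
  qed
  then obtain d where d: "\<And>k l. cmod (d k l) \<le> M"
    "\<And>k w. cmod w < 1 \<Longrightarrow> (\<lambda>l. d k l * w ^ l) sums c k w"
    by metis
  have sm: "summable (\<lambda>n. norm (e n * z ^ n))" if "\<And>n. cmod (e n) \<le> M" "cmod z < 1" for e z
  proof (rule summable_comparison_test')
    show "summable (\<lambda>n. M * cmod z ^ n)"
      using that by (intro summable_mult summable_geometric) simp
    show "norm (norm (e n * z ^ n)) \<le> M * cmod z ^ n" if "n \<ge> 0" for n
      by (simp add: norm_mult norm_power mult_right_mono \<open>cmod (e n) \<le> M\<close>)
  qed
  have "power_series2 (\<lambda>n. d (fst n) (snd n)) f"
    unfolding power_series2_iff
  proof
    fix p assume "p \<in> bidisc"
    then obtain z w where p: "p = (z, w)" and z: "cmod z < 1" and w: "cmod w < 1"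
      by (cases p) (auto simp: in_bidisc)
    have "((\<lambda>n. d (fst n) (snd n) * mono2 n p) has_sum f p) (UNIV \<times> UNIV)"
    proof (rule has_sum_SigmaI)
      have "((\<lambda>l. d k l * w ^ l) has_sum c k w) UNIV" for k
        by (rule norm_summable_imp_has_sum[OF sm[OF d(1) w] d(2)[OF w]])
      from has_sum_cmult_right[OF this, of "z ^ k" for k]
      show "((\<lambda>l. d (fst (k, l)) (snd (k, l)) * mono2 (k, l) p) has_sum z ^ k * c k w) UNIV" for k
        by (simp add: mono2_def p mult_ac)
      have "((\<lambda>k. c k w * z ^ k) has_sum f (z, w)) UNIV"
        using slice[OF w] by (intro norm_summable_imp_has_sum sm z) (use z in auto)
      then show "((\<lambda>k. z ^ k * c k w) has_sum f p) UNIV"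
        by (simp add: p mult.commute)
      have "(\<lambda>n. M * (cmod z ^ fst n * cmod w ^ snd n)) summable_on UNIV"
        using has_sum_geometric2[of "cmod z" "cmod w"] z w
        by (intro summable_on_cmult_right) (auto intro: has_sum_imp_summable)
      then show "(\<lambda>n. d (fst n) (snd n) * mono2 n p) summable_on UNIV \<times> UNIV"
        by (intro summable_on_complexI[where g = "\<lambda>n. M * (cmod z ^ fst n * cmod w ^ snd n)"])
          (auto simp: mono2_def p norm_mult norm_power d intro!: mult_right_mono)
    qed
    then show "((\<lambda>n. d (fst n) (snd n) * mono2 n p) has_sum f p) UNIV" by simp
  qed
  then show ?thesis by blast
qed

section \<open>Boundary values and inner functions\<close>

text \<open>\<open>boundary_value\<close> is arbitrary on a null set of exceptional points, so it is
  measurable only because \<open>torus_measure\<close> is a completion.\<close>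

lemma complete_borel_measurable_AE:
  assumes f: "f \<in> borel_measurable \<mu>" and ae: "AE x in \<mu>. f x = g x"
  shows "g \<in> borel_measurable \<mu>"
proof -
  interpret complete_measure \<mu>
    unfolding torus_measure_alt by (rule completion.complete_measure_axioms)
  show ?thesis
  proof (rule measurableI)
    fix A :: "'a set" assume A: "A \<in> sets borel"
    show "g -` A \<inter> space \<mu> \<in> sets \<mu>"
    proof (rule in_sets_AE)
      show "f -` A \<inter> space \<mu> \<in> sets \<mu>"
        by (rule measurable_sets[OF f A])
      show "AE x in \<mu>. (x \<in> f -` A \<inter> space \<mu>) = (x \<in> g -` A \<inter> space \<mu>)"
        using ae by eventually_elim simp
    qed simp
  qed simp
qed

abbreviation has_nontangential_limits :: "(c2 \<Rightarrow> complex) \<Rightarrow> bool" where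
  "has_nontangential_limits f \<equiv> AE x in \<mu>. \<exists>L. nontangential_limit f x L"

text \<open>Radial points satisfy |r x - x| = 1 - r in each coordinate, so they lie in the Stolz
  region of every aperture above 1; the aperture 2 is one choice. Nontangential limits are thereby
  reduced to limits of dilates.\<close>

lemma radial_filterlim:
  assumes "p \<in> torus"
  shows "filterlim (\<lambda>r. r *\<^sub>R p) (at p within stolz 2 p) (at_left 1)"
  unfolding filterlim_at
proof
  have "((\<lambda>r::real. r *\<^sub>R p) \<longlongrightarrow> 1 *\<^sub>R p) (at_left 1)"
    by (intro tendsto_intros)
  then show "((\<lambda>r::real. r *\<^sub>R p) \<longlongrightarrow> p) (at_left 1)" by simp
  obtain x y where p: "p = (x, y)" "cmod x = 1" "cmod y = 1"
    using assms by (auto simp: torus_def)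
  have d: "cmod (r *\<^sub>R x - x) = 1 - r" if "r < 1" "cmod x = 1" for r :: real and x
  proof -
    have "r *\<^sub>R x - x = (r - 1) *\<^sub>R x" by (simp add: algebra_simps)
    then show ?thesis using that by simp
  qed
  show "\<forall>\<^sub>F r in at_left 1. r *\<^sub>R p \<in> stolz 2 p \<and> r *\<^sub>R p \<noteq> p"
    using eventually_at_left_1
  proof eventually_elim
    case (elim r)
    have "r *\<^sub>R x \<noteq> x"
      using d[of r x] elim p by auto
    then show ?case
      using elim p d[of r x] d[of r y] scaleR_torus_bidisc[OF assms, of r]
      by (auto simp: stolz_def)
  qed
qed

lemma nontangential_limit_radial:
  assumes "nontangential_limit f x L" "x \<in> torus"
  shows "((\<lambda>r. dil r f x) \<longlongrightarrow> L) (at_left 1)"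
proof -
  have "(f \<longlongrightarrow> L) (at x within stolz 2 x)"
    using assms by (simp add: nontangential_limit_def)
  then show ?thesis
    unfolding dil_def by (rule filterlim_compose[OF _ radial_filterlim[OF assms(2)]])
qed

lemma boundary_value_eq:
  assumes "nontangential_limit f x L" "x \<in> torus"
  shows "boundary_value f x = L"
  unfolding boundary_value_def
proof (rule the_equality)
  fix L' assume "nontangential_limit f x L'"
  then show "L' = L"
    by (intro tendsto_unique[OF _ nontangential_limit_radial nontangential_limit_radial]) (use assms in auto)
qed fact

lemma boundary_value_radial:
  assumes "has_nontangential_limits f"
  shows "AE x in \<mu>. ((\<lambda>r. dil r f x) \<longlongrightarrow> boundary_value f x) (at_left 1)"
  using assms AE_space[of \<mu>]
  by eventually_elim (auto simp: boundary_value_eq intro: nontangential_limit_radial)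

lemma sequence_at_left_1:
  "\<exists>s :: nat \<Rightarrow> real. (\<forall>n. 0 \<le> s n \<and> s n < 1) \<and> filterlim s (at_left 1) sequentially"
proof -
  define s where "s n = 1 - 1 / real (Suc (Suc n))" for n
  have s: "0 \<le> s n" "s n < 1" for n by (simp_all add: s_def)
  have "(\<lambda>n. 1 - 1 / real (Suc (Suc n))) \<longlonglongrightarrow> 1 - 0"
    using LIMSEQ_Suc[OF LIMSEQ_inverse_real_of_nat]
    by (intro tendsto_diff tendsto_const) (simp add: inverse_eq_divide)
  then have "s \<longlonglongrightarrow> 1" by (simp add: s_def[abs_def])
  then have "filterlim s (at_left 1) sequentially"
    by (simp add: filterlim_at s less_imp_neq[OF s(2)])
  with s show ?thesis by (intro exI[of _ s]) simp
qed

lemma boundary_value_measurable: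
  assumes m: "power_series2 d m" and nt: "has_nontangential_limits m"
  shows "boundary_value m \<in> borel_measurable \<mu>"
proof -
  obtain s where "\<forall>n. 0 \<le> s n \<and> s n < (1 :: real)" and s_lim: "filterlim s (at_left 1) sequentially"
    using sequence_at_left_1 by (elim exE conjE)
  then have s: "0 \<le> s n" "s n < 1" for n by simp_all
  have [measurable]: "dil (s n) m \<in> borel_measurable \<mu>" for n
    by (rule dil_measurable[OF m s])
  show ?thesis
  proof (rule complete_borel_measurable_AE)
    show "(\<lambda>x. lim (\<lambda>n. dil (s n) m x)) \<in> borel_measurable \<mu>"
      by (rule borel_measurable_lim_metric) measurable
    show "AE x in \<mu>. lim (\<lambda>n. dil (s n) m x) = boundary_value m x"
      using boundary_value_radial[OF nt]
      by eventually_elim (rule limI, rule filterlim_compose[OF _ s_lim])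
  qed
qed

lemma boundary_value_bounded:
  assumes bound: "\<And>z. z \<in> bidisc \<Longrightarrow> cmod (m z) \<le> C"
    and nt: "has_nontangential_limits m"
  shows "AE x in \<mu>. cmod (boundary_value m x) \<le> C"
  using boundary_value_radial[OF nt] AE_space[of \<mu>]
proof eventually_elim
  case (elim x)
  show ?case
  proof (rule tendsto_upperbound[OF tendsto_norm[OF elim(1)]])
    show "\<forall>\<^sub>F r in at_left 1. cmod (dil r m x) \<le> C"
      using eventually_at_left_1
      by eventually_elim (use elim in \<open>auto simp: dil_def intro!: bound scaleR_torus_bidisc\<close>)
  qed simp
qed

text \<open>This identifies the adjoint of multiplication by m on \<open>H2\<close> with
  multiplication by the conjugate boundary values in \<open>L2\<close>, which is how the second
  summand of \<open>U1\<close> is defined.\<close>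

lemma H2_inner_multiplier:
  assumes m: "power_series2 d m" and bound: "\<And>z. z \<in> bidisc \<Longrightarrow> cmod (m z) \<le> C"
    and nt: "has_nontangential_limits m"
    and f: "f \<in> H2" and g: "g \<in> H2"
  shows "H2_inner f (\<lambda>z. m z * g z) =
    (\<integral>x. cnj (boundary_value m x) * (H2_boundary f x * cnj (H2_boundary g x)) \<partial>\<mu>)"
proof (rule tendsto_unique[OF _ dil_inner_tendsto])
  have "((\<lambda>r. \<integral>x. cnj (dil r m x) * (dil r f x * cnj (dil r g x)) \<partial>\<mu>) \<longlongrightarrow>
    (\<integral>x. cnj (boundary_value m x) * (H2_boundary f x * cnj (H2_boundary g x)) \<partial>\<mu>)) (at_left 1)"
  proof (rule dil_weighted_tendsto[OF f g, where C = C])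
    show "(\<lambda>x. cnj (dil r m x)) \<in> borel_measurable \<mu>" if "0 < r" "r < 1" for r
      by (rule measurable_compose[OF dil_measurable[OF m] cnj_measurable]) (use that in auto)
    show "cmod (cnj (dil r m x)) \<le> C" if "0 < r" "r < 1" "x \<in> torus" for r x
      using that by (auto simp: dil_def intro!: bound scaleR_torus_bidisc)
    show "(\<lambda>x. cnj (boundary_value m x)) \<in> borel_measurable \<mu>"
      by (rule measurable_compose[OF boundary_value_measurable[OF m nt] cnj_measurable])
    show "AE x in \<mu>. ((\<lambda>r. cnj (dil r m x)) \<longlongrightarrow> cnj (boundary_value m x)) (at_left 1)"
      using boundary_value_radial[OF nt] by eventually_elim (rule tendsto_cnj)
  qed
  then show "((\<lambda>r. L2_inner \<mu> (dil r f) (dil r (\<lambda>z. m z * g z))) \<longlongrightarrow>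
    (\<integral>x. cnj (boundary_value m x) * (H2_boundary f x * cnj (H2_boundary g x)) \<partial>\<mu>)) (at_left 1)"
    by (simp add: L2_inner_def dil_def mult_ac)
  show "(\<lambda>z. m z * g z) \<in> H2" by (rule bounded_multiplier[OF m bound g])
qed (simp_all add: f)

lemma inner_function_bound:
  assumes "inner_function \<phi>"
  obtains C where "\<And>z. z \<in> bidisc \<Longrightarrow> cmod (\<phi> z) \<le> C"
  using assms unfolding inner_function_def bounded_iff by (meson imageI)

lemma inner_function_sep_holo: "inner_function \<phi> \<Longrightarrow> sep_holo \<phi>"
  by (simp add: inner_function_def holomorphic2_imp_sep_holo)

lemma inner_function_power_series:
  assumes "inner_function \<phi>"
  obtains d where "power_series2 d \<phi>"
proof -
  obtain C where "\<And>z. z \<in> bidisc \<Longrightarrow> cmod (\<phi> z) \<le> C"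
    using assms by (rule inner_function_bound) (rule that)
  from sep_holo_power_series[OF inner_function_sep_holo[OF assms] this] that show thesis by blast
qed

lemma inner_function_H2:
  assumes "inner_function \<phi>" "f \<in> H2"
  shows "(\<lambda>z. \<phi> z * f z) \<in> H2"
proof -
  obtain C where C: "\<And>z. z \<in> bidisc \<Longrightarrow> cmod (\<phi> z) \<le> C"
    using assms(1) by (rule inner_function_bound) (rule that)
  obtain d where d: "power_series2 d \<phi>"
    using assms(1) by (rule inner_function_power_series) (rule that)
  show ?thesis by (rule bounded_multiplier(1)[OF d C assms(2)])
qed

text \<open>The weight is the squared modulus of the dilates of \<phi>, which is bounded and tends
  to 1 almost everywhere on the torus.\<close>

lemma inner_function_isometry:
  assumes \<phi>: "inner_function \<phi>" and f: "f \<in> H2" and g: "g \<in> H2"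
  shows "H2_inner (\<lambda>z. \<phi> z * f z) (\<lambda>z. \<phi> z * g z) = H2_inner f g"
proof (rule tendsto_unique[OF _ dil_inner_tendsto])
  obtain C where C: "\<And>z. z \<in> bidisc \<Longrightarrow> cmod (\<phi> z) \<le> C"
    using \<phi> by (rule inner_function_bound) (rule that)
  obtain d where d: "power_series2 d \<phi>"
    using \<phi> by (rule inner_function_power_series) (rule that)
  have "((\<lambda>r. \<integral>x. (dil r \<phi> x * cnj (dil r \<phi> x)) * (dil r f x * cnj (dil r g x)) \<partial>\<mu>) \<longlongrightarrow>
    (\<integral>x. 1 * (H2_boundary f x * cnj (H2_boundary g x)) \<partial>\<mu>)) (at_left 1)"
  proof (rule dil_weighted_tendsto[OF f g, where C = "C * C"])
    show "(\<lambda>x. dil r \<phi> x * cnj (dil r \<phi> x)) \<in> borel_measurable \<mu>" if "0 < r" "r < 1" for r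
      by (intro borel_measurable_times measurable_compose[OF dil_measurable[OF d] cnj_measurable]
          dil_measurable[OF d]) (use that in auto)
    show "cmod (dil r \<phi> x * cnj (dil r \<phi> x)) \<le> C * C" if "0 < r" "r < 1" "x \<in> torus" for r x
    proof -
      have le: "cmod (dil r \<phi> x) \<le> C"
        using that by (auto simp: dil_def intro!: C scaleR_torus_bidisc)
      then show ?thesis
        using order_trans[OF norm_ge_zero le] by (simp add: norm_mult mult_mono)
    qed
    have "AE x in \<mu>. \<exists>L. nontangential_limit \<phi> x L \<and> cmod L = 1"
      using \<phi> by (simp add: inner_function_def)
    then show "AE x in \<mu>. ((\<lambda>r. dil r \<phi> x * cnj (dil r \<phi> x)) \<longlongrightarrow> 1) (at_left 1)"
      using AE_space[of \<mu>]
    proof eventually_elim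
      case (elim x)
      then obtain L where L: "nontangential_limit \<phi> x L" "cmod L = 1" by blast
      have "((\<lambda>r. dil r \<phi> x * cnj (dil r \<phi> x)) \<longlongrightarrow> L * cnj L) (at_left 1)"
        using elim by (intro tendsto_mult tendsto_cnj nontangential_limit_radial[OF L(1)]) auto
      moreover have "L * cnj L = 1"
        using L(2) by (simp add: complex_norm_square[symmetric])
      ultimately show ?case by simp
    qed
  qed simp
  then show "((\<lambda>r. L2_inner \<mu> (dil r (\<lambda>z. \<phi> z * f z)) (dil r (\<lambda>z. \<phi> z * g z))) \<longlongrightarrow> H2_inner f g) (at_left 1)"
    unfolding L2_inner_boundary[OF f g, symmetric] by (simp add: L2_inner_def dil_def mult_ac)
qed (use inner_function_H2[OF \<phi>] f g in auto)

text \<open>Multiplication by z1 thus falls under the results on inner functions: it maps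
  \<open>H2\<close> into itself and is isometric.\<close>

lemma inner_function_fst: "inner_function fst"
proof -
  have "holomorphic2 fst"
    unfolding holomorphic2_def
    by (intro ballI exI[of _ 1] exI[of _ 0]) (auto intro!: derivative_eq_intros)
  moreover have "bounded (fst ` bidisc)"
    unfolding bounded_iff by (intro exI[of _ 1]) (auto simp: bidisc_def)
  moreover have "\<exists>L. nontangential_limit fst x L \<and> cmod L = 1" if "x \<in> torus" for x
    by (rule exI[of _ "fst x"])
      (use that in \<open>auto simp: nontangential_limit_def torus_def intro!: tendsto_eq_intros\<close>)
  ultimately show ?thesis
    unfolding inner_function_def by (intro conjI AE_I2) simp_all
qed

section \<open>Model spaces and their reproducing kernels\<close>

lemma model_space_H2: "f \<in> model_space \<phi> \<Longrightarrow> f \<in> H2"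
  by (simp add: model_space_def)

lemma model_space_orthogonal: "f \<in> model_space \<phi> \<Longrightarrow> h \<in> H2 \<Longrightarrow> H2_inner f (\<lambda>z. \<phi> z * h z) = 0"
  by (simp add: model_space_def)

lemma model_space_add:
  assumes "inner_function \<phi>" "f \<in> model_space \<phi>" "g \<in> model_space \<phi>"
  shows "(\<lambda>z. f z + g z) \<in> model_space \<phi>"
  using assms by (auto simp: model_space_def H2_add H2_inner_add_left inner_function_H2)

lemma model_space_cmult:
  assumes "inner_function \<phi>" "f \<in> model_space \<phi>"
  shows "(\<lambda>z. c * f z) \<in> model_space \<phi>"
  using assms by (auto simp: model_space_def H2_cmult H2_inner_cmult_left inner_function_H2)

lemma model_space_diff:
  assumes "inner_function \<phi>" "f \<in> model_space \<phi>" "g \<in> model_space \<phi>"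
  shows "(\<lambda>z. f z - g z) \<in> model_space \<phi>"
  using model_space_add[OF assms(1,2) model_space_cmult[OF assms(1,3), of "-1"]] by simp

lemma model_kernel_eq:
  "model_kernel \<phi> w = (\<lambda>z. szego w z - cnj (\<phi> w) * (\<phi> z * szego w z))"
  by (auto simp: model_kernel_def szego_def szego_kernel_def diff_divide_distrib)

lemma model_kernel_H2:
  assumes "inner_function \<phi>" "w \<in> bidisc"
  shows "model_kernel \<phi> w \<in> H2"
  unfolding model_kernel_eq
  by (intro H2_diff H2_cmult inner_function_H2 szego_H2 assms)

lemma model_kernel_in_model_space:
  assumes \<phi>: "inner_function \<phi>" and w: "w \<in> bidisc"
  shows "model_kernel \<phi> w \<in> model_space \<phi>"
proof -
  have "H2_inner (model_kernel \<phi> w) (\<lambda>z. \<phi> z * h z) = 0" if h: "h \<in> H2" for h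
  proof -
    note H2s = szego_H2[OF w] inner_function_H2[OF \<phi> szego_H2[OF w]] inner_function_H2[OF \<phi> h]
    have "H2_inner (model_kernel \<phi> w) (\<lambda>z. \<phi> z * h z) =
        H2_inner (szego w) (\<lambda>z. \<phi> z * h z) - cnj (\<phi> w) * H2_inner (\<lambda>z. \<phi> z * szego w z) (\<lambda>z. \<phi> z * h z)"
      unfolding model_kernel_eq
      by (simp add: H2_inner_diff_left H2_inner_cmult_left H2_cmult H2s)
    \<comment> \<open>The first term is the reproducing property for \<phi> h; in the second the
      isometry removes \<phi> before the reproducing property for h is used.\<close>
    also have "\<dots> = cnj (\<phi> w * h w) - cnj (\<phi> w) * cnj (h w)"
      using H2_reproducing[OF H2s(3) w] H2_reproducing[OF h w]
      by (simp add: inner_function_isometry[OF \<phi> szego_H2[OF w] h] H2_inner_commute[of "szego w"])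
    finally show ?thesis by simp
  qed
  then show ?thesis
    using model_kernel_H2[OF assms] by (simp add: model_space_def)
qed

lemma model_kernel_reproducing:
  assumes \<phi>: "inner_function \<phi>" and w: "w \<in> bidisc" and f: "f \<in> model_space \<phi>"
  shows "H2_inner f (model_kernel \<phi> w) = f w"
proof -
  note H2s = szego_H2[OF w] inner_function_H2[OF \<phi> szego_H2[OF w]] model_space_H2[OF f]
  have "H2_inner f (model_kernel \<phi> w) =
      H2_inner f (szego w) - \<phi> w * H2_inner f (\<lambda>z. \<phi> z * szego w z)"
    unfolding model_kernel_eq
    by (simp add: H2_inner_diff_right H2_inner_cmult_right H2_cmult H2s)
  then show ?thesis
    by (simp add: H2_reproducing[OF H2s(3) w] model_space_orthogonal[OF f H2s(1)])
qed

text \<open>The squared norm of the kernel at \<open>w\<close> is its value on the diagonal, so \<open>\<bar>\<phi> w\<bar> \<le> 1\<close>;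
  equality would make the kernel vanish identically and hence \<open>\<phi>\<close> constant.\<close>

lemma inner_function_less_1:
  assumes \<phi>: "inner_function \<phi>" and nc: "\<not> \<phi> constant_on bidisc" and w: "w \<in> bidisc"
  shows "cmod (\<phi> w) < 1"
proof -
  let ?k = "model_kernel \<phi> w"
  let ?D = "(1 - (cmod (fst w))\<^sup>2) * (1 - (cmod (snd w))\<^sup>2)"
  have D: "?D > 0"
    using w by (intro mult_pos_pos) (auto simp: bidisc_def abs_square_less_1 power_less_one_iff)
  have "of_real ((H2_norm ?k)\<^sup>2) = ?k w"
    unfolding H2_inner_self[OF model_kernel_H2[OF \<phi> w], symmetric]
    by (rule model_kernel_reproducing[OF \<phi> w model_kernel_in_model_space[OF \<phi> w]])
  also have "?k w = of_real ((1 - (cmod (\<phi> w))\<^sup>2) / ?D)"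
    using w by (simp only: model_kernel_def if_True complex_norm_square of_real_divide of_real_mult of_real_diff of_real_1)
  finally have k: "(H2_norm ?k)\<^sup>2 = (1 - (cmod (\<phi> w))\<^sup>2) / ?D"
    by (simp only: of_real_eq_iff)
  then have "0 \<le> (1 - (cmod (\<phi> w))\<^sup>2) / ?D"
    by (metis zero_le_power2)
  then have "(cmod (\<phi> w))\<^sup>2 \<le> 1"
    using D by (simp add: zero_le_divide_iff)
  then have le: "cmod (\<phi> w) \<le> 1"
    by (simp add: abs_square_le_1)
  moreover have "cmod (\<phi> w) \<noteq> 1"
  proof
    assume 1: "cmod (\<phi> w) = 1"
    then have "H2_inner ?k ?k = 0"
      using k by (simp add: H2_inner_self[OF model_kernel_H2[OF \<phi> w]])
    then have k0: "?k z = 0" for z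
      by (rule H2_eq_zero[OF model_kernel_H2[OF \<phi> w]])
    have "\<phi> z = \<phi> w" if z: "z \<in> bidisc" for z
    proof -
      have "1 - fst z * cnj (fst w) \<noteq> 0" "1 - snd z * cnj (snd w) \<noteq> 0"
        using bidisc_mult_cnj_less_1[OF z w] by auto
      then have "1 - \<phi> z * cnj (\<phi> w) = 0"
        using k0[of z] z by (simp add: model_kernel_def)
      moreover have "\<phi> w * cnj (\<phi> w) = 1"
        using 1 by (simp add: complex_norm_square[symmetric])
      moreover have "cnj (\<phi> w) \<noteq> 0" using 1 by auto
      ultimately show ?thesis
        using mult_right_cancel[of "cnj (\<phi> w)" "\<phi> z" "\<phi> w"] by simp
    qed
    then have "\<phi> constant_on bidisc"
      unfolding constant_on_def by blast
    with nc show False by simp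
  qed
  ultimately show ?thesis by simp
qed

section \<open>Bounded functionals and projections\<close>

lemma H2_of_coeff:
  assumes "square_summable a"
  obtains f where "f \<in> H2" "H2_coeff f = a"
proof
  let ?f = "\<lambda>z. if z \<in> bidisc then \<Sum>\<^sub>\<infinity>n. a n * mono2 n z else 0"
  have ps: "power_series2 a ?f"
    unfolding power_series2_iff
  proof
    fix z assume z: "z \<in> bidisc"
    have "(\<lambda>n. a n * mono2 n z) summable_on UNIV"
      using square_summable_inner[OF assms szego_square_summable[OF z]] by simp
    then show "((\<lambda>n. a n * mono2 n z) has_sum ?f z) UNIV"
      using z by simp
  qed
  show "?f \<in> H2" by (rule H2I[OF _ assms ps]) simp
  show "H2_coeff ?f = a" by (rule H2_coeff_eq[OF assms ps])
qed

definition mono_H2 :: "nat \<times> nat \<Rightarrow> c2 \<Rightarrow> complex" where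
  "mono_H2 n z = (if z \<in> bidisc then mono2 n z else 0)"

lemma mono_H2: "mono_H2 n \<in> H2" "H2_coeff (mono_H2 n) = (\<lambda>k. of_bool (k = n))"
proof -
  have ps: "power_series2 (\<lambda>k. of_bool (k = n)) (mono_H2 n)"
    unfolding power_series2_iff by (auto simp: mono_H2_def intro!: has_sum_single[of n])
  have sq: "square_summable (\<lambda>k. of_bool (k = n))"
    by (rule has_sum_imp_summable, rule has_sum_single[OF _ refl, of n]) simp
  show "mono_H2 n \<in> H2" by (rule H2I[OF _ sq ps]) (simp add: mono_H2_def)
  show "H2_coeff (mono_H2 n) = (\<lambda>k. of_bool (k = n))" by (rule H2_coeff_eq[OF sq ps])
qed

lemma mono_H2_sum:
  assumes "finite A"
  shows "(\<lambda>z. \<Sum>n\<in>A. b n * mono_H2 n z) \<in> H2 \<and>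
    H2_coeff (\<lambda>z. \<Sum>n\<in>A. b n * mono_H2 n z) = (\<lambda>k. if k \<in> A then b k else 0)"
  using assms
proof induction
  case empty
  have "H2_coeff (\<lambda>z. 0) = (\<lambda>k. 0)"
    using H2_coeff_cmult[OF H2_zero, of 0] by simp
  then show ?case by (simp add: H2_zero)
next
  case (insert n A)
  then show ?case
    by (auto simp: H2_add H2_cmult mono_H2 H2_coeff_add H2_coeff_cmult)
qed

lemma conj_linear_sum:
  fixes T :: "(c2 \<Rightarrow> complex) \<Rightarrow> complex"
  assumes add: "\<And>f g. f \<in> H2 \<Longrightarrow> g \<in> H2 \<Longrightarrow> T (\<lambda>z. f z + g z) = T f + T g"
    and cmult: "\<And>f c. f \<in> H2 \<Longrightarrow> T (\<lambda>z. c * f z) = cnj c * T f"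
    and "finite A"
  shows "T (\<lambda>z. \<Sum>n\<in>A. b n * mono_H2 n z) = (\<Sum>n\<in>A. cnj (b n) * T (mono_H2 n))"
  using assms(3)
proof induction
  case empty
  show ?case using cmult[OF H2_zero, of 0] by simp
next
  case (insert n A)
  then show ?case
    using mono_H2_sum[OF insert(1), of b] by (simp add: add cmult H2_cmult mono_H2)
qed

lemma H2_inner_mono: "f \<in> H2 \<Longrightarrow> H2_inner f (mono_H2 n) = H2_coeff f n"
  unfolding H2_inner_def mono_H2(2) by (rule infsumI) (auto intro!: has_sum_single[of n])

lemma H2_approx:
  assumes g: "g \<in> H2" and e: "e > 0"
  obtains A where "finite A" "(H2_norm (\<lambda>z. g z - (\<Sum>n\<in>A. H2_coeff g n * mono_H2 n z)))\<^sup>2 \<le> e"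
proof -
  let ?s = "\<lambda>n. (cmod (H2_coeff g n))\<^sup>2"
  obtain A where A: "finite A" "dist (sum ?s A) (infsum ?s UNIV) \<le> e"
    using infsum_finite_approximation[OF H2_square_summable[OF g] e] by auto
  let ?p = "\<lambda>z. \<Sum>n\<in>A. H2_coeff g n * mono_H2 n z"
  have p: "?p \<in> H2" and p_coeff: "H2_coeff ?p = (\<lambda>k. if k \<in> A then H2_coeff g k else 0)"
    using mono_H2_sum[OF A(1), of "H2_coeff g"] by auto
  have "H2_coeff (\<lambda>z. g z + (-1) * ?p z) = (\<lambda>k. if k \<in> A then 0 else H2_coeff g k)"
    unfolding H2_coeff_add[OF g H2_cmult[OF p]] H2_coeff_cmult[OF p] p_coeff by auto
  then have "(H2_norm (\<lambda>z. g z - ?p z))\<^sup>2 = (\<Sum>\<^sub>\<infinity>n. ?s n - (if n \<in> A then ?s n else 0))"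
    unfolding H2_norm_square by (auto intro!: infsum_cong)
  also have "\<dots> = infsum ?s UNIV - sum ?s A"
  proof (rule infsumI, rule has_sum_diff)
    show "(?s has_sum infsum ?s UNIV) UNIV"
      by (rule has_sum_infsum[OF H2_square_summable[OF g]])
    show "((\<lambda>n. if n \<in> A then ?s n else 0) has_sum sum ?s A) UNIV"
      by (rule has_sum_finite_neutralI[OF A(1)]) auto
  qed
  also have "\<dots> \<le> e" using A(2) by (simp add: dist_real_def)
  finally show thesis using A(1) that by blast
qed

text \<open>T is conjugate linear, so the representing vector stands in the first argument. Its
  coefficients are the values of T on monomials; once they are square summable, p and T agree on
  polynomials, and by boundedness and density everywhere.\<close>

lemma H2_Riesz:
  fixes T :: "(c2 \<Rightarrow> complex) \<Rightarrow> complex"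
  assumes add: "\<And>f g. f \<in> H2 \<Longrightarrow> g \<in> H2 \<Longrightarrow> T (\<lambda>z. f z + g z) = T f + T g"
    and cmult: "\<And>f c. f \<in> H2 \<Longrightarrow> T (\<lambda>z. c * f z) = cnj c * T f"
    and bound: "\<And>f. f \<in> H2 \<Longrightarrow> cmod (T f) \<le> K * H2_norm f"
  obtains p where "p \<in> H2" "\<And>g. g \<in> H2 \<Longrightarrow> H2_inner p g = T g"
proof -
  define t where "t n = T (mono_H2 n)" for n
  let ?P = "\<lambda>A b z. \<Sum>n\<in>A. b n * mono_H2 n z"
  have fin: "(\<Sum>n\<in>A. (cmod (t n))\<^sup>2) \<le> K\<^sup>2" if A: "finite A" for A
  proof -
    define s where "s = (\<Sum>n\<in>A. (cmod (t n))\<^sup>2)"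
    have s0: "0 \<le> s" by (simp add: s_def sum_nonneg)
    \<comment> \<open>T is tested on the polynomial with coefficients t n: its value is s while the
      norm of the polynomial is the root of s, so the bound on T becomes a bound on s.\<close>
    have "T (?P A t) = (\<Sum>n\<in>A. cnj (t n) * T (mono_H2 n))"
      by (rule conj_linear_sum) (simp_all only: add cmult A)
    also have "\<dots> = (\<Sum>n\<in>A. of_real ((cmod (t n))\<^sup>2))"
      by (intro sum.cong refl) (simp only: complex_norm_square mult.commute t_def)
    finally have T_eq: "T (?P A t) = of_real s" by (simp add: s_def)
    have "(H2_norm (?P A t))\<^sup>2 = (\<Sum>\<^sub>\<infinity>n. if n \<in> A then (cmod (t n))\<^sup>2 else 0)"
      unfolding H2_norm_square mono_H2_sum[OF A, THEN conjunct2] by (intro infsum_cong) auto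
    also have "\<dots> = s"
      unfolding s_def by (intro infsumI has_sum_finite_neutralI[OF A]) auto
    finally have "H2_norm (?P A t) = sqrt s"
      using H2_norm_nonneg by (metis real_sqrt_unique)
    then have "s \<le> K * sqrt s"
      using bound[of "?P A t"] mono_H2_sum[OF A, of t] T_eq s0 by simp
    then have "sqrt s * sqrt s \<le> K * sqrt s"
      using s0 by simp
    then have "sqrt s \<le> K \<or> sqrt s = 0"
      using s0 by (metis mult_le_cancel_right not_le real_sqrt_ge_0_iff order_antisym)
    then show ?thesis
      using s0 real_sqrt_le_iff[of s "K\<^sup>2"] by (auto simp: s_def[symmetric] intro: sqrt_le_D)
  qed
  have sq: "square_summable t"
    by (rule nonneg_bdd_above_summable_on) (auto intro!: bdd_aboveI2 fin)
  obtain p where p: "p \<in> H2" "H2_coeff p = t"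
    using sq by (rule H2_of_coeff)
  have "H2_inner p g = T g" if g: "g \<in> H2" for g
  proof (rule ccontr)
    assume ne: "H2_inner p g \<noteq> T g"
    define D where "D f = H2_inner p f - T f" for f
    have D_add: "D (\<lambda>z. f z + h z) = D f + D h" if "f \<in> H2" "h \<in> H2" for f h
      using that p by (simp add: D_def add H2_inner_add_right)
    have D_cmult: "D (\<lambda>z. c * f z) = cnj c * D f" if "f \<in> H2" for f c
      using that p by (simp add: D_def cmult H2_inner_cmult_right right_diff_distrib)
    let ?M = "H2_norm p + K"
    have D_bound: "cmod (D f) \<le> ?M * H2_norm f" if "f \<in> H2" for f
    proof -
      have "cmod (D f) \<le> cmod (H2_inner p f) + cmod (T f)"
        unfolding D_def by (rule norm_triangle_ineq4)
      also have "\<dots> \<le> H2_norm p * H2_norm f + K * H2_norm f"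
        by (intro add_mono H2_Cauchy_Schwarz bound that p)
      finally show ?thesis by (simp add: distrib_right)
    qed
    have D_mono: "D (mono_H2 n) = 0" for n
      using p by (simp add: D_def H2_inner_mono t_def)
    \<comment> \<open>Chosen so that \<open>?M\<^sup>2 * e\<close> stays strictly below the squared
      modulus of D g; the summand 1 keeps the denominator positive when \<open>?M\<close>
      vanishes.\<close>
    define e where "e = (cmod (D g))\<^sup>2 / (2 * (?M\<^sup>2 + 1))"
    have den: "0 < 2 * (?M\<^sup>2 + 1)" by (simp add: add_nonneg_pos)
    have Dg: "0 < (cmod (D g))\<^sup>2"
      using ne by (simp add: D_def)
    have e: "e > 0"
      unfolding e_def by (intro divide_pos_pos Dg den)
    obtain A where A: "finite A" "(H2_norm (\<lambda>z. g z - ?P A (H2_coeff g) z))\<^sup>2 \<le> e"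
      using g e by (rule H2_approx)
    let ?p = "?P A (H2_coeff g)" and ?r = "\<lambda>z. g z - ?P A (H2_coeff g) z"
    have P: "?p \<in> H2" using mono_H2_sum[OF A(1), of "H2_coeff g"] by simp
    have r: "?r \<in> H2" by (rule H2_diff[OF g P])
    have "D ?p = 0"
      by (subst conj_linear_sum[of D]) (simp_all only: D_add D_cmult A(1) D_mono mult_zero_right sum.neutral_const)
    then have "D g = D ?r"
      using D_add[OF r P] by simp
    then have "(cmod (D g))\<^sup>2 \<le> (?M * H2_norm ?r)\<^sup>2"
      using D_bound[OF r] by (simp add: power_mono)
    also have "\<dots> \<le> ?M\<^sup>2 * e"
      using A(2) by (simp add: power_mult_distrib mult_left_mono)
    also have "\<dots> < (cmod (D g))\<^sup>2"
    proof -
      have "?M\<^sup>2 * (cmod (D g))\<^sup>2 < (2 * (?M\<^sup>2 + 1)) * (cmod (D g))\<^sup>2"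
      proof (rule mult_strict_right_mono[OF _ Dg])
        have "x < 2 * (x + 1)" if "0 \<le> x" for x :: real
          using that by simp
        from this[OF zero_le_power2[of ?M]] show "?M\<^sup>2 < 2 * (?M\<^sup>2 + 1)" .
      qed
      then show ?thesis
        unfolding e_def using den by (simp only: times_divide_eq_right pos_divide_less_eq mult.commute)
    qed
    finally show False by simp
  qed
  with p(1) show thesis by (rule that)
qed

text \<open>p is the image of h under the Toeplitz operator with symbol cnj m. With m = \<phi> it
  produces the projection onto the model space, with m = \<open>vartheta1\<close> the second summand
  of \<open>U1\<close>.\<close>

lemma multiplier_adjoint:
  assumes m: "power_series2 d m" and bound: "\<And>z. z \<in> bidisc \<Longrightarrow> cmod (m z) \<le> C"
    and h: "h \<in> H2"
  obtains p where "p \<in> H2" "\<And>g. g \<in> H2 \<Longrightarrow> H2_inner p g = H2_inner h (\<lambda>z. m z * g z)"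
proof (rule H2_Riesz[where T = "\<lambda>g. H2_inner h (\<lambda>z. m z * g z)" and K = "H2_norm h * C"])
  have mult: "(\<lambda>z. m z * f z) \<in> H2" if "f \<in> H2" for f
    by (rule bounded_multiplier(1)[OF m bound that])
  fix f assume f: "f \<in> H2"
  show "H2_inner h (\<lambda>z. m z * (f z + g z)) = H2_inner h (\<lambda>z. m z * f z) + H2_inner h (\<lambda>z. m z * g z)"
    if "g \<in> H2" for g
    using H2_inner_add_right[OF mult[OF f] mult[OF that] h] by (simp add: distrib_left)
  show "H2_inner h (\<lambda>z. m z * (c * f z)) = cnj c * H2_inner h (\<lambda>z. m z * f z)" for c
    using H2_inner_cmult_right[OF mult[OF f] h, of c] by (simp add: mult.left_commute)
  have "cmod (H2_inner h (\<lambda>z. m z * f z)) \<le> H2_norm h * H2_norm (\<lambda>z. m z * f z)"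
    by (rule H2_Cauchy_Schwarz[OF h mult[OF f]])
  also have "\<dots> \<le> H2_norm h * (C * H2_norm f)"
    by (intro mult_left_mono bounded_multiplier(2)[OF m bound f] H2_norm_nonneg)
  finally show "cmod (H2_inner h (\<lambda>z. m z * f z)) \<le> H2_norm h * C * H2_norm f"
    by (simp add: mult.assoc)
qed (use that in blast)

section \<open>The subspace of functions of the second variable\<close>

definition restrict0 :: "(c2 \<Rightarrow> complex) \<Rightarrow> c2 \<Rightarrow> complex" where
  "restrict0 g z = (if z \<in> bidisc then g (0, snd z) else 0)"

lemma has_sum_second_index:
  fixes a :: "nat \<Rightarrow> 'a :: real_normed_vector"
  shows "((\<lambda>n. if fst n = 0 then a (snd n) else 0) has_sum s) (UNIV :: (nat \<times> nat) set) \<longleftrightarrow>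
    (a has_sum s) UNIV"
proof -
  have "((\<lambda>n. if fst n = 0 then a (snd n) else 0) has_sum s) (UNIV :: (nat \<times> nat) set) \<longleftrightarrow>
      ((\<lambda>n. a (snd n)) has_sum s) ({0 :: nat} \<times> UNIV)"
    by (rule has_sum_cong_neutral) auto
  also have "\<dots> \<longleftrightarrow> (a has_sum s) UNIV"
    by (rule has_sum_reindex_bij_witness[where i = "\<lambda>l. (0, l)" and j = snd]) auto
  finally show ?thesis .
qed

lemma H22_coeffs:
  assumes "f \<in> H22"
  obtains a where "f \<in> H2" "H2_coeff f = (\<lambda>n. if fst n = 0 then a (snd n) else 0)"
proof -
  obtain h a where f: "f = (\<lambda>z. if z \<in> bidisc then h (snd z) else 0)"
    and a: "summable (\<lambda>n. (cmod (a n))\<^sup>2)" "\<And>w. cmod w < 1 \<Longrightarrow> (\<lambda>n. a n * w ^ n) sums h w"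
    using assms by (auto simp: H22_def hardy_disc_def)
  let ?c = "\<lambda>n. if fst n = 0 then a (snd n) else (0 :: complex)"
  have "((\<lambda>n. (cmod (a n))\<^sup>2) has_sum (\<Sum>n. (cmod (a n))\<^sup>2)) UNIV"
    by (rule norm_summable_imp_has_sum) (use a(1) in \<open>auto simp: summable_sums\<close>)
  then have "((\<lambda>n. if fst n = 0 then (cmod (a (snd n)))\<^sup>2 else 0) has_sum (\<Sum>n. (cmod (a n))\<^sup>2))
      (UNIV :: (nat \<times> nat) set)"
    by (simp only: has_sum_second_index[of "\<lambda>n. (cmod (a n))\<^sup>2"])
  moreover have "(\<lambda>n. if fst n = 0 then (cmod (a (snd n)))\<^sup>2 else 0) = (\<lambda>n :: nat \<times> nat. (cmod (?c n))\<^sup>2)"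
    by auto
  ultimately have sq: "square_summable ?c"
    by (simp only: has_sum_imp_summable)
  have ps: "power_series2 ?c f"
    unfolding power_series2_iff
  proof
    fix z assume z: "z \<in> bidisc"
    then have w: "cmod (snd z) < 1" by (auto simp: bidisc_def)
    \<comment> \<open>The definition of \<open>hardy_disc\<close> gives only sequential convergence;
      convergence at the larger radius r makes the series absolutely convergent at the given
      point.\<close>
    then obtain r where r: "cmod (snd z) < r" "r < 1" using dense by blast
    then have "0 < r" using norm_ge_zero le_less_trans by blast
    then have "summable (\<lambda>n. a n * complex_of_real r ^ n)"
      using a(2)[of "of_real r"] r by (auto simp: sums_iff)
    then have "summable (\<lambda>n. norm (a n * snd z ^ n))"
      by (rule powser_insidea) (use r \<open>0 < r\<close> in simp)
    then have "((\<lambda>n. a n * snd z ^ n) has_sum h (snd z)) UNIV"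
      by (rule norm_summable_imp_has_sum[OF _ a(2)[OF w]])
    then have "((\<lambda>n. if fst n = 0 then a (snd n) * snd z ^ snd n else 0) has_sum h (snd z)) (UNIV :: (nat \<times> nat) set)"
      by (simp only: has_sum_second_index[of "\<lambda>n. a n * snd z ^ n"])
    moreover have "(\<lambda>n :: nat \<times> nat. if fst n = 0 then a (snd n) * snd z ^ snd n else 0) =
        (\<lambda>n. ?c n * mono2 n z)"
      by (auto simp: mono2_def)
    ultimately show "((\<lambda>n. ?c n * mono2 n z) has_sum f z) UNIV"
      using z by (simp add: f)
  qed
  have "f \<in> H2" by (rule H2I[OF _ sq ps]) (simp add: f)
  then show thesis by (rule that[OF _ H2_coeff_eq[OF sq ps]])
qed

lemma H22_H2: "f \<in> H22 \<Longrightarrow> f \<in> H2"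
  by (erule H22_coeffs)

lemma restrict0_coeff_has_sum:
  assumes "g \<in> H2" "cmod w < 1"
  shows "((\<lambda>l. H2_coeff g (0, l) * w ^ l) has_sum g (0, w)) UNIV"
proof -
  have "((\<lambda>n. H2_coeff g n * mono2 n (0, w)) has_sum g (0, w)) UNIV"
    using H2_power_series[OF assms(1)] assms(2) by (auto simp: power_series2_iff bidisc_def)
  moreover have "(\<lambda>n. H2_coeff g n * mono2 n (0, w)) =
      (\<lambda>n. if fst n = 0 then H2_coeff g (0, snd n) * w ^ snd n else 0)"
    by (auto simp: mono2_def)
  ultimately show ?thesis
    using has_sum_second_index[of "\<lambda>l. H2_coeff g (0, l) * w ^ l"] by simp
qed

lemma restrict0_H22:
  assumes g: "g \<in> H2"
  shows "restrict0 g \<in> H22"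
proof -
  have "(\<lambda>n. (cmod (H2_coeff g n))\<^sup>2) summable_on range (Pair 0)"
    by (rule summable_on_subset_banach[OF H2_square_summable[OF g]]) simp
  then have "(\<lambda>l. (cmod (H2_coeff g (0, l)))\<^sup>2) summable_on UNIV"
    by (subst (asm) summable_on_reindex) (auto simp: inj_on_def o_def)
  then have "summable (\<lambda>l. (cmod (H2_coeff g (0, l)))\<^sup>2)"
    by (rule summable_on_imp_summable)
  then have "(\<lambda>w. g (0, w)) \<in> hardy_disc"
    unfolding hardy_disc_def using restrict0_coeff_has_sum[OF g]
    by (auto intro!: exI[of _ "\<lambda>l. H2_coeff g (0, l)"] has_sum_imp_sums)
  then show ?thesis
    unfolding H22_def restrict0_def[abs_def] by (auto intro!: bexI[of _ "\<lambda>w. g (0, w)"])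
qed

text \<open>Setting z1 = 0 keeps exactly the coefficients with first index 0, so
  \<open>restrict0\<close> is the orthogonal projection of \<open>H2\<close> onto
  \<open>H22\<close>.\<close>

lemma restrict0_coeff:
  assumes g: "g \<in> H2"
  shows "H2_coeff (restrict0 g) = (\<lambda>n. if fst n = 0 then H2_coeff g n else 0)"
proof (rule H2_coeff_eq)
  show "square_summable (\<lambda>n. if fst n = 0 then H2_coeff g n else 0)"
    by (rule summable_on_realI[OF _ H2_square_summable[OF g]]) auto
  show "power_series2 (\<lambda>n. if fst n = 0 then H2_coeff g n else 0) (restrict0 g)"
    unfolding power_series2_iff
  proof
    fix z assume z: "z \<in> bidisc"
    then have "((\<lambda>l. H2_coeff g (0, l) * snd z ^ l) has_sum g (0, snd z)) UNIV"
      by (intro restrict0_coeff_has_sum[OF g]) (auto simp: bidisc_def)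
    then have "((\<lambda>n. if fst n = 0 then H2_coeff g (0, snd n) * snd z ^ snd n else 0) has_sum g (0, snd z))
        (UNIV :: (nat \<times> nat) set)"
      by (simp only: has_sum_second_index[of "\<lambda>l. H2_coeff g (0, l) * snd z ^ l"])
    moreover have "(\<lambda>n. if fst n = 0 then H2_coeff g (0, snd n) * snd z ^ snd n else 0) =
        (\<lambda>n. (if fst n = 0 then H2_coeff g n else 0) * mono2 n z)"
    proof
      fix n :: "nat \<times> nat"
      show "(if fst n = 0 then H2_coeff g (0, snd n) * snd z ^ snd n else 0) =
          (if fst n = 0 then H2_coeff g n else 0) * mono2 n z"
        by (cases n) (simp add: mono2_def)
    qed
    ultimately show "((\<lambda>n. (if fst n = 0 then H2_coeff g n else 0) * mono2 n z) has_sum restrict0 g z) UNIV"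
      using z by (simp add: restrict0_def)
  qed
qed

lemma H2_inner_restrict0:
  assumes "p \<in> H22" "g \<in> H2"
  shows "H2_inner p (restrict0 g) = H2_inner p g"
proof -
  obtain a where "H2_coeff p = (\<lambda>n. if fst n = 0 then a (snd n) else 0)"
    using assms(1) by (rule H22_coeffs)
  then show ?thesis
    unfolding H2_inner_def restrict0_coeff[OF assms(2)] by (intro infsum_cong) simp
qed

lemma H22_diff:
  assumes "f \<in> H22" "g \<in> H22"
  shows "(\<lambda>z. f z - g z) \<in> H22"
proof -
  obtain h k where fg: "f = (\<lambda>z. if z \<in> bidisc then h (snd z) else 0)" "g = (\<lambda>z. if z \<in> bidisc then k (snd z) else 0)"
    using assms by (auto simp: H22_def)
  have "restrict0 (\<lambda>z. f z - g z) = (\<lambda>z. f z - g z)"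
    by (auto simp: restrict0_def fg bidisc_def)
  then show ?thesis
    using restrict0_H22[OF H2_diff[OF assms[THEN H22_H2]]] by simp
qed

text \<open>The projection from \<open>L2\<close> is reduced to one inside \<open>H2\<close>: if q
  represents the functional of G on \<open>H22\<close>, then \<open>restrict0 q\<close> is the
  projection of G. In the application q comes from \<open>multiplier_adjoint\<close>.\<close>

lemma proj_H22:
  assumes G: "G \<in> L2 \<mu>" and q: "q \<in> H2"
    and qG: "\<And>g. g \<in> H22 \<Longrightarrow> H2_inner q g = L2_inner \<mu> G (H2_boundary g)"
  shows "proj_H22 G \<in> H22 \<and> (\<forall>g\<in>H2. H2_inner (proj_H22 G) g = H2_inner q (restrict0 g))"
proof -
  let ?p = "restrict0 q"
  have p: "?p \<in> H22" by (rule restrict0_H22[OF q])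
  have inner: "L2_inner \<mu> (\<lambda>x. G x - H2_boundary p x) (H2_boundary g) =
      H2_inner q g - H2_inner p g" if "p \<in> H22" "g \<in> H22" for p g
    using that by (simp add: L2_inner_diff_left G H2_boundary_L2 H22_H2 L2_inner_boundary qG)
  have pq: "H2_inner ?p g = H2_inner q g" if "g \<in> H22" for g
    using H2_inner_restrict0[OF that q] H2_inner_commute by metis
  have "proj_H22 G = ?p"
    unfolding proj_H22_def
  proof (rule the_equality)
    show "?p \<in> H22 \<and> (\<forall>g\<in>H22. L2_inner \<mu> (\<lambda>x. G x - H2_boundary ?p x) (H2_boundary g) = 0)"
      using p by (simp add: inner pq)
    fix p' assume p': "p' \<in> H22 \<and>
      (\<forall>g\<in>H22. L2_inner \<mu> (\<lambda>x. G x - H2_boundary p' x) (H2_boundary g) = 0)"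
    then have eq: "H2_inner p' g = H2_inner ?p g" if "g \<in> H22" for g
      using p' that inner[of p' g] pq[OF that] by auto
    show "p' = ?p"
      using p p' eq[OF H22_diff[of p' ?p]]
      by (intro H2_eqI) (simp_all add: H22_H2 H2_inner_diff_left H22_diff)
  qed
  moreover have "H2_inner ?p g = H2_inner q (restrict0 g)" if "g \<in> H2" for g
    using H2_inner_restrict0[OF p that] pq[OF restrict0_H22[OF that]] by simp
  ultimately show ?thesis using p by simp
qed

section \<open>Nontangential limits\<close>

definition slice0 :: "(c2 \<Rightarrow> complex) \<Rightarrow> c2 \<Rightarrow> complex" where
  "slice0 f z = f (0, snd z)"

lemma sep_holo_slice0: "sep_holo f \<Longrightarrow> sep_holo (slice0 f)"
  by (auto simp: sep_holo_def slice0_def)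

lemma sep_holo_fix_snd:
  assumes "sep_holo f" "cmod w < 1"
  shows "sep_holo (\<lambda>z. f (fst z, w))"
  using assms by (auto simp: sep_holo_def)

text \<open>By the mean value property \<open>f (0, w)\<close> is the average of \<open>f (\<bar>w\<bar> \<zeta>\<^sub>1, w)\<close> over the circle, and
  \<open>(\<bar>w\<bar> \<zeta>\<^sub>1, w)\<close> approaches \<open>(\<zeta>\<^sub>1, \<eta>\<^sub>2)\<close> nontangentially when \<open>w\<close> approaches \<open>\<eta>\<^sub>2\<close> nontangentially.
  Hence the boundary behaviour of the slice is inherited from that of \<open>f\<close>.\<close>

lemma slice0_nontangential_limit:
  assumes f: "sep_holo f" and bound: "\<And>z. z \<in> bidisc \<Longrightarrow> cmod (f z) \<le> C"
    and nt: "has_nontangential_limits f"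
  shows "has_nontangential_limits (slice0 f)"
  using AE_torus_Fubini[OF nt] AE_space[of \<mu>]
proof eventually_elim
  case (elim \<eta>)
  then have \<eta>: "\<eta> \<in> torus" by simp
  define b where "b x = boundary_value f (fst x, snd \<eta>)" for x :: c2
  have b: "AE x in \<mu>. nontangential_limit f (fst x, snd \<eta>) (b x)"
    using elim(1) AE_space[of \<mu>]
  proof eventually_elim
    case (elim x)
    then have "(fst x, snd \<eta>) \<in> torus"
      using \<eta> by (auto simp: torus_def)
    then show ?case
      using elim(1) unfolding b_def by (auto simp: boundary_value_eq)
  qed
  show ?case
  \<comment> \<open>The candidate does not involve the aperture c, so one value serves for all Stolz
    regions.\<close>
  proof (rule exI[of _ "\<integral>x. b x \<partial>\<mu>"], unfold nontangential_limit_def, intro allI impI)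
    fix c :: real assume c: "c > 1"
    show "(slice0 f \<longlongrightarrow> (\<integral>x. b x \<partial>\<mu>)) (at \<eta> within stolz c \<eta>)"
      unfolding tendsto_at_iff_sequentially
    proof (intro allI impI)
      fix Z assume Z: "\<forall>i. Z i \<in> stolz c \<eta> - {\<eta>}" and Z_lim: "Z \<longlonglongrightarrow> \<eta>"
      define w where "w i = snd (Z i)" for i
      have w: "cmod (w i) < 1" "cmod (w i - snd \<eta>) < c * (1 - cmod (w i))" for i
        using Z[rule_format, of i] by (auto simp: stolz_def w_def bidisc_def)
      have w_lim: "w \<longlonglongrightarrow> snd \<eta>"
        unfolding w_def[abs_def] by (rule tendsto_snd[OF Z_lim])
      define g where "g i z = f (fst z, w i)" for i and z :: c2
      \<comment> \<open>With the second variable frozen, g i is regarded as a function on the bidisc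
        that ignores its second coordinate. The mean value property on the torus then averages over
        the first circle only.\<close>
      have "\<exists>d. power_series2 d (g i)" for i
      proof (rule sep_holo_power_series)
        show "sep_holo (g i)"
          unfolding g_def[abs_def] by (rule sep_holo_fix_snd[OF f w(1)])
        show "cmod (g i z) \<le> C" if "z \<in> bidisc" for z
          using that w(1)[of i] by (auto simp: g_def bidisc_def intro!: bound)
      qed
      then obtain d where d: "power_series2 (d i) (g i)" for i
        by metis
      define G where "G i = dil (cmod (w i)) (g i)" for i
      have [measurable]: "G i \<in> borel_measurable \<mu>" for i
        unfolding G_def by (rule dil_measurable[OF d]) (simp_all add: w)
      have G_mean: "(\<integral>x. G i x \<partial>\<mu>) = slice0 f (Z i)" for i
        unfolding G_def using mean_value_torus[OF d norm_ge_zero w(1), of i]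
        by (simp add: g_def slice0_def w_def)
      have G_eq: "G i x = f (cmod (w i) *\<^sub>R fst x, w i)" for i x
        by (simp add: G_def dil_def g_def)
      have G_lim: "AE x in \<mu>. (\<lambda>i. G i x) \<longlonglongrightarrow> b x"
        using b AE_space[of \<mu>]
      proof eventually_elim
        case (elim x)
        then have x1: "cmod (fst x) = 1" by (auto simp: torus_def)
        have \<eta>2: "cmod (snd \<eta>) = 1" using \<eta> by (auto simp: torus_def)
        let ?p = "\<lambda>i. (cmod (w i) *\<^sub>R fst x, w i)"
        have p1: "?p i \<in> stolz c (fst x, snd \<eta>) - {(fst x, snd \<eta>)}" for i
        proof -
          have "cmod (w i) *\<^sub>R fst x - fst x = (cmod (w i) - 1) *\<^sub>R fst x"
            by (simp add: algebra_simps)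
          then have "cmod (cmod (w i) *\<^sub>R fst x - fst x) = 1 - cmod (w i)"
            using w(1)[of i] x1 by simp
          also have "\<dots> < c * (1 - cmod (w i))"
            using c w(1)[of i] by simp
          finally show ?thesis
            using w[of i] x1 \<eta>2 by (auto simp: stolz_def bidisc_def)
        qed
        have p2: "?p \<longlonglongrightarrow> (fst x, snd \<eta>)"
        proof (rule tendsto_Pair[OF _ w_lim])
          have "(\<lambda>i. cmod (w i) *\<^sub>R fst x) \<longlonglongrightarrow> cmod (snd \<eta>) *\<^sub>R fst x"
            by (intro tendsto_intros w_lim)
          then show "(\<lambda>i. cmod (w i) *\<^sub>R fst x) \<longlonglongrightarrow> fst x"
            by (simp add: \<eta>2)
        qed
        have "(f \<longlongrightarrow> b x) (at (fst x, snd \<eta>) within stolz c (fst x, snd \<eta>))"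
          using elim(1) c by (simp add: nontangential_limit_def)
        then have "(f \<circ> ?p) \<longlonglongrightarrow> b x"
          unfolding tendsto_at_iff_sequentially using p1 p2 by (elim allE[of _ ?p] impE) auto
        then show ?case by (simp add: G_eq o_def)
      qed
      \<comment> \<open>b is a slice of \<open>boundary_value f\<close>; its measurability is
        obtained from the functions G i, whose limit it is almost everywhere.\<close>
      have b_meas: "b \<in> borel_measurable \<mu>"
      proof (rule complete_borel_measurable_AE)
        show "(\<lambda>x. lim (\<lambda>i. G i x)) \<in> borel_measurable \<mu>"
          by (rule borel_measurable_lim_metric) measurable
        show "AE x in \<mu>. lim (\<lambda>i. G i x) = b x"
          using G_lim by eventually_elim (rule limI)
      qed
      have "(\<lambda>i. \<integral>x. G i x \<partial>\<mu>) \<longlonglongrightarrow> (\<integral>x. b x \<partial>\<mu>)"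
      proof (rule integral_dominated_convergence[where w = "\<lambda>_. C"])
        show "AE x in \<mu>. norm (G i x) \<le> C" for i
        proof (rule AE_I2)
          fix x assume "x \<in> space \<mu>"
          then have "cmod (fst x) = 1" by (auto simp: torus_def)
          then show "norm (G i x) \<le> C"
            unfolding G_eq using w(1)[of i] by (intro bound) (simp add: bidisc_def)
        qed
      qed (simp_all add: b_meas G_lim)
      then show "(slice0 f \<circ> Z) \<longlonglongrightarrow> (\<integral>x. b x \<partial>\<mu>)"
        by (simp add: G_mean o_def)
    qed
  qed
qed

text \<open>Boundary uniqueness: \<open>1 / (1 + \<epsilon> - cnj \<alpha> * m)\<close> has positive real part, whose average over the
  torus stays bounded as \<open>\<epsilon> \<rightarrow> 0\<close>, although the real part equals \<open>1 / \<epsilon>\<close> where the boundary value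
  of \<open>m\<close> is \<open>\<alpha>\<close>.\<close>

lemma boundary_value_neq:
  assumes m: "sep_holo m" and le1: "\<And>z. z \<in> bidisc \<Longrightarrow> cmod (m z) \<le> 1" and m0: "cmod (m 0) < 1"
    and nt: "has_nontangential_limits m" and \<alpha>: "cmod \<alpha> = 1"
  shows "AE x in \<mu>. boundary_value m x \<noteq> \<alpha>"
proof -
  define G where "G = boundary_value m"
  obtain d where d: "power_series2 d m"
    using sep_holo_power_series[OF m le1] by blast
  have G_meas [measurable]: "G \<in> borel_measurable \<mu>"
    unfolding G_def by (rule boundary_value_measurable[OF d nt])
  have G_le: "AE x in \<mu>. cmod (G x) \<le> 1"
    unfolding G_def by (rule boundary_value_bounded[OF le1 nt])
  define E where "E = {x \<in> torus. G x = \<alpha>}"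
  have E: "E \<in> sets \<mu>"
    using measurable_sets[OF G_meas, of "{\<alpha>}"] by (simp add: E_def vimage_def Int_def conj_commute)
  define u where "u e w = 1 / (1 + complex_of_real e - cnj \<alpha> * w)" for e w
  have den: "e \<le> Re (1 + complex_of_real e - cnj \<alpha> * w)" "1 + e - cmod w \<le> cmod (1 + complex_of_real e - cnj \<alpha> * w)"
    if "cmod w \<le> 1" for e w
  proof -
    have "cmod (cnj \<alpha> * w) = cmod w" using \<alpha> by (simp add: norm_mult)
    then show "e \<le> Re (1 + complex_of_real e - cnj \<alpha> * w)"
      using complex_Re_le_cmod[of "cnj \<alpha> * w"] that by simp
    have "1 + e - cmod w \<le> Re (1 + complex_of_real e - cnj \<alpha> * w)"
      using complex_Re_le_cmod[of "cnj \<alpha> * w"] \<open>cmod (cnj \<alpha> * w) = cmod w\<close> by simp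
    also have "\<dots> \<le> cmod (1 + complex_of_real e - cnj \<alpha> * w)" by (rule complex_Re_le_cmod)
    finally show "1 + e - cmod w \<le> cmod (1 + complex_of_real e - cnj \<alpha> * w)" .
  qed
  have den_nz: "1 + complex_of_real e - cnj \<alpha> * w \<noteq> 0" if "0 < e" "cmod w \<le> 1" for e w
  proof
    assume "1 + complex_of_real e - cnj \<alpha> * w = 0"
    with den(1)[OF that(2), of e] that(1) show False by (simp only: zero_complex.sel)
  qed
  have u_bound: "cmod (u e w) \<le> 1 / e" if e: "0 < e" and w: "cmod w \<le> 1" for e w
  proof -
    have "e \<le> cmod (1 + complex_of_real e - cnj \<alpha> * w)"
      using den(2)[OF w, of e] w by simp
    then show ?thesis
      using e by (simp add: u_def norm_divide frac_le)
  qed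
  have u_Re: "0 \<le> Re (u e w)" if e: "0 < e" and w: "cmod w \<le> 1" for e w
    using den(1)[OF w, of e] e by (simp add: u_def Re_divide)
  \<comment> \<open>A bound for the modulus of u e (m 0) that is uniform in e > 0, finite because m
    0 lies strictly inside the disc.\<close>
  define K where "K = 1 / (1 - cmod (m 0))"
  have E_le: "measure \<mu> E \<le> K * e" if e: "0 < e" for e
  proof -
    define h where "h z = u e (m z)" for z
    have h_holo: "sep_holo h"
      using m den_nz[OF e le1] unfolding sep_holo_def h_def u_def
      by (auto intro!: holomorphic_intros simp: in_bidisc)
    have h_bound: "cmod (h z) \<le> 1 / e" if "z \<in> bidisc" for z
      unfolding h_def by (rule u_bound[OF e le1[OF that]])
    obtain d' where d': "power_series2 d' h"
      using sep_holo_power_series[OF h_holo h_bound] by blast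
    have h0: "Re (h 0) \<le> K"
    proof -
      have "Re (h 0) \<le> cmod (h 0)" by (rule complex_Re_le_cmod)
      also have "\<dots> = 1 / cmod (1 + complex_of_real e - cnj \<alpha> * m 0)"
        by (simp add: h_def u_def norm_divide)
      also have "\<dots> \<le> K"
        unfolding K_def using den(2)[of "m 0" e] m0 e by (intro frac_le) auto
      finally show ?thesis .
    qed
    obtain s where "\<forall>n. 0 \<le> s n \<and> s n < (1 :: real)" and s_lim: "filterlim s (at_left 1) sequentially"
      using sequence_at_left_1 by (elim exE conjE)
    then have s: "0 \<le> s n" "s n < 1" for n by simp_all
    have h_meas [measurable]: "dil (s n) h \<in> borel_measurable \<mu>" for n
      by (rule dil_measurable[OF d' s])
    have uG_meas [measurable]: "(\<lambda>x. u e (G x)) \<in> borel_measurable \<mu>"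
      unfolding u_def by measurable
    have uG_bound: "AE x in \<mu>. cmod (u e (G x)) \<le> 1 / e"
      using G_le by eventually_elim (rule u_bound[OF e])
    have "(\<lambda>n. \<integral>x. dil (s n) h x \<partial>\<mu>) \<longlonglongrightarrow> (\<integral>x. u e (G x) \<partial>\<mu>)"
    proof (rule integral_dominated_convergence[where w = "\<lambda>_. 1 / e"])
      show "AE x in \<mu>. (\<lambda>n. dil (s n) h x) \<longlonglongrightarrow> u e (G x)"
        using boundary_value_radial[OF nt] G_le
      proof eventually_elim
        case (elim x)
        have "(\<lambda>n. dil (s n) m x) \<longlonglongrightarrow> G x"
          unfolding G_def by (rule filterlim_compose[OF elim(1) s_lim])
        then have "(\<lambda>n. u e (dil (s n) m x)) \<longlonglongrightarrow> u e (G x)"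
          unfolding u_def by (intro tendsto_intros den_nz e elim)
        then show ?case by (simp add: h_def dil_def)
      qed
      show "AE x in \<mu>. norm (dil (s n) h x) \<le> 1 / e" for n
        by (intro AE_I2) (auto simp: dil_def s intro!: h_bound scaleR_torus_bidisc)
    qed simp_all
    moreover have "(\<integral>x. dil (s n) h x \<partial>\<mu>) = h 0" for n
      by (rule mean_value_torus[OF d' s])
    ultimately have int: "(\<integral>x. u e (G x) \<partial>\<mu>) = h 0"
      by (simp add: LIMSEQ_const_iff)
    have u_int: "integrable \<mu> (\<lambda>x. u e (G x))"
      by (rule torus.integrable_const_bound[OF uG_bound uG_meas])
    have "measure \<mu> E * (1 / e) = (\<integral>x. indicator E x * (1 / e) \<partial>\<mu>)"
      using E sets.sets_into_space[OF E] by (simp add: Int_absorb2)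
    also have "\<dots> \<le> (\<integral>x. Re (u e (G x)) \<partial>\<mu>)"
    proof (rule integral_mono_AE)
      show "integrable \<mu> (\<lambda>x. indicator E x * (1 / e) :: real)"
        using E by (intro integrable_mult_left integrable_real_indicator) (auto simp: torus.emeasure_finite less_top[symmetric])
      show "integrable \<mu> (\<lambda>x. Re (u e (G x)))"
        by (rule integrable_Re[OF u_int])
      show "AE x in \<mu>. indicator E x * (1 / e) \<le> Re (u e (G x))"
        using G_le
      proof eventually_elim
        case (elim x)
        show ?case
        proof (cases "x \<in> E")
          case True
          have "cnj \<alpha> * \<alpha> = 1"
            using \<alpha> by (simp add: complex_norm_square[symmetric] mult.commute)
          then have "u e (G x) = of_real (1 / e)"
            using True by (simp add: u_def E_def)
          then show ?thesis using True by simp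
        qed (use u_Re[OF e elim] in simp)
      qed
    qed
    also have "\<dots> = Re (h 0)"
      using integral_Re[OF u_int] int by simp
    finally have "measure \<mu> E \<le> Re (h 0) * e"
      using e by (simp add: field_simps)
    also have "\<dots> \<le> K * e"
      using e by (intro mult_right_mono h0) simp
    finally show ?thesis .
  qed
  have "measure \<mu> E \<le> 0"
  proof (rule tendsto_lowerbound)
    have "((\<lambda>e. K * e) \<longlongrightarrow> K * 0) (at_right 0)" by (intro tendsto_intros)
    then show "((\<lambda>e. K * e) \<longlongrightarrow> 0) (at_right 0)" by simp
    show "\<forall>\<^sub>F e in at_right 0. measure \<mu> E \<le> K * e"
      using eventually_at_right_less[of "0::real"] by eventually_elim (rule E_le)
  qed simp
  then have "E \<in> null_sets \<mu>"
    using E by (simp add: null_sets_def torus.emeasure_eq_measure measure_le_0_iff)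
  from AE_not_in[OF this] AE_space[of \<mu>] show ?thesis
    by eventually_elim (auto simp: E_def G_def)
qed

section \<open>Boundary values of \<open>vartheta1\<close>\<close>

lemma inner_function_nontangential_limit:
  "inner_function \<phi> \<Longrightarrow> has_nontangential_limits \<phi>"
  unfolding inner_function_def by (auto elim!: eventually_mono)

lemma one_minus_slice_nonzero:
  assumes "inner_function \<phi>" "\<not> \<phi> constant_on bidisc" "cmod \<alpha> = 1" "cmod w < 1"
  shows "1 - cnj \<alpha> * \<phi> (0, w) \<noteq> 0"
proof
  assume "1 - cnj \<alpha> * \<phi> (0, w) = 0"
  then have "cmod (cnj \<alpha> * \<phi> (0, w)) = 1" by simp
  then show False
    using inner_function_less_1[OF assms(1,2), of "(0, w)"] assms(3,4)
    by (simp add: norm_mult bidisc_def)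
qed

lemma vartheta1_sep_holo:
  assumes \<phi>: "inner_function \<phi>" and nc: "\<not> \<phi> constant_on bidisc" and \<alpha>: "cmod \<alpha> = 1"
  shows "sep_holo (vartheta1 \<phi> \<alpha>)"
proof -
  have "sep_holo (B1 \<phi>)"
    by (rule B1_sep_holo[OF inner_function_sep_holo[OF \<phi>], of 1])
      (use inner_function_less_1[OF \<phi> nc] in \<open>auto intro: less_imp_le\<close>)
  then show ?thesis
    using sep_holo_snd[OF inner_function_sep_holo[OF \<phi>], of 0] one_minus_slice_nonzero[OF assms]
    unfolding sep_holo_def vartheta1_def by (auto intro!: holomorphic_intros)
qed

lemma vartheta1_nontangential_limit:
  assumes \<phi>: "inner_function \<phi>" and nc: "\<not> \<phi> constant_on bidisc" and \<alpha>: "cmod \<alpha> = 1"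
  shows "has_nontangential_limits (vartheta1 \<phi> \<alpha>)"
proof -
  have le1: "cmod (\<phi> z) \<le> 1" if "z \<in> bidisc" for z
    using inner_function_less_1[OF \<phi> nc that] by simp
  note sh = inner_function_sep_holo[OF \<phi>] and nt = inner_function_nontangential_limit[OF \<phi>]
  have nt0: "has_nontangential_limits (slice0 \<phi>)"
    by (rule slice0_nontangential_limit[OF sh le1 nt])
  have "AE x in \<mu>. boundary_value (slice0 \<phi>) x \<noteq> \<alpha>"
  proof (rule boundary_value_neq[OF sep_holo_slice0[OF sh] _ _ nt0 \<alpha>])
    show "cmod (slice0 \<phi> z) \<le> 1" if "z \<in> bidisc" for z
      unfolding slice0_def by (rule le1) (use that in \<open>auto simp: bidisc_def\<close>)
    show "cmod (slice0 \<phi> 0) < 1"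
      unfolding slice0_def by (rule inner_function_less_1[OF \<phi> nc]) (simp add: bidisc_def)
  qed
  with nt nt0 AE_space[of \<mu>] show ?thesis
  proof eventually_elim
    case (elim x)
    then obtain L M where L: "nontangential_limit \<phi> x L" and M: "nontangential_limit (slice0 \<phi>) x M"
      by blast
    have x: "x \<in> torus" "fst x \<noteq> 0" using elim by (auto simp: torus_def)
    have "M \<noteq> \<alpha>" using elim M x by (simp add: boundary_value_eq)
    moreover have "\<alpha> * cnj \<alpha> = 1" using \<alpha> by (simp add: complex_norm_square[symmetric])
    ultimately have nz: "1 - cnj \<alpha> * M \<noteq> 0"
      by (metis eq_iff_diff_eq_0 mult.assoc mult.commute mult.right_neutral)
    have "nontangential_limit (vartheta1 \<phi> \<alpha>) x (cnj \<alpha> * ((L - M) / fst x / (1 - cnj \<alpha> * M)))"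
      unfolding nontangential_limit_def
    proof (intro allI impI)
      fix c :: real assume "c > 1"
      then have lims: "(\<phi> \<longlongrightarrow> L) (at x within stolz c x)" "(slice0 \<phi> \<longlongrightarrow> M) (at x within stolz c x)"
        using L M by (auto simp: nontangential_limit_def)
      have fst_lim: "(fst \<longlongrightarrow> fst x) (at x within stolz c x)"
        by (intro tendsto_intros)
      have "((\<lambda>z. cnj \<alpha> * ((\<phi> z - slice0 \<phi> z) / fst z / (1 - cnj \<alpha> * slice0 \<phi> z))) \<longlongrightarrow>
          cnj \<alpha> * ((L - M) / fst x / (1 - cnj \<alpha> * M))) (at x within stolz c x)"
        by (intro tendsto_intros lims fst_lim x nz)
      \<comment> \<open>Near x the first coordinate is nonzero, so the derivative branch of
        \<open>B1\<close> does not occur and \<open>vartheta1\<close> is the plain quotient.\<close>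
      moreover have "\<forall>\<^sub>F z in at x within stolz c x.
          cnj \<alpha> * ((\<phi> z - slice0 \<phi> z) / fst z / (1 - cnj \<alpha> * slice0 \<phi> z)) = vartheta1 \<phi> \<alpha> z"
        using tendsto_imp_eventually_ne[OF fst_lim x(2)]
        by eventually_elim (simp add: vartheta1_def B1_def slice0_def)
      ultimately show "(vartheta1 \<phi> \<alpha> \<longlongrightarrow> cnj \<alpha> * ((L - M) / fst x / (1 - cnj \<alpha> * M))) (at x within stolz c x)"
        by (rule Lim_transform_eventually)
    qed
    then show ?case by blast
  qed
qed

section \<open>The adjoint of \<open>U1\<close>\<close>

text \<open>Multiplication by \<phi> is isometric, so composing it with its adjoint gives the
  orthogonal projection onto \<phi> H2. Subtracting \<phi> p from h, where p is the adjoint applied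
  to h, therefore projects onto the model space.\<close>

lemma H2_proj_model_space:
  assumes \<phi>: "inner_function \<phi>" and h: "h \<in> H2"
  shows "H2_proj (model_space \<phi>) h \<in> model_space \<phi> \<and>
    (\<forall>g\<in>model_space \<phi>. H2_inner (H2_proj (model_space \<phi>) h) g = H2_inner h g)"
proof -
  obtain C where C: "\<And>z. z \<in> bidisc \<Longrightarrow> cmod (\<phi> z) \<le> C"
    using \<phi> by (rule inner_function_bound) (rule that)
  obtain d where d: "power_series2 d \<phi>"
    using \<phi> by (rule inner_function_power_series) (rule that)
  obtain p where p: "p \<in> H2" "\<And>g. g \<in> H2 \<Longrightarrow> H2_inner p g = H2_inner h (\<lambda>z. \<phi> z * g z)"
    by (rule multiplier_adjoint[OF d C h], assumption) (rule that)
  note \<phi>p = inner_function_H2[OF \<phi> p(1)]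
  let ?q = "\<lambda>z. h z - \<phi> z * p z"
  have q_H2: "?q \<in> H2" by (rule H2_diff[OF h \<phi>p])
  have q: "?q \<in> model_space \<phi>"
    unfolding model_space_def
    using q_H2 by (auto simp: H2_inner_diff_left h \<phi>p inner_function_H2[OF \<phi>]
        inner_function_isometry[OF \<phi> p(1)] p(2))
  have q_inner: "H2_inner ?q g = H2_inner h g" if g: "g \<in> model_space \<phi>" for g
    using model_space_orthogonal[OF g p(1)] H2_inner_commute[of "\<lambda>z. \<phi> z * p z" g]
    by (simp add: H2_inner_diff_left h \<phi>p model_space_H2[OF g])
  have "H2_proj (model_space \<phi>) h = ?q"
    unfolding H2_proj_def
  proof (rule the_equality)
    show "?q \<in> model_space \<phi> \<and> (\<forall>g\<in>model_space \<phi>. H2_inner (\<lambda>z. h z - ?q z) g = 0)"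
    proof (intro conjI ballI q)
      fix g assume g: "g \<in> model_space \<phi>"
      show "H2_inner (\<lambda>z. h z - ?q z) g = 0"
        unfolding H2_inner_diff_left[OF h q_H2 model_space_H2[OF g]] q_inner[OF g] by (rule diff_self)
    qed
    fix q' assume q': "q' \<in> model_space \<phi> \<and> (\<forall>g\<in>model_space \<phi>. H2_inner (\<lambda>z. h z - q' z) g = 0)"
    have "H2_inner q' g = H2_inner ?q g" if g: "g \<in> model_space \<phi>" for g
    proof -
      have "q' \<in> H2" "H2_inner (\<lambda>z. h z - q' z) g = 0"
        using q' g model_space_H2 by blast+
      then have "H2_inner h g - H2_inner q' g = 0"
        by (simp only: H2_inner_diff_left[OF h _ model_space_H2[OF g]])
      then show ?thesis
        unfolding q_inner[OF g] by simp
    qed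
    from this[OF model_space_diff[OF \<phi> _ q]] q' show "q' = ?q"
      by (intro H2_eqI) (auto simp: model_space_H2 q_H2 H2_inner_diff_left[OF _ q_H2] H2_diff[OF _ q_H2])
  qed
  then show ?thesis using q q_inner by simp
qed

lemma model_space_eqI:
  assumes \<phi>: "inner_function \<phi>" and f: "f \<in> model_space \<phi>" and g: "g \<in> model_space \<phi>"
    and eq: "\<And>h. h \<in> model_space \<phi> \<Longrightarrow> H2_inner f h = H2_inner g h"
  shows "f = g"
proof (rule H2_eqI[OF f[THEN model_space_H2] g[THEN model_space_H2]])
  have d: "(\<lambda>z. f z - g z) \<in> model_space \<phi>" by (rule model_space_diff[OF \<phi> f g])
  show "H2_inner (\<lambda>z. f z - g z) (\<lambda>z. f z - g z) = 0"
    using eq[OF d] by (simp add: H2_inner_diff_left model_space_H2[OF f] model_space_H2[OF g] model_space_H2[OF d])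
qed

text \<open>Projecting onto \<open>H22\<close> means setting z1 = 0, which kills z1 * f.\<close>

lemma fst_mult_orthogonal_H22:
  assumes "f \<in> H2" "p \<in> H22"
  shows "H2_inner (\<lambda>z. fst z * f z) p = 0"
proof -
  have zf: "(\<lambda>z. fst z * f z) \<in> H2" by (rule inner_function_H2[OF inner_function_fst assms(1)])
  have "restrict0 (\<lambda>z. fst z * f z) = (\<lambda>z. 0 * f z)"
    by (auto simp: restrict0_def)
  then have "H2_inner p (\<lambda>z. fst z * f z) = H2_inner p (\<lambda>z. 0 * f z)"
    using H2_inner_restrict0[OF assms(2) zf] by metis
  also have "\<dots> = 0"
    using H2_inner_cmult_right[OF assms(1) H22_H2[OF assms(2)], of 0] by simp
  finally show ?thesis
    using H2_inner_commute[of _ p] by (metis complex_cnj_zero)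
qed

text \<open>The two summands of \<open>U1\<close> have the adjoints \<open>g \<mapsto> (g - g\<^sub>0) / z\<^sub>1\<close> and
  \<open>g \<mapsto> vartheta1 \<cdot> g\<^sub>0\<close>, where \<open>g\<^sub>0(z) = g (0, z\<^sub>2)\<close>.\<close>

lemma U1_adjoint:
  assumes \<phi>: "inner_function \<phi>" and nc: "\<not> \<phi> constant_on bidisc" and \<alpha>: "cmod \<alpha> = 1"
    and bdd: "bounded (vartheta1 \<phi> \<alpha> ` bidisc)"
    and f: "f \<in> model_space \<phi>"
  shows "U1 \<phi> \<alpha> f \<in> model_space \<phi>" (is ?mem)
    and "g \<in> model_space \<phi> \<Longrightarrow> v \<in> H2 \<Longrightarrow>
      (\<And>z. z \<in> bidisc \<Longrightarrow> fst z * v z = g z - g (0, snd z) + fst z * (vartheta1 \<phi> \<alpha> z * g (0, snd z))) \<Longrightarrow>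
      H2_inner (U1 \<phi> \<alpha> f) g = H2_inner f v"
proof -
  let ?t = "vartheta1 \<phi> \<alpha>" and ?K = "model_space \<phi>"
  obtain C where C: "\<And>z. z \<in> bidisc \<Longrightarrow> cmod (?t z) \<le> C"
    using bdd unfolding bounded_iff by auto
  obtain d where d: "power_series2 d ?t"
    using sep_holo_power_series[OF vartheta1_sep_holo[OF \<phi> nc \<alpha>] C] by blast
  note nt = vartheta1_nontangential_limit[OF \<phi> nc \<alpha>]
  have fH: "f \<in> H2" by (rule model_space_H2[OF f])
  have zf: "(\<lambda>z. fst z * f z) \<in> H2" by (rule inner_function_H2[OF inner_function_fst fH])
  have t_H2: "(\<lambda>z. ?t z * g z) \<in> H2" if "g \<in> H2" for g
    by (rule bounded_multiplier(1)[OF d C that])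
  obtain q where q: "q \<in> H2" "\<And>g. g \<in> H2 \<Longrightarrow> H2_inner q g = H2_inner f (\<lambda>z. ?t z * g z)"
    by (rule multiplier_adjoint[OF d C fH], assumption) (rule that)
  let ?G = "\<lambda>x. cnj (boundary_value ?t x) * H2_boundary f x"
  have G: "?G \<in> L2 \<mu>"
  proof (rule L2_bounded_mult[OF _ _ H2_boundary_L2[OF fH]])
    show "(\<lambda>x. cnj (boundary_value ?t x)) \<in> borel_measurable \<mu>"
      by (rule measurable_compose[OF boundary_value_measurable[OF d nt] cnj_measurable])
    show "AE x in \<mu>. cmod (cnj (boundary_value ?t x)) \<le> C"
      using boundary_value_bounded[of ?t C, OF C nt] by simp
  qed
  have qG: "H2_inner q g = L2_inner \<mu> ?G (H2_boundary g)" if "g \<in> H22" for g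
    using H2_inner_multiplier[of d ?t C, OF d C nt fH H22_H2[OF that]] q(2)[OF H22_H2[OF that]]
    by (simp add: L2_inner_def mult.assoc)
  let ?p = "proj_H22 ?G"
  have p: "?p \<in> H22" and p_inner: "\<And>g. g \<in> H2 \<Longrightarrow> H2_inner ?p g = H2_inner q (restrict0 g)"
    using proj_H22[OF G q(1) qG] by auto
  note P1 = H2_proj_model_space[OF \<phi> zf, folded compressed_shift1_def]
    and P2 = H2_proj_model_space[OF \<phi> H22_H2[OF p]]
  have U: "U1 \<phi> \<alpha> f = (\<lambda>z. compressed_shift1 \<phi> f z + H2_proj ?K ?p z)"
    by (simp add: U1_def)
  show ?mem
    unfolding U using P1 P2 by (intro model_space_add[OF \<phi>]) auto
  assume g: "g \<in> ?K" and v: "v \<in> H2"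
    and veq: "\<And>z. z \<in> bidisc \<Longrightarrow> fst z * v z = g z - g (0, snd z) + fst z * (?t z * g (0, snd z))"
  have gH: "g \<in> H2" by (rule model_space_H2[OF g])
  let ?g0 = "restrict0 g"
  have g0: "?g0 \<in> H22" "?g0 \<in> H2"
    using restrict0_H22[OF gH] H22_H2 by auto
  \<comment> \<open>\<open>?r\<close> is the difference quotient (g - g0) / z1. It is built from v,
    so that its membership in \<open>H2\<close> is immediate and nothing is divided by z1.\<close>
  let ?r = "\<lambda>z. v z - ?t z * ?g0 z"
  have r: "?r \<in> H2" by (rule H2_diff[OF v t_H2[OF g0(2)]])
  have zr: "(\<lambda>z. fst z * ?r z) = (\<lambda>z. g z - ?g0 z)"
  proof
    fix z show "fst z * ?r z = g z - ?g0 z"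
      using veq[of z] H2_outside[OF gH, of z] H2_outside[OF v, of z]
      by (cases "z \<in> bidisc") (simp_all add: restrict0_def right_diff_distrib)
  qed
  have "H2_inner (U1 \<phi> \<alpha> f) g = H2_inner (compressed_shift1 \<phi> f) g + H2_inner (H2_proj ?K ?p) g"
    unfolding U using P1 P2 by (intro H2_inner_add_left gH) (auto intro: model_space_H2)
  also have "\<dots> = H2_inner (\<lambda>z. fst z * f z) g + H2_inner ?p g"
    using P1 P2 g by simp
  \<comment> \<open>Subtracting g0 changes nothing because z1 * f is orthogonal to
    \<open>H22\<close>; then both arguments carry the factor z1, which the isometry cancels.\<close>
  also have "H2_inner (\<lambda>z. fst z * f z) g = H2_inner (\<lambda>z. fst z * f z) (\<lambda>z. g z - ?g0 z)"
    by (simp add: H2_inner_diff_right[OF gH g0(2) zf] fst_mult_orthogonal_H22[OF fH g0(1)])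
  also have "\<dots> = H2_inner f ?r"
    unfolding zr[symmetric] by (rule inner_function_isometry[OF inner_function_fst fH r])
  also have "\<dots> = H2_inner f v - H2_inner f (\<lambda>z. ?t z * ?g0 z)"
    by (rule H2_inner_diff_right[OF v t_H2[OF g0(2)] fH])
  also have "H2_inner ?p g = H2_inner f (\<lambda>z. ?t z * ?g0 z)"
    by (simp add: p_inner[OF gH] q(2)[OF g0(2)])
  finally show "H2_inner (U1 \<phi> \<alpha> f) g = H2_inner f v" by simp
qed

section \<open>Polarization identities\<close>

lemma H2_polarization:
  assumes "f \<in> H2" "g \<in> H2"
  shows "(H2_norm (\<lambda>z. f z + c * g z))\<^sup>2 = (H2_norm f)\<^sup>2 + (cmod c)\<^sup>2 * (H2_norm g)\<^sup>2 + 2 * Re (cnj c * H2_inner f g)"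
proof -
  note H = assms(1) H2_cmult[OF assms(2), of c]
  have "complex_of_real ((H2_norm (\<lambda>z. f z + c * g z))\<^sup>2) =
      H2_inner f f + c * cnj c * H2_inner g g + (cnj c * H2_inner f g + cnj (cnj c * H2_inner f g))"
    unfolding H2_inner_self[OF H2_add[OF H], symmetric]
    using H2_inner_commute[of g f]
    by (simp add: H2_inner_add_left H2_inner_add_right H2_add H H2_inner_cmult_left H2_inner_cmult_right
        assms algebra_simps)
  also have "cnj c * H2_inner f g + cnj (cnj c * H2_inner f g) = of_real (2 * Re (cnj c * H2_inner f g))"
    by (rule complex_add_cnj)
  also have "c * cnj c = of_real ((cmod c)\<^sup>2)"
    by (simp only: complex_norm_square)
  finally show ?thesis
    unfolding H2_inner_self[OF assms(1)] H2_inner_self[OF assms(2)]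
    by (simp only: of_real_add[symmetric] of_real_mult[symmetric] of_real_eq_iff)
qed

lemma L2_polarization:
  assumes f: "f \<in> L2 M" and g: "g \<in> L2 M"
  shows "(L2_norm M (\<lambda>z. f z + c * g z))\<^sup>2 = (L2_norm M f)\<^sup>2 + (cmod c)\<^sup>2 * (L2_norm M g)\<^sup>2 + 2 * Re (cnj c * L2_inner M f g)"
proof -
  have pw: "(cmod (f x + c * g x))\<^sup>2 =
      (cmod (f x))\<^sup>2 + (cmod c)\<^sup>2 * (cmod (g x))\<^sup>2 + 2 * Re (cnj c * (f x * cnj (g x)))" for x
    unfolding cmod_power2 by (simp add: power2_eq_square algebra_simps)
  have int: "integrable M (\<lambda>x. cnj c * (f x * cnj (g x)))"
    by (intro integrable_mult_right L2_inner_integrable f g)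
  have "(\<integral>x. (cmod (f x + c * g x))\<^sup>2 \<partial>M) =
      (\<integral>x. (cmod (f x))\<^sup>2 \<partial>M) + (\<integral>x. (cmod c)\<^sup>2 * (cmod (g x))\<^sup>2 \<partial>M) +
      (\<integral>x. 2 * Re (cnj c * (f x * cnj (g x))) \<partial>M)"
    unfolding pw
    by (simp only: Bochner_Integration.integral_add Bochner_Integration.integrable_add integrable_mult_right
        L2_square_integrable f g integrable_Re int)
  also have "(\<integral>x. 2 * Re (cnj c * (f x * cnj (g x))) \<partial>M) = 2 * Re (cnj c * L2_inner M f g)"
    unfolding L2_inner_def by (simp add: integral_Re[OF int] del: times_complex.simps)
  finally show ?thesis by (simp add: L2_norm_square)
qed

section \<open>The Clark embedding\<close>

lemma L2_inner_cong_AE: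
  assumes "f \<in> borel_measurable M" "f' \<in> borel_measurable M" "g \<in> borel_measurable M" "g' \<in> borel_measurable M"
    and "AE x in M. f x = f' x" "AE x in M. g x = g' x"
  shows "L2_inner M f g = L2_inner M f' g'"
  unfolding L2_inner_def
proof (rule integral_cong_AE)
  show "AE x in M. f x * cnj (g x) = f' x * cnj (g' x)"
    using assms(5,6) by eventually_elim simp
qed (intro borel_measurable_times measurable_compose[OF _ cnj_measurable] assms)+

lemma L2_norm_cong_AE:
  assumes [measurable]: "f \<in> borel_measurable M" "f' \<in> borel_measurable M" and ae: "AE x in M. f x = f' x"
  shows "L2_norm M f = L2_norm M f'"
  unfolding L2_norm_def
  by (intro arg_cong[where f = sqrt] integral_cong_AE) (use ae in auto)

lemma L2_inner_cmult_right: "L2_inner M f (\<lambda>x. c * g x) = cnj c * L2_inner M f g"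
  by (simp add: L2_inner_def mult.left_commute)

text \<open>The definition of the embedding records only norms and linearity almost everywhere.
  Comparing the norms of f + c * g and of its image gives the real part of cnj c times the inner
  product; c = 1 and c = \<i> recover both parts.\<close>

lemma clark_embedding_isometry:
  assumes \<phi>: "inner_function \<phi>" and J: "clark_embedding \<phi> \<alpha> \<sigma> J"
    and f: "f \<in> model_space \<phi>" and g: "g \<in> model_space \<phi>"
  shows "L2_inner \<sigma> (J f) (J g) = H2_inner f g"
proof -
  have JL2: "\<And>f. f \<in> model_space \<phi> \<Longrightarrow> J f \<in> L2 \<sigma>"
    and Jnorm: "\<And>f. f \<in> model_space \<phi> \<Longrightarrow> L2_norm \<sigma> (J f) = H2_norm f"
    and Jadd: "\<And>f g. f \<in> model_space \<phi> \<Longrightarrow> g \<in> model_space \<phi> \<Longrightarrow>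
      AE x in \<sigma>. J (\<lambda>z. f z + g z) x = J f x + J g x"
    and Jcmult: "\<And>f c. f \<in> model_space \<phi> \<Longrightarrow> AE x in \<sigma>. J (\<lambda>z. c * f z) x = c * J f x"
    using J by (auto simp: clark_embedding_def)
  have "Re (cnj c * L2_inner \<sigma> (J f) (J g)) = Re (cnj c * H2_inner f g)" for c
  proof -
    let ?s = "\<lambda>z. f z + c * g z"
    have cg: "(\<lambda>z. c * g z) \<in> model_space \<phi>" by (rule model_space_cmult[OF \<phi> g])
    have s: "?s \<in> model_space \<phi>" by (rule model_space_add[OF \<phi> f cg])
    have "AE x in \<sigma>. J ?s x = J f x + c * J g x"
      using Jadd[OF f cg] Jcmult[OF g, of c] by eventually_elim simp
    then have "L2_norm \<sigma> (\<lambda>x. J f x + c * J g x) = H2_norm ?s"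
      unfolding Jnorm[OF s, symmetric]
      by (intro L2_norm_cong_AE L2_measurable L2_add L2_cmult JL2 s f g) auto
    then show ?thesis
      using L2_polarization[OF JL2[OF f] JL2[OF g], of c]
        H2_polarization[OF model_space_H2[OF f] model_space_H2[OF g], of c]
        Jnorm[OF f] Jnorm[OF g] by simp
  qed
  from this[of 1] this[of \<i>] show ?thesis
    by (simp add: complex_eq_iff)
qed

lemma clark_embedding_inj:
  assumes \<phi>: "inner_function \<phi>" and J: "clark_embedding \<phi> \<alpha> \<sigma> J"
    and f: "f \<in> model_space \<phi>" and g: "g \<in> model_space \<phi>" and ae: "AE x in \<sigma>. J f x = J g x"
  shows "f = g"
proof (rule model_space_eqI[OF \<phi> f g])
  fix h assume h: "h \<in> model_space \<phi>"
  have meas: "J f \<in> borel_measurable \<sigma>" if "f \<in> model_space \<phi>" for f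
    using J that by (auto simp: clark_embedding_def L2_def)
  have "L2_inner \<sigma> (J f) (J h) = L2_inner \<sigma> (J g) (J h)"
    by (intro L2_inner_cong_AE ae meas f g h) auto
  then show "H2_inner f h = H2_inner g h"
    by (simp add: clark_embedding_isometry[OF \<phi> J] f g h)
qed

text \<open>With t = cnj w1 * \<zeta>1 this is t / (1 - t) = 1 / (1 - t) - 1, multiplied by the
  factor in the second variable, which is the kernel at (0, w2).\<close>

lemma szego_kernel_shift:
  assumes "w \<in> bidisc" "x \<in> torus"
  shows "cnj (fst w) * (fst x * szego_kernel w x) = szego_kernel w x - szego_kernel (0, snd w) x"
proof -
  have "cmod (fst x * cnj (fst w)) < 1" "cmod (snd x * cnj (snd w)) < 1"
    using assms by (auto simp: bidisc_def torus_def norm_mult)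
  then have "1 - fst x * cnj (fst w) \<noteq> 0" "1 - snd x * cnj (snd w) \<noteq> 0" by auto
  then show ?thesis
    by (simp add: szego_kernel_def divide_simps)
qed

theorem theorem4p3:
  fixes \<phi> :: "complex \<times> complex \<Rightarrow> complex" and \<alpha> :: complex
    and \<sigma> :: "(complex \<times> complex) measure"
    and J :: "(complex \<times> complex \<Rightarrow> complex) \<Rightarrow> (complex \<times> complex \<Rightarrow> complex)"
  assumes "inner_function \<phi>"
    and "\<not> \<phi> constant_on bidisc"
    and "cmod \<alpha> = 1"
    and "clark_measure \<phi> \<alpha> \<sigma>"
    and "clark_embedding \<phi> \<alpha> \<sigma> J"
    and "surjective_onto_L2 (model_space \<phi>) \<sigma> J"
    and "bounded (vartheta1 \<phi> \<alpha> ` bidisc)"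
  shows "unitary_on (model_space \<phi>) (U1 \<phi> \<alpha>) \<and>
    (\<forall>g\<in>L2 \<sigma>. AE \<zeta> in \<sigma>.
       fst \<zeta> * g \<zeta> = J (U1 \<phi> \<alpha> (L2_adjoint (model_space \<phi>) \<sigma> J g)) \<zeta>)"
proof -
  let ?K = "model_space \<phi>" and ?U = "U1 \<phi> \<alpha>"
  note \<phi> = assms(1) and nc = assms(2) and \<alpha> = assms(3) and J = assms(5)
  have JL2: "\<And>f. f \<in> ?K \<Longrightarrow> J f \<in> L2 \<sigma>"
    and Jadd: "\<And>f g. f \<in> ?K \<Longrightarrow> g \<in> ?K \<Longrightarrow> AE x in \<sigma>. J (\<lambda>z. f z + g z) x = J f x + J g x"
    and Jcmult: "\<And>f c. f \<in> ?K \<Longrightarrow> AE x in \<sigma>. J (\<lambda>z. c * f z) x = c * J f x"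
    and Jker: "\<And>w. w \<in> bidisc \<Longrightarrow>
      AE x in \<sigma>. J (model_kernel \<phi> w) x = (1 - \<alpha> * cnj (\<phi> w)) * szego_kernel w x"
    using J by (auto simp: clark_embedding_def)
  note Jmeas = L2_measurable[OF JL2]
  note Jinner = clark_embedding_isometry[OF \<phi> J]
  note Jinj = clark_embedding_inj[OF \<phi> J]
  have Jsurj: "\<exists>f\<in>?K. AE x in \<sigma>. J f x = g x" if "g \<in> L2 \<sigma>" for g
    using assms(6) that by (auto simp: surjective_onto_L2_def)
  have sets_\<sigma>: "sets \<sigma> = sets (restrict_space borel torus)"
    using assms(4) by (simp add: clark_measure_def)
  have space_\<sigma>: "space \<sigma> = torus"
    using sets_eq_imp_space_eq[OF sets_\<sigma>] by (simp add: space_restrict_space)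
  have fst_meas: "fst \<in> borel_measurable \<sigma>"
    unfolding measurable_cong_sets[OF sets_\<sigma> refl] by (rule fst_measurable_restrict)
  have unimod: "fst x * cnj (fst x) = 1" "cmod (fst x) = 1" if "x \<in> space \<sigma>" for x
    using that by (auto simp: space_\<sigma> torus_def complex_norm_square[symmetric])
  have M_L2: "(\<lambda>x. fst x * g x) \<in> L2 \<sigma>" "(\<lambda>x. cnj (fst x) * g x) \<in> L2 \<sigma>" if "g \<in> L2 \<sigma>" for g
    using that unimod(2)
    by (auto intro!: L2_bounded_mult[where C = 1] AE_I2 fst_meas measurable_compose[OF fst_meas cnj_measurable])
  have shift_inner: "L2_inner \<sigma> (\<lambda>x. cnj (fst x) * p x) q = L2_inner \<sigma> p (\<lambda>x. fst x * q x)" for p q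
    by (simp add: L2_inner_def mult_ac)

  \<comment> \<open>v stands for the image of g under the inverse of the transported multiplication.
    The formula is stated for w1 * v w, so it is trivial at w1 = 0 and matches the hypothesis of
    \<open>U1_adjoint\<close>.\<close>
  have adjoint_value: "fst w * v w = g w - g (0, snd w) + fst w * (vartheta1 \<phi> \<alpha> w * g (0, snd w))"
    if g: "g \<in> ?K" and v: "v \<in> ?K" and Jv: "AE x in \<sigma>. J v x = cnj (fst x) * J g x" and w: "w \<in> bidisc"
    for g v w
  proof (cases "fst w = 0")
    case True
    then have "w = (0, snd w)" by (simp add: prod_eq_iff)
    then show ?thesis using True by simp
  next
    case False
    define w0 where "w0 = (0 :: complex, snd w)"
    define k k0 where "k = J (model_kernel \<phi> w)" and "k0 = J (model_kernel \<phi> w0)"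
    \<comment> \<open>\<open>J\<close> scales the Szego kernels at w and w0 by different factors; c
      converts the factor at w0 into the one at w, so that the shift identity for Szego kernels
      applies to k and k0.\<close>
    define c where "c = (1 - \<alpha> * cnj (\<phi> w)) / (1 - \<alpha> * cnj (\<phi> w0))"
    have w0: "w0 \<in> bidisc" and sw: "cmod (snd w) < 1" using w by (auto simp: w0_def bidisc_def)
    note kK = model_kernel_in_model_space[OF \<phi> w] model_kernel_in_model_space[OF \<phi> w0]
    have k_L2: "k \<in> L2 \<sigma>" "k0 \<in> L2 \<sigma>"
      unfolding k_def k0_def by (intro JL2 kK)+
    have nz: "1 - cnj \<alpha> * \<phi> w0 \<noteq> 0"
      unfolding w0_def by (rule one_minus_slice_nonzero[OF \<phi> nc \<alpha> sw])
    then have nz': "1 - \<alpha> * cnj (\<phi> w0) \<noteq> 0"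
      using complex_cnj_cancel_iff[of "1 - cnj \<alpha> * \<phi> w0" 0] by simp
    have k_shift: "AE x in \<sigma>. cnj (fst w) * (fst x * k x) = k x - c * k0 x"
      using Jker[OF w] Jker[OF w0] AE_space[of \<sigma>]
    proof eventually_elim
      case (elim x)
      have "cnj (fst w) * (fst x * k x) =
          (1 - \<alpha> * cnj (\<phi> w)) * (cnj (fst w) * (fst x * szego_kernel w x))"
        unfolding k_def elim(1) by (simp add: mult_ac)
      also have "\<dots> = (1 - \<alpha> * cnj (\<phi> w)) * (szego_kernel w x - szego_kernel w0 x)"
        using szego_kernel_shift[OF w, of x] elim(3) by (simp add: space_\<sigma> w0_def)
      also have "\<dots> = k x - c * k0 x"
        unfolding k_def k0_def elim(1,2) c_def using nz' by (simp add: right_diff_distrib)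
      finally show ?case .
    qed
    have "fst w * v w = fst w * L2_inner \<sigma> (J v) k"
      unfolding k_def Jinner[OF v kK(1)] model_kernel_reproducing[OF \<phi> w v] ..
    also have "L2_inner \<sigma> (J v) k = L2_inner \<sigma> (\<lambda>x. cnj (fst x) * J g x) k"
      by (intro L2_inner_cong_AE Jv Jmeas v L2_measurable M_L2 JL2 g k_L2) auto
    also have "fst w * \<dots> = L2_inner \<sigma> (J g) (\<lambda>x. cnj (fst w) * (fst x * k x))"
      by (simp add: shift_inner L2_inner_cmult_right)
    also have "\<dots> = L2_inner \<sigma> (J g) (\<lambda>x. k x - c * k0 x)"
      by (intro L2_inner_cong_AE k_shift Jmeas g L2_measurable[OF L2_cmult] L2_measurable[OF L2_diff]
          L2_cmult M_L2 k_L2) auto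
    also have "\<dots> = L2_inner \<sigma> (J g) k - cnj c * L2_inner \<sigma> (J g) k0"
      by (simp only: L2_inner_diff_right[OF k_L2(1) L2_cmult[OF k_L2(2)] JL2[OF g]] L2_inner_cmult_right)
    also have "\<dots> = g w - cnj c * g w0"
      unfolding k_def k0_def Jinner[OF g kK(1)] Jinner[OF g kK(2)]
        model_kernel_reproducing[OF \<phi> w g] model_kernel_reproducing[OF \<phi> w0 g] ..
    also have "cnj c = (1 - cnj \<alpha> * \<phi> w) / (1 - cnj \<alpha> * \<phi> w0)"
      by (simp add: c_def)
    also have "(1 - cnj \<alpha> * \<phi> w) / (1 - cnj \<alpha> * \<phi> w0) = 1 - fst w * vartheta1 \<phi> \<alpha> w"
      using False nz by (simp add: vartheta1_def B1_def w0_def[symmetric] field_simps)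
    finally show ?thesis
      by (simp add: w0_def algebra_simps)
  qed

  have U_K: "?U f \<in> ?K" if "f \<in> ?K" for f
    by (rule U1_adjoint(1)[OF \<phi> nc \<alpha> assms(7) that])
  \<comment> \<open>Surjectivity gives u with J u = \<zeta>1 * J f. Both \<open>?U f\<close> and u
    have inner product \<open>H2_inner f v\<close> with g, where J v = cnj \<zeta>1 * J g: the
    former by the adjoint formula, the latter because \<zeta>1 moves across the integral.\<close>
  have JU: "AE x in \<sigma>. J (?U f) x = fst x * J f x" if f: "f \<in> ?K" for f
  proof -
    obtain u where u: "u \<in> ?K" and Ju: "AE x in \<sigma>. J u x = fst x * J f x"
      using Jsurj[OF M_L2(1)[OF JL2[OF f]]] by blast
    have "?U f = u"
    proof (rule model_space_eqI[OF \<phi> U_K[OF f] u])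
      fix g assume g: "g \<in> ?K"
      obtain v where v: "v \<in> ?K" and Jv: "AE x in \<sigma>. J v x = cnj (fst x) * J g x"
        using Jsurj[OF M_L2(2)[OF JL2[OF g]]] by blast
      have "H2_inner (?U f) g = H2_inner f v"
        by (rule U1_adjoint(2)[OF \<phi> nc \<alpha> assms(7) f g model_space_H2[OF v] adjoint_value[OF g v Jv]])
      also have "\<dots> = L2_inner \<sigma> (J f) (J v)" by (rule Jinner[OF f v, symmetric])
      also have "\<dots> = L2_inner \<sigma> (J f) (\<lambda>x. cnj (fst x) * J g x)"
        by (intro L2_inner_cong_AE Jv Jmeas f v L2_measurable M_L2 JL2 g) auto
      also have "\<dots> = L2_inner \<sigma> (\<lambda>x. fst x * J f x) (J g)"
        by (simp add: L2_inner_def mult_ac)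
      also have "\<dots> = L2_inner \<sigma> (J u) (J g)"
      proof (intro L2_inner_cong_AE Jmeas g u L2_measurable M_L2 JL2 f)
        show "AE x in \<sigma>. fst x * J f x = J u x" using Ju by eventually_elim simp
      qed auto
      also have "\<dots> = H2_inner u g" by (rule Jinner[OF u g])
      finally show "H2_inner (?U f) g = H2_inner u g" .
    qed
    with Ju show ?thesis by simp
  qed

  have unitary: "unitary_on ?K ?U"
    unfolding unitary_on_def
  proof (intro conjI ballI allI)
    show "?U ` ?K = ?K"
    proof (intro equalityI subsetI)
      fix g assume g: "g \<in> ?K"
      \<comment> \<open>The preimage of g: since \<zeta>1 is unimodular on the torus, multiplying by
        its conjugate inverts the multiplication.\<close>
      obtain v where v: "v \<in> ?K" and Jv: "AE x in \<sigma>. J v x = cnj (fst x) * J g x"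
        using Jsurj[OF M_L2(2)[OF JL2[OF g]]] by blast
      have "AE x in \<sigma>. J (?U v) x = J g x"
        using JU[OF v] Jv AE_space[of \<sigma>]
      proof eventually_elim
        case (elim x)
        then show ?case using unimod(1)[OF elim(3)] by (simp add: mult.assoc[symmetric])
      qed
      then have "?U v = g" by (rule Jinj[OF U_K[OF v] g])
      with v show "g \<in> ?U ` ?K" by blast
    qed (use U_K in blast)
  next
    fix f g assume f: "f \<in> ?K" and g: "g \<in> ?K"
    note fg = model_space_add[OF \<phi> f g] and UfUg = model_space_add[OF \<phi> U_K[OF f] U_K[OF g]]
    have "AE x in \<sigma>. J (?U (\<lambda>z. f z + g z)) x = J (\<lambda>z. ?U f z + ?U g z) x"
      using JU[OF fg] JU[OF f] JU[OF g] Jadd[OF f g] Jadd[OF U_K[OF f] U_K[OF g]]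
      by eventually_elim (simp add: distrib_left)
    then show "?U (\<lambda>z. f z + g z) = (\<lambda>z. ?U f z + ?U g z)"
      by (rule Jinj[OF U_K[OF fg] UfUg])
    have "H2_inner (?U f) (?U g) = L2_inner \<sigma> (J (?U f)) (J (?U g))"
      by (rule Jinner[OF U_K[OF f] U_K[OF g], symmetric])
    also have "\<dots> = L2_inner \<sigma> (\<lambda>x. fst x * J f x) (\<lambda>x. fst x * J g x)"
      by (intro L2_inner_cong_AE JU f g Jmeas U_K L2_measurable[OF M_L2(1)] JL2)
    also have "\<dots> = L2_inner \<sigma> (J f) (J g)"
      unfolding L2_inner_def
    proof (rule Bochner_Integration.integral_cong[OF refl])
      fix x assume "x \<in> space \<sigma>"
      have "fst x * J f x * cnj (fst x * J g x) = (fst x * cnj (fst x)) * (J f x * cnj (J g x))"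
        by (simp add: mult_ac)
      then show "fst x * J f x * cnj (fst x * J g x) = J f x * cnj (J g x)"
        using unimod(1)[OF \<open>x \<in> space \<sigma>\<close>] by simp
    qed
    also have "\<dots> = H2_inner f g" by (rule Jinner[OF f g])
    finally show "H2_inner (?U f) (?U g) = H2_inner f g" .
  next
    fix f c assume f: "f \<in> ?K"
    note cf = model_space_cmult[OF \<phi> f, of c] and cUf = model_space_cmult[OF \<phi> U_K[OF f], of c]
    have "AE x in \<sigma>. J (?U (\<lambda>z. c * f z)) x = J (\<lambda>z. c * ?U f z) x"
      using JU[OF cf] JU[OF f] Jcmult[OF f, of c] Jcmult[OF U_K[OF f], of c]
      by eventually_elim (simp add: mult.left_commute)
    then show "?U (\<lambda>z. c * f z) = (\<lambda>z. c * ?U f z)"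
      by (rule Jinj[OF U_K[OF cf] cUf])
  qed

  \<comment> \<open>\<open>J\<close> is a surjective isometry, so its adjoint is its inverse: the
    adjoint applied to g is the f with J f = g.\<close>
  have "AE x in \<sigma>. fst x * g x = J (?U (L2_adjoint ?K \<sigma> J g)) x" if g: "g \<in> L2 \<sigma>" for g
  proof -
    obtain f where f: "f \<in> ?K" and Jf: "AE x in \<sigma>. J f x = g x"
      using Jsurj[OF g] by blast
    have inner: "L2_inner \<sigma> (J h) g = H2_inner h f" if h: "h \<in> ?K" for h
    proof -
      have "L2_inner \<sigma> (J h) (J f) = L2_inner \<sigma> (J h) g"
        by (intro L2_inner_cong_AE Jf Jmeas h f L2_measurable[OF g]) auto
      then show ?thesis by (simp add: Jinner[OF h f])
    qed
    have "L2_adjoint ?K \<sigma> J g = f"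
      unfolding L2_adjoint_def
    proof (rule the_equality)
      show "f \<in> ?K \<and> (\<forall>h\<in>?K. L2_inner \<sigma> (J h) g = H2_inner h f)"
        using f inner by blast
      fix f' assume f': "f' \<in> ?K \<and> (\<forall>h\<in>?K. L2_inner \<sigma> (J h) g = H2_inner h f')"
      show "f' = f"
      proof (rule model_space_eqI[OF \<phi> _ f])
        fix h assume h: "h \<in> ?K"
        then have "H2_inner h f' = H2_inner h f"
          using f' inner[OF h] by auto
        then show "H2_inner f' h = H2_inner f h"
          using H2_inner_commute[of f' h] H2_inner_commute[of f h] by simp
      qed (use f' in blast)
    qed
    moreover have "AE x in \<sigma>. fst x * g x = J (?U f) x"
      using JU[OF f] Jf by eventually_elim simp
    ultimately show ?thesis by simp
  qed
  with unitary show ?thesis by blast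
qed

end
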